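(* For any virtual link diagram $D$, the parallel diagram $\phi_-(D)$ admits an Alexander numbering. Thus, the welded link represented by $\phi_-(D)$ is almost classical.
   Context: **Diagrams.** A virtual link diagram is a generic immersion of finitely many oriented circles in the plane (considered up to planar isotopy) whose double points are transverse and each marked either as a classical crossing (with over/under information) or as a virtual crossing (no over/under information). A classical crossing is positive if the direction of the over strand is carried to the direction of the under strand by a counterclockwise rotation through an angle less than $\pi$, and negative otherwise. **Welded equivalence.** Two virtual link diagrams are equivalent as welded links if they are related by a finite sequence of planar isotopies and the following local moves (with all orientations): the classical Reidemeister moves I, II, III; the virtual Reidemeister moves, namely the moves I, II, III with all crossings virtual, and the mixed move IV in which a strand meeting two other strands only in virtual crossings is moved across a classical crossing of those two strands; and the welded move, in which a strand passing over (by two classical crossings) two other strands that cross each other virtually is moved across that virtual crossing, remaining over both strands. A welded link is an equivalence class of virtual link diagrams under this relation. **The parallel diagram $\phi_-(D)$.** Given a virtual link diagram $D$, replace every strand $s$ of $D$ by two parallel copies, $s_{\rm R}$ on the right and $s_{\rm L}$ on the left of $s$ (with respect to the orientation of $D$). The crossings are as follows. - At a virtual crossing of $D$, all four resulting crossings are virtual. - At a classical crossing of $D$ with over strand $o$ and under strand $u$: $o_{\rm R}$ and $u_{\rm R}$ cross classically with $o_{\rm R}$ over $u_{\rm R}$; $o_{\rm R}$ and $u_{\rm L}$ cross classically with $o_{\rm R}$ over $u_{\rm L}$; the crossing of $o_{\rm L}$ with $u_{\rm R}$ and that of $o_{\rm L}$ with $u_{\rm L}$ are virtual. Moreover a twist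 is inserted in the pair $(u_{\rm R},u_{\rm L})$ near the crossing. If the crossing of $D$ is positive, then immediately after the crossing along $u$ insert a $-1v$-twist: travelling along $u$, the strands $u_{\rm R},u_{\rm L}$ cross each other first at a classical crossing with $u_{\rm R}$ over $u_{\rm L}$ (a negative crossing when both are oriented parallel to $u$) and then at a virtual crossing, after which $u_{\rm R}$ is again on the right. If the crossing of $D$ is negative, then immediately before the crossing along $u$ insert a $v1$-twist: travelling along $u$, the strands $u_{\rm R},u_{\rm L}$ cross first at a virtual crossing and then at a classical crossing with $u_{\rm R}$ over $u_{\rm L}$ (a positive crossing when both are oriented parallel to $u$). Away from the crossings of $D$ the two copies are just parallel. In $\phi_-(D)$ the right copies are oriented parallel to $D$ and the left copies are oriented opposite to $D$. **Alexander numbering.** Cut a virtual link diagram at all of its classical crossings (both the over and the under strand are cut; virtual crossings are ignored), obtaining a collection of arcs. An Alexander numbering is an assignment of an integer to each arc such that at every classical crossing there is an integer $i$ with the following property: looking in the common forward direction of the two strands, the two arcs on the right-hand side (the incoming right arc and the outgoing right arc) both receive $i$, and the two arcs on the left-hand side (the incoming left arc and the outgoing left arc) both receive $i+1$. At virtual crossings the number is unchanged along each strand. A welded link is almost classical if it is represented by some virtual link diagram that admits an Alexander numbering. *)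

theory Defs
  imports "HOL-Analysis.Analysis"
begin

section \<open>Virtual link diagrams\<close>

text \<open>
  A diagram consists of closed plane curves \<open>curve D i\<close>, \<open>i < components D\<close>, each given as a
  1-periodic map on the real line, so that a point of the \<open>i\<close>-th source circle is a real parameter
  modulo the integers; the orientation is that of increasing parameter.  \<open>over D i t\<close> says that
  the \<open>i\<close>-th curve, at parameter \<open>t\<close>, is the over strand of a classical crossing.  A double point at
  which neither passage is marked in this way is a virtual crossing.
\<close>

record virtual_diagram =
  components :: nat
  curve :: "nat \<Rightarrow> real \<Rightarrow> complex"
  over :: "nat \<Rightarrow> real \<Rightarrow> bool"

definition smooth :: "(real \<Rightarrow> 'a::real_normed_vector) \<Rightarrow> bool" where
  "smooth g \<longleftrightarrow> (\<forall>n. ((\<lambda>h t. vector_derivative h (at t)) ^^ n) g differentiable_on UNIV)"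

definition velocity :: "virtual_diagram \<Rightarrow> nat \<Rightarrow> real \<Rightarrow> complex" where
  "velocity D i t = vector_derivative (curve D i) (at t)"

text \<open>
  \<open>turn v w\<close> is the determinant of the pair \<open>(v, w)\<close>: it is positive iff the direction of \<open>v\<close> is
  carried to that of \<open>w\<close> by a counterclockwise rotation through an angle strictly between
  \<open>0\<close> and \<open>\<pi>\<close>, and zero iff \<open>v\<close> and \<open>w\<close> are linearly dependent over the reals.
\<close>

definition turn :: "complex \<Rightarrow> complex \<Rightarrow> real" where
  "turn v w = Im (cnj v * w)"

definition meets :: "virtual_diagram \<Rightarrow> nat \<Rightarrow> real \<Rightarrow> nat \<Rightarrow> real \<Rightarrow> bool" where
  "meets D i s j t \<longleftrightarrow> i < components D \<and> j < components D \<and> \<not> (i = j \<and> s - t \<in> \<int>) \<and>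
     curve D i s = curve D j t"

definition virtual_link_diagram :: "virtual_diagram \<Rightarrow> bool" where
  "virtual_link_diagram D \<longleftrightarrow>
     (\<forall>i < components D. smooth (curve D i) \<and>
        (\<forall>t. curve D i (t + 1) = curve D i t \<and> velocity D i t \<noteq> 0 \<and> over D i (t + 1) = over D i t)) \<and>
     finite {(i, s, j, t). meets D i s j t \<and> s \<in> {0..<1} \<and> t \<in> {0..<1}} \<and>
     (\<forall>i s j t. meets D i s j t \<longrightarrow> turn (velocity D i s) (velocity D j t) \<noteq> 0) \<and>
     (\<forall>i s j t k u. meets D i s j t \<and> meets D i s k u \<longrightarrow> j = k \<and> t - u \<in> \<int>) \<and>
     (\<forall>i < components D. \<forall>s. over D i s \<longrightarrow> (\<exists>j t. meets D i s j t \<and> \<not> over D j t))"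

text \<open>In \<open>classical_crossing D i s j t\<close> the over strand comes first.\<close>

definition classical_crossing :: "virtual_diagram \<Rightarrow> nat \<Rightarrow> real \<Rightarrow> nat \<Rightarrow> real \<Rightarrow> bool" where
  "classical_crossing D i s j t \<longleftrightarrow> meets D i s j t \<and> over D i s \<and> \<not> over D j t"

definition virtual_crossing :: "virtual_diagram \<Rightarrow> nat \<Rightarrow> real \<Rightarrow> nat \<Rightarrow> real \<Rightarrow> bool" where
  "virtual_crossing D i s j t \<longleftrightarrow> meets D i s j t \<and> \<not> over D i s \<and> \<not> over D j t"

definition positive_crossing :: "virtual_diagram \<Rightarrow> nat \<Rightarrow> real \<Rightarrow> nat \<Rightarrow> real \<Rightarrow> bool" where
  "positive_crossing D i s j t \<longleftrightarrow>
     classical_crossing D i s j t \<and> turn (velocity D i s) (velocity D j t) > 0"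


section \<open>Welded equivalence\<close>

text \<open>
  Planar isotopy is ambient isotopy of the plane, up to renumbering the components and
  orientation-preserving reparametrisation of the circles.
\<close>

definition planar_isotopic :: "virtual_diagram \<Rightarrow> virtual_diagram \<Rightarrow> bool" where
  "planar_isotopic D D' \<longleftrightarrow> components D' = components D \<and>
     (\<exists>(H :: real \<Rightarrow> complex \<Rightarrow> complex) p \<theta>.
        continuous_on ({0..1} \<times> UNIV) (\<lambda>(u, z). H u z) \<and>
        (\<forall>u \<in> {0..1}. \<exists>g. homeomorphism UNIV UNIV (H u) g) \<and>
        (\<forall>z. H 0 z = z) \<and>
        bij_betw p {..<components D} {..<components D} \<and>
        (\<forall>i < components D. continuous_on UNIV (\<theta> i) \<and> strict_mono (\<theta> i) \<and>
           (\<forall>t :: real. \<theta> i (t + 1) = \<theta> i t + (1 :: real) \<and>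
              curve D' (p i) (\<theta> i t) = H 1 (curve D i t) \<and>
              over D' (p i) (\<theta> i t) = over D i t)))"

text \<open>
  A local move changes a diagram only inside a round disc, which the diagram meets in finitely many
  strands; such a strand \<open>(i, a, b)\<close> is the part of the \<open>i\<close>-th curve with parameters in \<open>{a..b}\<close>
  (modulo the integers) and runs properly from boundary to boundary.  Up to planar isotopy, the
  picture inside the disc is determined by the number of crossings between the strands, except that
  three strands which cross pairwise once can be arranged in two ways, which are related by moving
  one strand across the crossing of the other two.
\<close>

type_synonym strand = "nat \<times> real \<times> real"

fun on_strand :: "strand \<Rightarrow> nat \<Rightarrow> real \<Rightarrow> bool" where
  "on_strand (i, a, b) j t \<longleftrightarrow> j = i \<and> (\<exists>m :: int. t + of_int m \<in> {a..b})"

fun inside_strand :: "strand \<Rightarrow> nat \<Rightarrow> real \<Rightarrow> bool" where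
  "inside_strand (i, a, b) j t \<longleftrightarrow> j = i \<and> (\<exists>m :: int. t + of_int m \<in> {a<..<b})"

definition strands_in_disc :: "virtual_diagram \<Rightarrow> complex \<Rightarrow> real \<Rightarrow> strand set \<Rightarrow> bool" where
  "strands_in_disc D z r A \<longleftrightarrow>
     (\<forall>(i, a, b) \<in> A. i < components D \<and> a < b \<and> b < a + 1) \<and>
     (\<forall>P \<in> A. \<forall>Q \<in> A. \<forall>i t. on_strand P i t \<and> on_strand Q i t \<longrightarrow> P = Q) \<and>
     (\<forall>i < components D. \<forall>t.
        (curve D i t \<in> cball z r \<longleftrightarrow> (\<exists>P \<in> A. on_strand P i t)) \<and>
        (curve D i t \<in> ball z r \<longleftrightarrow> (\<exists>P \<in> A. inside_strand P i t))) \<and>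
     (\<forall>i s j t. meets D i s j t \<longrightarrow> curve D i s \<notin> sphere z r)"

definition agree_outside :: "virtual_diagram \<Rightarrow> virtual_diagram \<Rightarrow> complex \<Rightarrow> real \<Rightarrow> bool" where
  "agree_outside D D' z r \<longleftrightarrow> components D' = components D \<and>
     (\<forall>i < components D. \<forall>t. curve D i t \<notin> ball z r \<or> curve D' i t \<notin> ball z r \<longrightarrow>
        curve D' i t = curve D i t \<and> over D' i t = over D i t)"

definition local_change ::
    "virtual_diagram \<Rightarrow> virtual_diagram \<Rightarrow> strand set \<Rightarrow> bool" where
  "local_change D D' A \<longleftrightarrow>
     (\<exists>z r. r > 0 \<and> agree_outside D D' z r \<and> strands_in_disc D z r A \<and> strands_in_disc D' z r A)"

text \<open>For \<open>P = Q\<close> each self-crossing of the strand is counted once.\<close>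

fun crossings :: "virtual_diagram \<Rightarrow> strand \<Rightarrow> strand \<Rightarrow> (real \<times> real) set" where
  "crossings D (i, a, b) (j, c, d) =
     {(s, t). s \<in> {a..b} \<and> t \<in> {c..d} \<and> meets D i s j t \<and> ((i, a, b) = (j, c, d) \<longrightarrow> s < t)}"

definition all_over :: "virtual_diagram \<Rightarrow> strand \<Rightarrow> strand \<Rightarrow> bool" where
  "all_over D P Q \<longleftrightarrow> (\<forall>(s, t) \<in> crossings D P Q. classical_crossing D (fst P) s (fst Q) t)"

definition all_virtual :: "virtual_diagram \<Rightarrow> strand \<Rightarrow> strand \<Rightarrow> bool" where
  "all_virtual D P Q \<longleftrightarrow> (\<forall>(s, t) \<in> crossings D P Q. virtual_crossing D (fst P) s (fst Q) t)"

text \<open>The move creates a kink whose crossing may be of any type.\<close>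

definition move_I :: "virtual_diagram \<Rightarrow> virtual_diagram \<Rightarrow> bool" where
  "move_I D D' \<longleftrightarrow>
     (\<exists>P. local_change D D' {P} \<and> crossings D P P = {} \<and> card (crossings D' P P) = 1)"

definition move_II :: "virtual_diagram \<Rightarrow> virtual_diagram \<Rightarrow> bool" where
  "move_II D D' \<longleftrightarrow>
     (\<exists>P Q. P \<noteq> Q \<and> local_change D D' {P, Q} \<and>
        (\<forall>X \<in> {D, D'}. crossings X P P = {} \<and> crossings X Q Q = {}) \<and>
        crossings D P Q = {} \<and> card (crossings D' P Q) = 2 \<and>
        (all_over D' P Q \<or> all_virtual D' P Q))"

text \<open>
  The four alternatives are: the classical move, the virtual move, the mixed move (\<open>P\<close> moves
  virtually across a classical crossing), and the welded move (\<open>P\<close> moves over a virtual crossing).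
\<close>

definition move_III :: "virtual_diagram \<Rightarrow> virtual_diagram \<Rightarrow> bool" where
  "move_III D D' \<longleftrightarrow>
     (\<exists>P Q R. P \<noteq> Q \<and> P \<noteq> R \<and> Q \<noteq> R \<and> local_change D D' {P, Q, R} \<and>
        (\<forall>X \<in> {D, D'}. crossings X P P = {} \<and> crossings X Q Q = {} \<and> crossings X R R = {} \<and>
           card (crossings X P Q) = 1 \<and> card (crossings X P R) = 1 \<and> card (crossings X Q R) = 1) \<and>
        ((\<forall>X \<in> {D, D'}. all_over X P Q \<and> all_over X P R \<and> all_over X Q R) \<or>
         (\<forall>X \<in> {D, D'}. all_virtual X P Q \<and> all_virtual X P R \<and> all_virtual X Q R) \<or>
         (\<forall>X \<in> {D, D'}. all_virtual X P Q \<and> all_virtual X P R \<and> all_over X Q R) \<or>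
         (\<forall>X \<in> {D, D'}. all_over X P Q \<and> all_over X P R \<and> all_virtual X Q R)))"

definition welded_step :: "virtual_diagram \<Rightarrow> virtual_diagram \<Rightarrow> bool" where
  "welded_step D D' \<longleftrightarrow> virtual_link_diagram D \<and> virtual_link_diagram D' \<and>
     (planar_isotopic D D' \<or> move_I D D' \<or> move_II D D' \<or> move_III D D')"

definition welded_link :: "virtual_diagram \<Rightarrow> virtual_diagram set" where
  "welded_link D = {D'. virtual_link_diagram D' \<and> equivclp welded_step D D'}"


section \<open>Alexander numberings\<close>

definition cut_point :: "virtual_diagram \<Rightarrow> nat \<Rightarrow> real \<Rightarrow> bool" where
  "cut_point D i s \<longleftrightarrow> (\<exists>j t. classical_crossing D i s j t \<or> classical_crossing D j t i s)"

text \<open>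
  The number of an arc is recorded at each of its points; the values at the cut points themselves
  are irrelevant.
\<close>

definition incoming :: "(nat \<Rightarrow> real \<Rightarrow> int) \<Rightarrow> nat \<Rightarrow> real \<Rightarrow> int \<Rightarrow> bool" where
  "incoming \<nu> i s k \<longleftrightarrow> (\<forall>\<^sub>F r in at_left s. \<nu> i r = k)"

definition outgoing :: "(nat \<Rightarrow> real \<Rightarrow> int) \<Rightarrow> nat \<Rightarrow> real \<Rightarrow> int \<Rightarrow> bool" where
  "outgoing \<nu> i s k \<longleftrightarrow> (\<forall>\<^sub>F r in at_right s. \<nu> i r = k)"

text \<open>
  If the second strand is directed to the left of the first one, then, looking in the common forward
  direction, the first strand comes in on the left and goes out on the right, and the second strand
  comes in on the right and goes out on the left.  Of the two strands at a crossing exactly one can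
  play the role of the first.
\<close>

definition alexander_numbering :: "virtual_diagram \<Rightarrow> (nat \<Rightarrow> real \<Rightarrow> int) \<Rightarrow> bool" where
  "alexander_numbering D \<nu> \<longleftrightarrow>
     (\<forall>i < components D. \<forall>t. \<nu> i (t + 1) = \<nu> i t) \<and>
     (\<forall>i < components D. \<forall>s t. s < t \<and> (\<forall>r \<in> {s..t}. \<not> cut_point D i r) \<longrightarrow> \<nu> i s = \<nu> i t) \<and>
     (\<forall>i s j t. (classical_crossing D i s j t \<or> classical_crossing D j t i s) \<and>
        turn (velocity D i s) (velocity D j t) > 0 \<longrightarrow>
        (\<exists>k. incoming \<nu> j t k \<and> outgoing \<nu> i s k \<and>
             incoming \<nu> i s (k + 1) \<and> outgoing \<nu> j t (k + 1)))"

definition admits_alexander_numbering :: "virtual_diagram \<Rightarrow> bool" where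
  "admits_alexander_numbering D \<longleftrightarrow> (\<exists>\<nu>. alexander_numbering D \<nu>)"

definition almost_classical :: "virtual_diagram set \<Rightarrow> bool" where
  "almost_classical K \<longleftrightarrow> (\<exists>D \<in> K. admits_alexander_numbering D)"


section \<open>The parallel diagram\<close>

text \<open>
  The copies of the \<open>i\<close>-th curve are its pushoffs by \<open>\<epsilon> * f i t\<close> times the velocity rotated by a
  right angle, to the right and to the left.  The function \<open>f i\<close> is positive, except that it changes
  sign twice at every twist: its zeros are the places where the two copies cross each other.  The
  zeros of a twist lie on the under strand, just after a positive or just before a negative crossing
  of \<open>D\<close>; the number \<open>\<delta>\<close> separates the crossings of \<open>D\<close> along its components.
\<close>

definition positive_under :: "virtual_diagram \<Rightarrow> nat \<Rightarrow> real \<Rightarrow> bool" where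
  "positive_under D j t \<longleftrightarrow> (\<exists>i s. positive_crossing D i s j t)"

definition negative_under :: "virtual_diagram \<Rightarrow> nat \<Rightarrow> real \<Rightarrow> bool" where
  "negative_under D j t \<longleftrightarrow> (\<exists>i s. classical_crossing D i s j t \<and> \<not> positive_crossing D i s j t)"

definition twist_zeros ::
    "virtual_diagram \<Rightarrow> real \<Rightarrow> (nat \<Rightarrow> real \<Rightarrow> real) \<Rightarrow> nat \<Rightarrow> real \<Rightarrow> real set" where
  "twist_zeros D \<delta> f j t =
     {r. f j r = 0 \<and> (if positive_under D j t then t < r \<and> r < t + \<delta> else t - \<delta> < r \<and> r < t)}"

definition twist_profile :: "virtual_diagram \<Rightarrow> real \<Rightarrow> (nat \<Rightarrow> real \<Rightarrow> real) \<Rightarrow> bool" where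
  "twist_profile D \<delta> f \<longleftrightarrow>
     \<delta> > 0 \<and>
     (\<forall>i s s' j t j' t'. meets D i s j t \<and> meets D i s' j' t' \<and> s \<noteq> s' \<longrightarrow> \<bar>s - s'\<bar> \<ge> 2 * \<delta>) \<and>
     (\<forall>j < components D.
        smooth (f j) \<and>
        (\<forall>r. f j (r + 1) = f j r) \<and>
        (\<forall>r. f j r = 0 \<longrightarrow> deriv (f j) r \<noteq> 0) \<and>
        (\<forall>t. positive_under D j t \<or> negative_under D j t \<longrightarrow> card (twist_zeros D \<delta> f j t) = 2) \<and>
        (\<forall>r. f j r \<le> 0 \<longrightarrow>
           (\<exists>t. (positive_under D j t \<and> t < r \<and> r < t + \<delta>) \<or>
                (negative_under D j t \<and> t - \<delta> < r \<and> r < t))))"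

definition right_copy ::
    "virtual_diagram \<Rightarrow> (nat \<Rightarrow> real \<Rightarrow> real) \<Rightarrow> real \<Rightarrow> nat \<Rightarrow> real \<Rightarrow> complex" where
  "right_copy D f \<epsilon> i t = curve D i t - of_real (\<epsilon> * f i t) * (\<i> * velocity D i t)"

definition left_copy ::
    "virtual_diagram \<Rightarrow> (nat \<Rightarrow> real \<Rightarrow> real) \<Rightarrow> real \<Rightarrow> nat \<Rightarrow> real \<Rightarrow> complex" where
  "left_copy D f \<epsilon> i t = curve D i t + of_real (\<epsilon> * f i t) * (\<i> * velocity D i t)"

text \<open>
  The places where the right copy of the \<open>i\<close>-th curve is the over strand of a classical crossing
  of the parallel diagram: where it crosses a copy of the under strand near a classical crossing
  of \<open>D\<close>, and at the classical crossing of a twist, which is the first of its two crossings near a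
  positive and the last one near a negative crossing of \<open>D\<close>.  The left copy is never over.
\<close>

definition right_copy_over ::
    "virtual_diagram \<Rightarrow> real \<Rightarrow> (nat \<Rightarrow> real \<Rightarrow> real) \<Rightarrow> real \<Rightarrow> nat \<Rightarrow> real \<Rightarrow> bool" where
  "right_copy_over D \<delta> f \<epsilon> i r \<longleftrightarrow>
     (\<exists>s j t q. classical_crossing D i s j t \<and> \<bar>r - s\<bar> < \<delta> \<and> \<bar>q - t\<bar> < \<delta> \<and>
        right_copy D f \<epsilon> i r \<in> {right_copy D f \<epsilon> j q, left_copy D f \<epsilon> j q}) \<or>
     (\<exists>t. positive_under D i t \<and> r = Min (twist_zeros D \<delta> f i t)) \<or>
     (\<exists>t. negative_under D i t \<and> r = Max (twist_zeros D \<delta> f i t))"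

text \<open>
  Component \<open>2 * i\<close> is the right copy of the \<open>i\<close>-th curve, component \<open>2 * i + 1\<close> the left copy with
  reversed orientation.  For small \<open>\<epsilon> > 0\<close> this is the diagram \<open>\<phi>\<^sub>-(D)\<close>.
\<close>

definition phi_minus ::
    "virtual_diagram \<Rightarrow> real \<Rightarrow> (nat \<Rightarrow> real \<Rightarrow> real) \<Rightarrow> real \<Rightarrow> virtual_diagram" where
  "phi_minus D \<delta> f \<epsilon> =
     \<lparr>components = 2 * components D,
      curve = (\<lambda>k t. if even k then right_copy D f \<epsilon> (k div 2) t else left_copy D f \<epsilon> (k div 2) (- t)),
      over = (\<lambda>k t. even k \<and> right_copy_over D \<delta> f \<epsilon> (k div 2) t)\<rparr>"

end

(* A right and a left copy of a strand of D are its pushoffs by -eps and +eps times f times the normal.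
   For small eps, two copies meet only at the zeros of f on one strand, or near a crossing of D, where
   each pair of copies meets exactly once (contraction principle).  Hence the classical crossings on
   every component of the parallel diagram come in pairs, one pair for each over passage of a right
   copy (it crosses the two oppositely directed copies of the under strand) and one pair for each
   under passage of either copy (the crossing below the right copy of the over strand, and the
   classical crossing of the inserted twist).  In each pair the component first plays the role of the
   strand whose number increases and then that of the strand whose number decreases.  So the number 1
   between the two crossings of a pair and 0 elsewhere is an Alexander numbering. *)

theory Submission
  imports Defs
begin


section \<open>Smooth functions\<close>

text \<open>Why every pair starts with the rising role. Over passage: the copies of the under strand
  are traversed in opposite directions, so the right over copy plays opposite roles at them; it
  meets the left one first exactly when the crossing is positive, and for either sign the first
  meeting is the rising one. Under passage: at a positive crossing the right under copy rises below
  the right over copy and falls at the twist placed after it; at a negative crossing it falls there,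
  and the twist placed before has raised it. For the reversed left copy both the roles and the order
  of the two crossings are exchanged, so one twist serves both copies. The analytic difficulty is
  the order in which the two under copies are met: the two places are only of order
  \<open>\<epsilon>\<close> apart, so errors must be small multiples of \<open>\<epsilon>\<close>.
  This dictates the order of choice: global bounds \<open>K\<close>, \<open>\<tau>\<close>,
  \<open>\<phi>\<close>, then the relative error \<open>\<kappa>\<close>, then the radius
  \<open>\<eta>\<close> of the neighbourhoods of crossings, and \<open>\<epsilon>\<close>
  last.\<close>

definition times_diff :: "nat \<Rightarrow> (real \<Rightarrow> 'a::real_normed_vector) \<Rightarrow> bool" where
  "times_diff n g \<longleftrightarrow> (\<forall>m\<le>n. ((\<lambda>h t. vector_derivative h (at t)) ^^ m) g differentiable_on UNIV)"

lemma smooth_iff_times_diff: "smooth g \<longleftrightarrow> (\<forall>n. times_diff n g)"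
  by (auto simp: smooth_def times_diff_def)

lemma times_diff_0: "times_diff 0 g \<longleftrightarrow> g differentiable_on UNIV"
  by (simp add: times_diff_def)

text \<open>Peels off the first derivative, not the last, so that closure properties of
  \<open>smooth\<close> can be proved by induction on the order with the function
  generalised.\<close>

lemma times_diff_Suc:
  "times_diff (Suc n) g \<longleftrightarrow>
     g differentiable_on UNIV \<and> times_diff n (\<lambda>t. vector_derivative g (at t))"
proof -
  have "times_diff (Suc n) g \<longleftrightarrow> (\<forall>m\<in>insert 0 (Suc ` {..n}).
     ((\<lambda>h t. vector_derivative h (at t)) ^^ m) g differentiable_on UNIV)"
    by (simp only: times_diff_def atMost_Suc_eq_insert_0[symmetric] Ball_def atMost_iff)
  then show ?thesis
    by (auto simp: times_diff_def funpow_swap1 simp del: funpow.simps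
        simp: funpow_Suc_right)
qed

lemma times_diff_SucI:
  assumes "\<And>t. (g has_vector_derivative g' t) (at t)" "times_diff n g'"
  shows "times_diff (Suc n) g"
proof -
  have "(\<lambda>t. vector_derivative g (at t)) = g'"
    using assms(1) by (auto intro: vector_derivative_at)
  then show ?thesis using assms
    by (auto simp: times_diff_Suc differentiable_on_def
        intro: differentiableI_vector)
qed

lemma times_diff_0I:
  assumes "\<And>t. (g has_vector_derivative g' t) (at t)"
  shows "times_diff 0 g"
  using assms by (auto simp: times_diff_0 differentiable_on_def intro: differentiableI_vector)

lemma times_diff_mono: "times_diff n g \<Longrightarrow> m \<le> n \<Longrightarrow> times_diff m g"
  by (auto simp: times_diff_def)

lemma times_diff_has_vector_derivative:
  assumes "times_diff n g"
  shows "(g has_vector_derivative vector_derivative g (at t)) (at t)"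
  using times_diff_mono[OF assms, of 0]
  by (simp add: times_diff_0 differentiable_on_def vector_derivative_works)

lemma times_diff_add:
  assumes "times_diff n g" "times_diff n h"
  shows "times_diff n (\<lambda>t. g t + h t)"
  using assms
proof (induction n arbitrary: g h)
  case 0
  show ?case
    by (rule times_diff_0I has_vector_derivative_add)+
      (use 0 times_diff_has_vector_derivative in blast)+
next
  case (Suc n)
  show ?case
  proof (rule times_diff_SucI)
    show "((\<lambda>t. g t + h t) has_vector_derivative
        vector_derivative g (at t) + vector_derivative h (at t)) (at t)" for t
      by (intro has_vector_derivative_add)
        (use Suc.prems times_diff_has_vector_derivative in blast)+
    show "times_diff n (\<lambda>t. vector_derivative g (at t) + vector_derivative h (at t))"
      using Suc by (auto simp: times_diff_Suc)
  qed
qed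

text \<open>One induction serves real multiples, complex products and real products alike. By the
  product rule the derivative is a sum of two expressions of the same kind, of order one
  lower.\<close>

lemma times_diff_bilinear:
  assumes "bounded_bilinear b" "times_diff n g" "times_diff n h"
  shows "times_diff n (\<lambda>t. b (g t) (h t))"
  using assms(2,3)
proof (induction n arbitrary: g h)
  case 0
  show ?case
    by (rule times_diff_0I bounded_bilinear.has_vector_derivative[OF assms(1)])+
      (use 0 times_diff_has_vector_derivative in blast)+
next
  case (Suc n)
  show ?case
  proof (rule times_diff_SucI)
    show "((\<lambda>t. b (g t) (h t)) has_vector_derivative
        b (g t) (vector_derivative h (at t)) + b (vector_derivative g (at t)) (h t)) (at t)" for t
      by (intro bounded_bilinear.has_vector_derivative[OF assms(1)])
        (use Suc.prems times_diff_has_vector_derivative in blast)+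
    show "times_diff n (\<lambda>t. b (g t) (vector_derivative h (at t)) + b (vector_derivative g (at t)) (h t))"
      using Suc times_diff_mono[OF Suc.prems(1), of n] times_diff_mono[OF Suc.prems(2), of n]
      by (intro times_diff_add Suc.IH) (auto simp: times_diff_Suc)
  qed
qed

lemma times_diff_const: "times_diff n (\<lambda>t. c)"
proof (induction n arbitrary: c)
  case 0 show ?case by (rule times_diff_0I has_vector_derivative_const)+
next
  case (Suc n) show ?case
    by (rule times_diff_SucI has_vector_derivative_const)+ (rule Suc)
qed

lemma times_diff_reverse:
  assumes "times_diff n g"
  shows "times_diff n (\<lambda>t. g (- t))"
  using assms
proof (induction n arbitrary: g)
  case 0
  have "((\<lambda>t. g (- t)) has_vector_derivative (- 1) *\<^sub>R vector_derivative g (at (- t))) (at t)" for t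
    using vector_diff_chain_at[OF has_vector_derivative_minus[OF has_vector_derivative_id]
        times_diff_has_vector_derivative[OF 0]] by (simp add: o_def)
  then show ?case by (rule times_diff_0I)
next
  case (Suc n)
  have "((\<lambda>t. g (- t)) has_vector_derivative (- 1) *\<^sub>R vector_derivative g (at (- t))) (at t)" for t
    using vector_diff_chain_at[OF has_vector_derivative_minus[OF has_vector_derivative_id]
        times_diff_has_vector_derivative[OF Suc.prems]] by (simp add: o_def)
  moreover have "times_diff n (\<lambda>t. (- 1) *\<^sub>R vector_derivative g (at (- t)))"
    using Suc by (intro times_diff_bilinear[OF bounded_bilinear_scaleR] times_diff_const)
      (auto simp: times_diff_Suc)
  ultimately show ?case by (rule times_diff_SucI)
qed

text \<open>Differentiation only rescales the amplitude and shifts the phase by a quarter turn, so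
  the family is closed under it once \<open>a\<close> and \<open>d\<close> are generalised.\<close>

lemma times_diff_cos: "times_diff n (\<lambda>t::real. a * cos (c * t + d))"
proof (induction n arbitrary: a d)
  case 0
  show ?case
    by (rule times_diff_0I, subst has_real_derivative_iff_has_vector_derivative[symmetric])
      (rule derivative_eq_intros refl | simp)+
next
  case (Suc n)
  have "((\<lambda>t. a * cos (c * t + d)) has_vector_derivative (- a * c) * cos (c * t + (d - pi / 2))) (at t)"
    for t
    unfolding has_real_derivative_iff_has_vector_derivative[symmetric]
    by (rule derivative_eq_intros refl | simp)+
      (simp add: cos_diff diff_add_eq add_diff_eq cos_minus[of "_ - _", symmetric] 
        flip: sin_cos_eq cos_sin_eq)
  then show ?case by (rule times_diff_SucI) (rule Suc)
qed

lemma smooth_add: "smooth g \<Longrightarrow> smooth h \<Longrightarrow> smooth (\<lambda>t. g t + h t)"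
  by (simp add: smooth_iff_times_diff times_diff_add)

lemma smooth_bilinear: "bounded_bilinear b \<Longrightarrow> smooth g \<Longrightarrow> smooth h \<Longrightarrow> smooth (\<lambda>t. b (g t) (h t))"
  by (simp add: smooth_iff_times_diff times_diff_bilinear)

lemma smooth_const: "smooth (\<lambda>t. c)"
  by (simp add: smooth_iff_times_diff times_diff_const)

lemma smooth_reverse: "smooth g \<Longrightarrow> smooth (\<lambda>t. g (- t))"
  by (simp add: smooth_iff_times_diff times_diff_reverse)

lemma smooth_cos: "smooth (\<lambda>t::real. a * cos (c * t + d))"
  by (simp add: smooth_iff_times_diff times_diff_cos)

lemma smooth_derivative: "smooth g \<Longrightarrow> smooth (\<lambda>t. vector_derivative g (at t))"
  using times_diff_Suc[of _ g] by (auto simp: smooth_iff_times_diff)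

lemma smooth_has_vector_derivative:
  "smooth g \<Longrightarrow> (g has_vector_derivative vector_derivative g (at t)) (at t)"
  using times_diff_has_vector_derivative[of 0 g] by (simp add: smooth_iff_times_diff)

lemma smooth_continuous_on: "smooth g \<Longrightarrow> continuous_on S g"
  by (rule continuous_at_imp_continuous_on)
    (blast intro: has_vector_derivative_continuous smooth_has_vector_derivative)

lemma smooth_prod:
  fixes g :: "'a \<Rightarrow> real \<Rightarrow> real"
  assumes "\<And>x. x \<in> A \<Longrightarrow> smooth (g x)"
  shows "smooth (\<lambda>t. \<Prod>x\<in>A. g x t)"
  using assms
proof (induction A rule: infinite_finite_induct)
  case (insert x A)
  then show ?case
    using smooth_bilinear[OF bounded_bilinear_mult, of "g x" "\<lambda>t. \<Prod>x\<in>A. g x t"] by simp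
qed (simp_all add: smooth_const)


section \<open>Crossings of a virtual link diagram\<close>

lemma periodic_of_int:
  fixes g :: "real \<Rightarrow> 'a"
  assumes "\<And>t. g (t + 1) = g t"
  shows "g (t + of_int m) = g t"
proof (induction m rule: int_induct[of _ 0])
  case base then show ?case by simp
next
  case (step1 i)
  then show ?case using assms[of "t + of_int i"] by (simp add: add.assoc)
next
  case (step2 i)
  then show ?case using assms[of "t + of_int (i - 1)"] by (simp add: add.assoc)
qed

lemma turn_add_left: "turn (a + b) c = turn a c + turn b c"
  and turn_add_right: "turn c (a + b) = turn c a + turn c b"
  and turn_diff_left: "turn (a - b) c = turn a c - turn b c"
  and turn_diff_right: "turn c (a - b) = turn c a - turn c b"
  and turn_minus_left: "turn (- a) c = - turn a c"
  and turn_minus_right: "turn c (- a) = - turn c a"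
  and turn_scaleR_left: "turn (x *\<^sub>R a) c = x * turn a c"
  and turn_scaleR_right: "turn c (x *\<^sub>R a) = x * turn c a"
  and turn_mult_left: "turn (of_real x * a) c = x * turn a c"
  and turn_mult_right: "turn c (of_real x * a) = x * turn c a"
  and turn_self: "turn a a = 0"
  by (auto simp: turn_def algebra_simps)

lemmas turn_simps = turn_add_left turn_add_right turn_diff_left turn_diff_right turn_minus_left
  turn_minus_right turn_scaleR_left turn_scaleR_right turn_mult_left turn_mult_right turn_self

lemma turn_swap: "turn a b = - turn b a"
  by (simp add: turn_def)

lemma abs_turn_le: "\<bar>turn a b\<bar> \<le> norm a * norm b"
  unfolding turn_def by (metis abs_Im_le_cmod complex_mod_cnj norm_mult)

definition crossing_param :: "virtual_diagram \<Rightarrow> nat \<Rightarrow> real \<Rightarrow> bool" where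
  "crossing_param D i s \<longleftrightarrow> (\<exists>j t. meets D i s j t)"

lemma meets_sym: "meets D i s j t \<longleftrightarrow> meets D j t i s"
  unfolding meets_def by (auto simp: minus_diff_eq[symmetric, of s t] simp del: minus_diff_eq)

locale link_diagram =
  fixes D :: virtual_diagram
  assumes link_diagram: "virtual_link_diagram D"
begin

lemma smooth_curve: "i < components D \<Longrightarrow> smooth (curve D i)"
  and velocity_nonzero: "i < components D \<Longrightarrow> velocity D i t \<noteq> 0"
  using link_diagram by (auto simp: virtual_link_diagram_def)

lemma curve_periodic: "i < components D \<Longrightarrow> curve D i (t + of_int m) = curve D i t"
  and over_periodic: "i < components D \<Longrightarrow> over D i (t + of_int m) = over D i t"
  using link_diagram by (auto simp: virtual_link_diagram_def intro!: periodic_of_int)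

lemma velocity_eq: "velocity D i = (\<lambda>t. vector_derivative (curve D i) (at t))"
  by (auto simp: velocity_def)

lemma smooth_velocity: "i < components D \<Longrightarrow> smooth (velocity D i)"
  unfolding velocity_eq by (intro smooth_derivative smooth_curve)

lemma curve_has_derivative:
  "i < components D \<Longrightarrow> (curve D i has_vector_derivative velocity D i t) (at t)"
  unfolding velocity_eq by (intro smooth_has_vector_derivative smooth_curve)

lemma velocity_periodic:
  assumes "i < components D"
  shows "velocity D i (t + of_int m) = velocity D i t"
proof -
  have "((\<lambda>t. curve D i (t + of_int m)) has_vector_derivative 1 *\<^sub>R velocity D i (t + of_int m)) (at t)"
    using vector_diff_chain_at[OF has_vector_derivative_add[OF has_vector_derivative_id
        has_vector_derivative_const] curve_has_derivative[OF assms]] by (simp add: o_def)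
  then show ?thesis
    using curve_has_derivative[OF assms, of t] vector_derivative_unique_at
    by (fastforce simp: curve_periodic[OF assms])
qed

lemma meets_shift: "meets D i (s + of_int m) j (t + of_int l) \<longleftrightarrow> meets D i s j t"
proof -
  have "s + of_int m - (t + of_int l) \<in> \<int> \<longleftrightarrow> s - t \<in> \<int>"
  proof -
    have "s + of_int m - (t + of_int l) = (s - t) + of_int (m - l)" by simp
    then show ?thesis by (metis Ints_of_int Ints_add Ints_diff add_diff_cancel_right')
  qed
  then show ?thesis unfolding meets_def by (auto simp: curve_periodic)
qed

lemma meets_components: "meets D i s j t \<Longrightarrow> i < components D \<and> j < components D"
  by (simp add: meets_def)

lemma meets_transverse: "meets D i s j t \<Longrightarrow> turn (velocity D i s) (velocity D j t) \<noteq> 0"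
  using link_diagram unfolding virtual_link_diagram_def by metis

lemma meets_unique: "meets D i s j t \<Longrightarrow> meets D i s k u \<Longrightarrow> j = k \<and> t - u \<in> \<int>"
  using link_diagram unfolding virtual_link_diagram_def by metis

lemma classical_shift:
  "classical_crossing D i (s + of_int m) j (t + of_int l) \<longleftrightarrow> classical_crossing D i s j t"
  unfolding classical_crossing_def meets_shift
  using meets_components over_periodic by blast

lemma positive_shift:
  "positive_crossing D i (s + of_int m) j (t + of_int l) \<longleftrightarrow> positive_crossing D i s j t"
  unfolding positive_crossing_def classical_shift
  by (metis classical_crossing_def meets_components velocity_periodic)

text \<open>An over passage has some partner that is not over; a double point has only one partner
  modulo the integers, so that partner is the given one.\<close>

lemma over_classical:
  assumes "meets D i s j t" "over D i s"
  shows "classical_crossing D i s j t"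
proof -
  obtain k u where "meets D i s k u" "\<not> over D k u"
    using assms link_diagram unfolding virtual_link_diagram_def by (metis meets_components)
  with meets_unique[OF assms(1)] obtain m where "k = j" "t = u + of_int m"
    by (metis Ints_cases diff_eq_eq add.commute)
  then show ?thesis using \<open>\<not> over D k u\<close> assms over_periodic
    by (auto simp: classical_crossing_def dest: meets_components)
qed

lemma crossing_param_shift: "crossing_param D i (s + of_int m) \<longleftrightarrow> crossing_param D i s"
  unfolding crossing_param_def using meets_shift[of i s m _ _ 0] by (metis add_0_right of_int_0)

lemma positive_under_shift: "positive_under D i (s + of_int m) \<longleftrightarrow> positive_under D i s"
  unfolding positive_under_def using positive_shift[of _ _ 0 i s m] by simp

lemma negative_under_shift: "negative_under D i (s + of_int m) \<longleftrightarrow> negative_under D i s"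
  unfolding negative_under_def
  using positive_shift[of _ _ 0 i s m] classical_shift[of _ _ 0 i s m] by simp

lemma under_iff: "positive_under D i s \<or> negative_under D i s \<longleftrightarrow> (\<exists>j t. classical_crossing D j t i s)"
  unfolding positive_under_def negative_under_def positive_crossing_def by auto

lemma under_crossing_param: "positive_under D i s \<or> negative_under D i s \<Longrightarrow> crossing_param D i s"
  unfolding under_iff crossing_param_def classical_crossing_def using meets_sym by blast

lemma classical_unique:
  assumes "classical_crossing D i s j t" "classical_crossing D k u j t"
  shows "i = k \<and> s - u \<in> \<int>"
  using assms meets_sym meets_unique unfolding classical_crossing_def by metis

text \<open>The over strand above \<open>s\<close> is unique modulo the integers and velocities are
  periodic, so the sign of the crossing is well defined.\<close>

lemma under_exclusive: "\<not> (positive_under D i s \<and> negative_under D i s)"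
proof (safe)
  assume "positive_under D i s" "negative_under D i s"
  then obtain j t k u where jk: "positive_crossing D j t i s" "classical_crossing D k u i s"
    "\<not> positive_crossing D k u i s"
    unfolding positive_under_def negative_under_def by blast
  then have "j = k \<and> t - u \<in> \<int>" using classical_unique by (auto simp: positive_crossing_def)
  then obtain m where "j = k" "t = u + of_int m" by (metis Ints_cases diff_eq_eq add.commute)
  then show False using jk positive_shift[of k u m i s 0] by simp
qed

lemma crossing_param_component: "crossing_param D i s \<Longrightarrow> i < components D"
  by (auto simp: crossing_param_def meets_def)

lemma finite_meets:
  "finite {(i, s, j, t). meets D i s j t \<and> \<bar>s\<bar> \<le> R \<and> \<bar>t\<bar> \<le> R}"
proof -
  define M where "M = {(i, s, j, t). meets D i s j t \<and> s \<in> {0..<1} \<and> t \<in> {0..<1}}"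
  define Z where "Z = {m::int. \<bar>real_of_int m\<bar> \<le> R + 1}"
  have "Z \<subseteq> {- \<lceil>R + 1\<rceil>..\<lceil>R + 1\<rceil>}" unfolding Z_def by (auto simp: abs_le_iff) linarith+
  then have "finite Z" by (rule finite_subset) simp
  have "finite M" using link_diagram unfolding virtual_link_diagram_def M_def by blast
  have "{(i, s, j, t). meets D i s j t \<and> \<bar>s\<bar> \<le> R \<and> \<bar>t\<bar> \<le> R} \<subseteq>
      (\<lambda>((i, s, j, t), m, l). (i, s + of_int m, j, t + of_int l)) ` (M \<times> Z \<times> Z)"
  proof safe
    fix i s j t
    assume *: "meets D i s j t" "\<bar>s\<bar> \<le> R" "\<bar>t\<bar> \<le> R"
    have "(i, frac s, j, frac t) \<in> M"
      using *(1) meets_shift[of i "frac s" "\<lfloor>s\<rfloor>" j "frac t" "\<lfloor>t\<rfloor>"]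
      by (simp add: M_def frac_lt_1) (simp add: frac_def)
    moreover have "\<lfloor>s\<rfloor> \<in> Z" "\<lfloor>t\<rfloor> \<in> Z" unfolding Z_def using *(2,3) by simp_all linarith+
    ultimately show "(i, s, j, t) \<in> (\<lambda>((i, s, j, t), m, l). (i, s + of_int m, j, t + of_int l)) ` (M \<times> Z \<times> Z)"
      by (intro image_eqI[where x="((i, frac s, j, frac t), \<lfloor>s\<rfloor>, \<lfloor>t\<rfloor>)"]) (auto simp: frac_def)
  qed
  then show ?thesis using \<open>finite M\<close> \<open>finite Z\<close> by (meson finite_SigmaI finite_imageI finite_subset)
qed

lemma meets_normalize_right:
  assumes "meets D i s j t"
  shows "meets D i s j (frac t)"
  using meets_shift[of i s 0 j "frac t" "\<lfloor>t\<rfloor>"] assms by (simp add: frac_def)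

lemma finite_crossing_params: "finite {s. crossing_param D i s \<and> \<bar>s\<bar> \<le> R}"
proof (rule finite_subset)
  \<comment> \<open>Only \<open>s\<close> is prescribed; the partner parameter may be replaced by
    its fractional part, which the bound \<open>max R 1\<close> admits.\<close>
  show "{s. crossing_param D i s \<and> \<bar>s\<bar> \<le> R} \<subseteq> (\<lambda>(i, s, j, t). s) `
      {(i, s, j, t). meets D i s j t \<and> \<bar>s\<bar> \<le> max R 1 \<and> \<bar>t\<bar> \<le> max R 1}"
  proof
    fix s assume "s \<in> {s. crossing_param D i s \<and> \<bar>s\<bar> \<le> R}"
    then obtain j t where "meets D i s j t" "\<bar>s\<bar> \<le> R" by (auto simp: crossing_param_def)
    then show "s \<in> (\<lambda>(i, s, j, t). s) `
      {(i, s, j, t). meets D i s j t \<and> \<bar>s\<bar> \<le> max R 1 \<and> \<bar>t\<bar> \<le> max R 1}"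
      using frac_lt_1[of t]
      by (intro image_eqI[where x="(i, s, j, frac t)"]) (auto intro: meets_normalize_right)
  qed
qed (rule finite_imageI[OF finite_meets])

lemma crossing_params_separated:
  obtains \<delta> where "\<delta> > 0" "\<delta> \<le> 1/2"
    "\<And>i s s'. crossing_param D i s \<Longrightarrow> crossing_param D i s' \<Longrightarrow> s \<noteq> s' \<Longrightarrow> \<bar>s - s'\<bar> \<ge> 2 * \<delta>"
proof -
  \<comment> \<open>The element 1 makes \<open>B\<close> nonempty and its minimum at most 1, so only
    pairs closer than 1 need work. Translating such a pair by the floor of its smaller member puts
    both parameters between 0 and 2.\<close>
  define B where "B = insert 1 (\<Union>i<components D. (\<lambda>(s, s'). \<bar>s - s'\<bar>) `
     ({s. crossing_param D i s \<and> \<bar>s\<bar> \<le> 2} \<times> {s. crossing_param D i s \<and> \<bar>s\<bar> \<le> 2})) - {0}"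
  have fin: "finite B" "B \<noteq> {}" unfolding B_def by (auto intro!: finite_crossing_params)
  have pos: "Min B > 0" using fin by (auto simp: B_def)
  have le1: "Min B \<le> 1" using fin by (intro Min_le) (auto simp: B_def)
  have *: "s' - s \<ge> Min B" if "crossing_param D i s" "crossing_param D i s'" "s < s'" for i s s'
  proof (cases "s' - s < 1")
    case True
    define r where "r = s' - of_int \<lfloor>s\<rfloor>"
    have "crossing_param D i (frac s)" "crossing_param D i r"
      using that crossing_param_shift[of i _ "- \<lfloor>s\<rfloor>"] by (auto simp: frac_def r_def)
    moreover have "\<bar>frac s\<bar> \<le> 2" "\<bar>r\<bar> \<le> 2"
      using frac_lt_1[of s] that True unfolding r_def frac_def by linarith+
    moreover have "\<bar>frac s - r\<bar> = s' - s" using that by (simp add: r_def frac_def)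
    ultimately have "s' - s \<in> B"
      using that crossing_param_component unfolding B_def by (force simp: image_iff)
    then show ?thesis using fin by simp
  qed (use le1 in linarith)
  have "\<bar>s - s'\<bar> \<ge> 2 * (Min B / 2)"
    if "crossing_param D i s" "crossing_param D i s'" "s \<noteq> s'" for i s s'
    using *[of i s s'] *[of i s' s] that by linarith
  then show ?thesis using that[of "Min B / 2"] pos le1 by auto
qed

end


section \<open>Existence of twist profiles\<close>

lemma cos_diff_sign:
  fixes x :: real
  assumes "0 < \<omega>" "\<omega> < 1/2" "\<bar>x\<bar> \<le> 1/2"
  shows "cos (2 * pi * \<omega>) - cos (2 * pi * x) \<le> 0 \<longleftrightarrow> \<bar>x\<bar> \<le> \<omega>"
    and "cos (2 * pi * \<omega>) - cos (2 * pi * x) = 0 \<longleftrightarrow> \<bar>x\<bar> = \<omega>"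
proof -
  have "cos (2 * pi * x) = cos (2 * pi * \<bar>x\<bar>)"
    using cos_abs_real[of "2 * pi * x"] by (simp add: abs_mult)
  moreover have "2 * pi * \<omega> \<le> pi" "2 * pi * \<bar>x\<bar> \<le> pi" "0 \<le> 2 * pi * \<omega>" "0 \<le> 2 * pi * \<bar>x\<bar>"
    using assms by auto
  ultimately show "cos (2 * pi * \<omega>) - cos (2 * pi * x) \<le> 0 \<longleftrightarrow> \<bar>x\<bar> \<le> \<omega>"
    and "cos (2 * pi * \<omega>) - cos (2 * pi * x) = 0 \<longleftrightarrow> \<bar>x\<bar> = \<omega>"
    using cos_mono_le_eq[of "2 * pi * \<omega>" "2 * pi * \<bar>x\<bar>"] cos_inj_pi[of "2 * pi * \<omega>" "2 * pi * \<bar>x\<bar>"]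
    by auto
qed

text \<open>For \<open>0 < \<omega>\<close> and \<open>\<omega> < 1/2\<close> this shifted cosine
  changes sign at distance \<open>\<omega>\<close> from the integer translates of \<open>m\<close>.
  It is smooth and 1-periodic without any gluing, and its zeros are simple.\<close>

definition bump :: "real \<Rightarrow> real \<Rightarrow> real \<Rightarrow> real" where
  "bump \<omega> m r = cos (2 * pi * \<omega>) - cos (2 * pi * (r - m))"

lemma bump_shift: "bump \<omega> m (r + of_int n) = bump \<omega> m r"
proof -
  have "2 * pi * (r + of_int n - m) = 2 * pi * (r - m) + 2 * pi * of_int n"
    by (simp add: algebra_simps)
  then show ?thesis unfolding bump_def by (simp only: cos_add cos_int_2pin sin_int_2pin mult_1_left mult_zero_left mult_1_right mult_zero_right diff_zero)
qed

lemma bump_sign: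
  assumes "0 < \<omega>" "\<omega> < 1/2"
  shows "bump \<omega> m r \<le> 0 \<longleftrightarrow> (\<exists>n::int. \<bar>r - (m + of_int n)\<bar> \<le> \<omega>)"
    and "bump \<omega> m r = 0 \<longleftrightarrow> (\<exists>n::int. \<bar>r - (m + of_int n)\<bar> = \<omega>)"
proof -
  have eq: "bump \<omega> m r = cos (2 * pi * \<omega>) - cos (2 * pi * (r - (m + of_int n)))" for n :: int
    using bump_shift[of \<omega> m r "- n"] by (simp add: bump_def algebra_simps)
  \<comment> \<open>The translate of \<open>m\<close> nearest to \<open>r\<close> is within 1/2, and
    so is any translate within \<open>\<omega>\<close>; in that range the cosine is a decreasing
    function of the distance.\<close>
  have "\<bar>r - (m + of_int (round (r - m)))\<bar> \<le> 1/2"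
    using of_int_round_abs_le[of "r - m"] unfolding abs_le_iff by linarith
  note round = this
  have sign: "(bump \<omega> m r \<le> 0 \<longleftrightarrow> \<bar>r - (m + of_int n)\<bar> \<le> \<omega>) \<and>
      (bump \<omega> m r = 0 \<longleftrightarrow> \<bar>r - (m + of_int n)\<bar> = \<omega>)"
    if "\<bar>r - (m + of_int n)\<bar> \<le> 1/2" for n :: int
    using cos_diff_sign[OF assms that] unfolding eq[of n] by blast
  show "bump \<omega> m r \<le> 0 \<longleftrightarrow> (\<exists>n::int. \<bar>r - (m + of_int n)\<bar> \<le> \<omega>)"
  proof
    assume "\<exists>n::int. \<bar>r - (m + of_int n)\<bar> \<le> \<omega>"
    then obtain n :: int where n: "\<bar>r - (m + of_int n)\<bar> \<le> \<omega>" ..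
    then have "\<bar>r - (m + of_int n)\<bar> \<le> 1/2" using assms by linarith
    with n sign show "bump \<omega> m r \<le> 0" by blast
  qed (use sign[OF round] in blast)
  show "bump \<omega> m r = 0 \<longleftrightarrow> (\<exists>n::int. \<bar>r - (m + of_int n)\<bar> = \<omega>)"
  proof
    assume "\<exists>n::int. \<bar>r - (m + of_int n)\<bar> = \<omega>"
    then obtain n :: int where n: "\<bar>r - (m + of_int n)\<bar> = \<omega>" ..
    then have "\<bar>r - (m + of_int n)\<bar> \<le> 1/2" using assms by linarith
    with n sign show "bump \<omega> m r = 0" by blast
  qed (use sign[OF round] in blast)
qed

lemma bump_deriv:
  "(bump \<omega> m has_real_derivative 2 * pi * sin (2 * pi * (r - m))) (at r)"
  unfolding bump_def[abs_def] by (rule derivative_eq_intros refl | simp)+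

text \<open>The sine vanishes only if \<open>r - m\<close> is half an integer. At a zero of the
  bump, \<open>2 * \<omega>\<close> would then be an integer strictly between 0 and 1.\<close>

lemma bump_deriv_nonzero:
  assumes "0 < \<omega>" "\<omega> < 1/2" "bump \<omega> m r = 0"
  shows "2 * pi * sin (2 * pi * (r - m)) \<noteq> 0"
proof
  assume "2 * pi * sin (2 * pi * (r - m)) = 0"
  then have "sin (2 * pi * (r - m)) = 0" by simp
  then obtain n :: int where "2 * pi * (r - m) = of_int n * pi"
    using sin_zero_iff_int2 by auto
  then have "pi * (2 * (r - m)) = pi * of_int n" by (simp add: mult_ac)
  then have n: "r - m = of_int n / 2" unfolding mult_left_cancel[OF pi_neq_zero] by simp
  obtain k :: int where k: "\<bar>r - (m + of_int k)\<bar> = \<omega>" using bump_sign(2)[OF assms(1,2)] assms(3) by blast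
  have "\<bar>real_of_int (n - 2 * k)\<bar> = 2 * \<omega>" using k n by (simp add: field_simps)
  then have "real_of_int \<bar>n - 2 * k\<bar> = 2 * \<omega>" by simp
  then have "real_of_int \<bar>n - 2 * k\<bar> < 1" "0 < real_of_int \<bar>n - 2 * k\<bar>"
    using assms(1,2) by linarith+
  then show False unfolding of_int_less_1_iff of_int_0_less_iff by linarith
qed

lemma smooth_bump: "smooth (bump \<omega> m)"
proof -
  have "bump \<omega> m = (\<lambda>r. cos (2 * pi * \<omega>) + (- 1) * cos (2 * pi * r + (- 2 * pi * m)))"
    by (auto simp: bump_def algebra_simps)
  then show ?thesis by (simp only: smooth_add smooth_const smooth_cos)
qed

text \<open>\<open>f i\<close> is the product of one bump per under passage in a period; periodicity
  of the bumps takes care of the translated passages.\<close>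

lemma (in link_diagram) twist_profile_exists: "\<exists>\<delta> f. twist_profile D \<delta> f"
proof -
  obtain \<delta> where \<delta>: "\<delta> > 0" "\<delta> \<le> 1/2"
    "\<And>i s s'. crossing_param D i s \<Longrightarrow> crossing_param D i s' \<Longrightarrow> s \<noteq> s' \<Longrightarrow> \<bar>s - s'\<bar> \<ge> 2 * \<delta>"
    using crossing_params_separated by blast
  define under where "under i t \<longleftrightarrow> positive_under D i t \<or> negative_under D i t" for i t
  define T where "T i = {t. under i t \<and> 0 \<le> t \<and> t < 1}" for i
  \<comment> \<open>The middle of the interval in which \<open>twist_zeros\<close> looks for the
    zeros of this passage; a bump of half width \<open>\<delta> / 4\<close> there has both its zeros
    strictly inside.\<close>
  define mid where "mid i t = (if positive_under D i t then t + \<delta> / 2 else t - \<delta> / 2)" for i t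
  define f where "f i r = (\<Prod>t\<in>T i. bump (\<delta> / 4) (mid i t) r)" for i r
  have \<omega>: "0 < \<delta> / 4" "\<delta> / 4 < 1 / 2" using \<delta> by auto
  have param: "under i t \<Longrightarrow> crossing_param D i t" for i t
    unfolding under_def by (rule under_crossing_param)
  have finT: "finite (T i)" for i
    by (rule finite_subset[OF _ finite_crossing_params[of i 1]]) (auto simp: T_def param)
  have under_shift: "under i (t + of_int n) = under i t" for i t n
    by (simp add: under_def positive_under_shift negative_under_shift)
  have mid_shift: "mid i (t + of_int n) = mid i t + of_int n" for i t n
    by (simp add: mid_def positive_under_shift)
  have under_split: "\<exists>t0 n. t0 \<in> T i \<and> t = t0 + of_int n" if "under i t" for i t
    using under_shift[of i "frac t" "\<lfloor>t\<rfloor>"] that frac_lt_1[of t]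
    by (intro exI[of _ "frac t"] exI[of _ "\<lfloor>t\<rfloor>"]) (auto simp: T_def frac_def)
  \<comment> \<open>Bumps of different passages do not interfere: the passages are
    \<open>2 * \<delta>\<close> apart and each centre is moved by \<open>\<delta> / 2\<close>, so
    centres stay at least \<open>\<delta>\<close> apart, which exceeds
    \<open>\<delta> / 4 + \<delta> / 2\<close>.\<close>
  have near: "t = t'" if "under i t" "under i t'" "\<bar>r - mid i t\<bar> \<le> \<delta> / 4" "\<bar>r - mid i t'\<bar> < \<delta>/2"
    for i t t' r
  proof (rule ccontr)
    assume "t \<noteq> t'"
    then have "\<bar>t - t'\<bar> \<ge> 2 * \<delta>" using that param \<delta>(3) by blast
    moreover have "\<bar>mid i t - t\<bar> = \<delta> / 2" "\<bar>mid i t' - t'\<bar> = \<delta> / 2"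
      using \<delta>(1) by (simp_all add: mid_def)
    ultimately show False using that(3,4) \<delta>(1) by linarith
  qed
  have f0: "f i r = 0 \<longleftrightarrow> (\<exists>t. under i t \<and> \<bar>r - mid i t\<bar> = \<delta> / 4)" for i r
  proof -
    have "f i r = 0 \<longleftrightarrow> (\<exists>t\<in>T i. \<exists>n::int. \<bar>r - (mid i t + of_int n)\<bar> = \<delta> / 4)"
      by (simp add: f_def finT bump_sign(2)[OF \<omega>])
    also have "\<dots> \<longleftrightarrow> (\<exists>t. under i t \<and> \<bar>r - mid i t\<bar> = \<delta> / 4)"
    proof safe
      fix t n assume "t \<in> T i" "\<bar>r - (mid i t + of_int n)\<bar> = \<delta> / 4"
      then show "\<exists>t. under i t \<and> \<bar>r - mid i t\<bar> = \<delta> / 4"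
        by (intro exI[of _ "t + of_int n"]) (simp add: under_shift mid_shift T_def)
    next
      fix t assume t: "under i t" "\<bar>r - mid i t\<bar> = \<delta> / 4"
      obtain t0 n where "t0 \<in> T i" "t = t0 + of_int n" using under_split[OF t(1)] by blast
      then show "\<exists>t\<in>T i. \<exists>n::int. \<bar>r - (mid i t + of_int n)\<bar> = \<delta> / 4"
        using t(2) by (auto simp: mid_shift)
    qed
    finally show ?thesis .
  qed
  have fle: "\<exists>t. under i t \<and> \<bar>r - mid i t\<bar> \<le> \<delta> / 4" if "f i r \<le> 0" for i r
  proof -
    have "\<exists>t\<in>T i. bump (\<delta> / 4) (mid i t) r \<le> 0"
      using that prod_pos[of "T i" "\<lambda>t. bump (\<delta> / 4) (mid i t) r"] unfolding f_def
      by (meson not_le)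
    then obtain t n where "t \<in> T i" "\<bar>r - (mid i t + of_int n)\<bar> \<le> \<delta> / 4"
      unfolding bump_sign(1)[OF \<omega>] by blast
    then show ?thesis
      by (intro exI[of _ "t + of_int n"]) (simp add: under_shift mid_shift T_def)
  qed
  have deriv_f: "deriv (f i) r \<noteq> 0" if f_zero: "f i r = 0" for i r
  proof -
    obtain t0 where t0: "t0 \<in> T i" "bump (\<delta> / 4) (mid i t0) r = 0"
      using f_zero finT by (auto simp: f_def)
    \<comment> \<open>Exactly one factor vanishes at \<open>r\<close>; by the product rule the
      derivative of \<open>f i\<close> there is the derivative of that factor times the nonzero
      value of the remaining product.\<close>
    define g where "g r = (\<Prod>t\<in>T i - {t0}. bump (\<delta> / 4) (mid i t) r)" for r
    have f_eq: "f i = (\<lambda>r. bump (\<delta> / 4) (mid i t0) r * g r)"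
      by (rule ext) (simp add: f_def g_def prod.remove[OF finT t0(1)])
    have "bump (\<delta> / 4) (mid i t) r \<noteq> 0" if t: "t \<in> T i - {t0}" for t
    proof
      assume "bump (\<delta> / 4) (mid i t) r = 0"
      then obtain n n0 where n: "\<bar>r - mid i (t + of_int n)\<bar> = \<delta> / 4" "\<bar>r - mid i (t0 + of_int n0)\<bar> = \<delta> / 4"
        using t0(2) unfolding bump_sign(2)[OF \<omega>] mid_shift by blast
      have "t + of_int n = t0 + of_int n0"
        using n t t0(1) \<delta>(1) by (intro near[of i _ _ r]) (auto simp: under_shift T_def)
      moreover have "\<bar>t - t0\<bar> < 1" using t t0(1) by (auto simp: T_def)
      ultimately have "\<bar>real_of_int (n0 - n)\<bar> < 1" by (auto simp: algebra_simps)
      then have "n = n0" by linarith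
      then show False using \<open>t + of_int n = t0 + of_int n0\<close> t by simp
    qed
    then have "g r \<noteq> 0" by (simp add: g_def finT)
    have "smooth g" unfolding g_def by (intro smooth_prod smooth_bump)
    then obtain g' where "(g has_real_derivative g') (at r)"
      using smooth_has_vector_derivative[of g r] by (auto simp: has_real_derivative_iff_has_vector_derivative)
    from DERIV_mult[OF bump_deriv this, of "\<delta> / 4" "mid i t0"]
    have "deriv (f i) r = 2 * pi * sin (2 * pi * (r - mid i t0)) * g r"
      unfolding f_eq using t0(2) by (intro DERIV_imp_deriv) simp
    then show ?thesis using bump_deriv_nonzero[OF \<omega> t0(2)] \<open>g r \<noteq> 0\<close> by simp
  qed
  have zeros: "twist_zeros D \<delta> f i t = {mid i t - \<delta> / 4, mid i t + \<delta> / 4}" if t: "under i t" for i t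
  proof -
    have "twist_zeros D \<delta> f i t = {r. f i r = 0 \<and> \<bar>r - mid i t\<bar> < \<delta> / 2}"
      unfolding twist_zeros_def mid_def by (auto simp: abs_if)
    also have "\<dots> = {r. \<bar>r - mid i t\<bar> = \<delta> / 4}"
    proof (intro set_eqI iffI CollectI)
      fix r assume "r \<in> {r. f i r = 0 \<and> \<bar>r - mid i t\<bar> < \<delta> / 2}"
      then obtain t' where "under i t'" "\<bar>r - mid i t'\<bar> = \<delta> / 4" "\<bar>r - mid i t\<bar> < \<delta> / 2"
        unfolding f0 by blast
      then show "\<bar>r - mid i t\<bar> = \<delta> / 4" using near[of i t' t r] t by simp
    next
      fix r assume r: "r \<in> {r. \<bar>r - mid i t\<bar> = \<delta> / 4}"
      then show "f i r = 0 \<and> \<bar>r - mid i t\<bar> < \<delta> / 2"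
        unfolding f0 using t \<delta>(1) by auto
    qed
    also have "\<dots> = {mid i t - \<delta> / 4, mid i t + \<delta> / 4}"
    proof (intro set_eqI)
      fix x
      have "\<bar>x - mid i t\<bar> = \<delta> / 4 \<longleftrightarrow> x = mid i t - \<delta> / 4 \<or> x = mid i t + \<delta> / 4"
        using \<delta>(1) by arith
      then show "x \<in> {r. \<bar>r - mid i t\<bar> = \<delta> / 4} \<longleftrightarrow> x \<in> {mid i t - \<delta> / 4, mid i t + \<delta> / 4}"
        by blast
    qed
    finally show ?thesis .
  qed
  have "twist_profile D \<delta> f"
    unfolding twist_profile_def
  proof (intro conjI allI impI)
    fix i s s' j t j' t' assume "meets D i s j t \<and> meets D i s' j' t' \<and> s \<noteq> s'"
    then show "2 * \<delta> \<le> \<bar>s - s'\<bar>" using \<delta>(3) unfolding crossing_param_def by blast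
  next
    fix j show "smooth (f j)" unfolding f_def by (intro smooth_prod smooth_bump)
    fix r show "f j (r + 1) = f j r" unfolding f_def using bump_shift[of _ _ r 1] by simp
    assume "f j r = 0" then show "deriv (f j) r \<noteq> 0" by (rule deriv_f)
  next
    fix j t assume "positive_under D j t \<or> negative_under D j t"
    then show "card (twist_zeros D \<delta> f j t) = 2" using zeros[of j t] \<delta>(1) by (simp add: under_def)
  next
    fix j r assume "f j r \<le> 0"
    then obtain t where "under j t" "\<bar>r - mid j t\<bar> \<le> \<delta> / 4" using fle by blast
    then have "under j t" "mid j t - \<delta> / 4 \<le> r" "r \<le> mid j t + \<delta> / 4" by linarith+
    then show "\<exists>t. positive_under D j t \<and> t < r \<and> r < t + \<delta> \<or> negative_under D j t \<and> t - \<delta> < r \<and> r < t"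
      using \<delta>(1) by (intro exI[of _ t]) (auto simp: mid_def under_def split: if_splits)
  qed (use \<delta> in auto)
  then show ?thesis by blast
qed


section \<open>Crossings of nearly linear curves\<close>

text \<open>The mean value inequality for \<open>g x - x *\<^sub>R c\<close>, whose derivative has
  norm at most \<open>\<kappa>\<close> on the ball.\<close>

lemma linear_approximation:
  fixes g :: "real \<Rightarrow> 'a::real_normed_vector"
  assumes "\<And>x. \<bar>x - s\<bar> < \<rho> \<Longrightarrow> (g has_vector_derivative g' x) (at x)"
    and "\<And>x. \<bar>x - s\<bar> < \<rho> \<Longrightarrow> norm (g' x - c) \<le> \<kappa>"
    and "\<bar>r - s\<bar> < \<rho>" "\<bar>q - s\<bar> < \<rho>"
  shows "norm (g r - g q - (r - q) *\<^sub>R c) \<le> \<kappa> * \<bar>r - q\<bar>"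
proof -
  define F where "F x = g x - x *\<^sub>R c" for x
  have in_ball: "x \<in> ball s \<rho> \<longleftrightarrow> \<bar>x - s\<bar> < \<rho>" for x by (auto simp: dist_real_def)
  have "norm (F r - F q) \<le> \<kappa> * norm (r - q)"
  proof (rule differentiable_bound[of "ball s \<rho>" F "\<lambda>x h. h *\<^sub>R (g' x - c)"])
    fix x assume x: "x \<in> ball s \<rho>"
    have "(F has_vector_derivative g' x - 1 *\<^sub>R c) (at x)"
      unfolding F_def using x in_ball
      by (intro has_vector_derivative_diff assms(1)) (auto intro!: derivative_eq_intros)
    then show "(F has_derivative (\<lambda>h. h *\<^sub>R (g' x - c))) (at x within ball s \<rho>)"
      by (simp add: has_vector_derivative_def has_derivative_at_withinI)
    have "0 \<le> \<kappa>" using assms(2)[of x] x in_ball norm_ge_zero order_trans by blast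
    show "onorm (\<lambda>h. h *\<^sub>R (g' x - c)) \<le> \<kappa>"
    proof (rule onorm_bound[OF \<open>0 \<le> \<kappa>\<close>])
      show "norm (h *\<^sub>R (g' x - c)) \<le> \<kappa> * norm h" for h
        using mult_right_mono[OF assms(2)[of x], of "norm h"] x in_ball by (simp add: mult.commute)
    qed
  qed (use assms in_ball in auto)
  then show ?thesis by (simp add: F_def algebra_simps)
qed

text \<open>Cramer's rule: the determinant with \<open>w\<close> isolates \<open>a\<close>, the
  determinant with \<open>v\<close> isolates \<open>b\<close>.\<close>

lemma transverse_coordinates_bound:
  fixes a b :: real
  assumes "0 < \<tau>" "\<tau> \<le> \<bar>turn v w\<bar>" "norm v \<le> K" "norm w \<le> K"
  shows "\<bar>a\<bar> \<le> (K / \<tau>) * norm (a *\<^sub>R v - b *\<^sub>R w)" "\<bar>b\<bar> \<le> (K / \<tau>) * norm (a *\<^sub>R v - b *\<^sub>R w)"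
proof -
  let ?z = "a *\<^sub>R v - b *\<^sub>R w"
  have "\<bar>a\<bar> * \<tau> \<le> \<bar>a\<bar> * \<bar>turn v w\<bar>" using assms by (intro mult_left_mono) auto
  also have "\<dots> = \<bar>turn ?z w\<bar>" by (simp add: turn_simps abs_mult)
  also have "\<dots> \<le> norm ?z * norm w" by (rule abs_turn_le)
  also have "\<dots> \<le> norm ?z * K" using assms by (intro mult_left_mono) auto
  finally show "\<bar>a\<bar> \<le> (K / \<tau>) * norm ?z" using assms by (simp add: field_simps)
  have "\<bar>b\<bar> * \<tau> \<le> \<bar>b\<bar> * \<bar>turn v w\<bar>" using assms by (intro mult_left_mono) auto
  also have "\<dots> = \<bar>turn v ?z\<bar>" by (simp add: turn_simps abs_mult)
  also have "\<dots> \<le> norm v * norm ?z" by (rule abs_turn_le)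
  also have "\<dots> \<le> K * norm ?z" using assms by (intro mult_right_mono) auto
  finally show "\<bar>b\<bar> \<le> (K / \<tau>) * norm ?z" using assms by (simp add: field_simps)
qed

text \<open>The deviation from a line of direction \<open>v\<close> is
  \<open>\<kappa>\<close>-Lipschitz near \<open>s\<close>. No derivative is mentioned, since
  existence, uniqueness and order of crossings need only increments.\<close>

definition nearly_linear :: "(real \<Rightarrow> complex) \<Rightarrow> complex \<Rightarrow> real \<Rightarrow> real \<Rightarrow> real \<Rightarrow> bool" where
  "nearly_linear g v s \<eta> \<kappa> \<longleftrightarrow> (\<forall>r q. \<bar>r - s\<bar> < \<eta> \<and> \<bar>q - s\<bar> < \<eta> \<longrightarrow>
      norm (g r - g q - (r - q) *\<^sub>R v) \<le> \<kappa> * \<bar>r - q\<bar>)"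

lemma nearly_linearD:
  "nearly_linear g v s \<eta> \<kappa> \<Longrightarrow> \<bar>r - s\<bar> < \<eta> \<Longrightarrow> \<bar>q - s\<bar> < \<eta> \<Longrightarrow>
     norm (g r - g q - (r - q) *\<^sub>R v) \<le> \<kappa> * \<bar>r - q\<bar>"
  unfolding nearly_linear_def by blast

locale transverse_pair =
  fixes v w :: complex and \<tau> K \<kappa> :: real
  assumes \<tau>: "0 < \<tau>" "\<tau> \<le> \<bar>turn v w\<bar>" and K: "0 < K" "norm v \<le> K" "norm w \<le> K"
    and \<kappa>: "0 \<le> \<kappa>" "\<kappa> \<le> \<tau> / (4 * K)"
begin

lemma coordinate_bound:
  "\<bar>a\<bar> \<le> (K / \<tau>) * norm (a *\<^sub>R v - b *\<^sub>R w) \<and> \<bar>b\<bar> \<le> (K / \<tau>) * norm (a *\<^sub>R v - b *\<^sub>R w)"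
  using transverse_coordinates_bound[OF \<tau> K(2,3)] by blast

text \<open>This is where \<open>\<kappa> \<le> \<tau> / (4 * K)\<close> comes from: the errors of
  two nearly linear curves together amount to at most half of the linear displacement. The same 1/2
  is the contraction factor in \<open>crossing_exists\<close>.\<close>

lemma error_bound: "\<kappa> * (\<bar>a\<bar> + \<bar>b\<bar>) \<le> norm (a *\<^sub>R v - b *\<^sub>R w) / 2"
proof -
  let ?n = "norm (a *\<^sub>R v - b *\<^sub>R w)"
  have "\<kappa> * (\<bar>a\<bar> + \<bar>b\<bar>) \<le> \<tau> / (4 * K) * ((K / \<tau>) * ?n + (K / \<tau>) * ?n)"
    using \<kappa> \<tau> K coordinate_bound[of a b] by (intro mult_mono add_mono) auto
  also have "\<dots> = ?n / 2" using \<tau> K by (simp add: field_simps)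
  finally show ?thesis .
qed

text \<open>Between two common points the linear displacement \<open>z\<close> equals a difference
  of errors, hence has at most half of its own norm and vanishes; transversality then makes both
  parameters agree.\<close>

lemma crossing_unique:
  assumes "nearly_linear g v s \<eta> \<kappa>" "nearly_linear h w t \<eta> \<kappa>"
    and "\<bar>r - s\<bar> < \<eta>" "\<bar>r' - s\<bar> < \<eta>" "\<bar>q - t\<bar> < \<eta>" "\<bar>q' - t\<bar> < \<eta>"
    and "g r = h q" "g r' = h q'"
  shows "r = r'" "q = q'"
proof -
  let ?z = "(r - r') *\<^sub>R v - (q - q') *\<^sub>R w"
  have "?z = (h q - h q' - (q - q') *\<^sub>R w) - (g r - g r' - (r - r') *\<^sub>R v)"
    using assms(7,8) by simp
  then have "norm ?z \<le> \<kappa> * \<bar>q - q'\<bar> + \<kappa> * \<bar>r - r'\<bar>"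
    by (simp only: order_trans[OF norm_triangle_ineq4 add_mono]
        nearly_linearD[OF assms(1,3,4)] nearly_linearD[OF assms(2,5,6)])
  also have "\<dots> \<le> norm ?z / 2" using error_bound[of "r - r'" "q - q'"] by (simp add: algebra_simps)
  finally have "norm ?z = 0" by simp
  then show "r = r'" "q = q'" using coordinate_bound[of "r - r'" "q - q'"] by auto
qed

text \<open>Writing a plane vector as \<open>x = A x *\<^sub>R v - B x *\<^sub>R w\<close>, the gap
  \<open>g (s + A x) - h (t + B x)\<close> is \<open>x\<close> plus a constant up to small errors.
  So \<open>T\<close>, which subtracts the gap from \<open>x\<close>, is a contraction, and its
  fixed points are the crossings.\<close>

lemma crossing_exists:
  assumes g: "nearly_linear g v s \<eta> \<kappa>" and h: "nearly_linear h w t \<eta> \<kappa>"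
    and "0 < \<eta>" and close: "norm (g s - h t) \<le> \<eta> * \<tau> / (4 * K)"
  shows "\<exists>r q. \<bar>r - s\<bar> < \<eta> \<and> \<bar>q - t\<bar> < \<eta> \<and> g r = h q"
proof -
  \<comment> \<open>On the ball of radius \<open>\<rho>\<close> both coordinates are at most
    \<open>K / \<tau> * \<rho> = \<eta> / 2\<close>, so the parameters stay in the neighbourhoods.
    The hypothesis \<open>close\<close> bounds \<open>norm (T 0)\<close> by
    \<open>\<rho> / 2\<close>, which with contraction factor 1/2 keeps the ball invariant.\<close>
  define \<rho> where "\<rho> = \<eta> * \<tau> / (2 * K)"
  have "\<rho> > 0" using assms \<tau> K by (simp add: \<rho>_def)
  (* A x and B x are the coordinates of x with respect to v and - w *)
  define A where "A x = turn x w / turn v w" for x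
  define B where "B x = turn x v / turn v w" for x
  have AB: "A x *\<^sub>R v - B x *\<^sub>R w = x" for x
  proof -
    have "turn v w *\<^sub>R x = turn x w *\<^sub>R v - turn x v *\<^sub>R w"
      by (rule complex_eqI) (simp_all add: turn_def algebra_simps)
    moreover have "A x *\<^sub>R v - B x *\<^sub>R w = inverse (turn v w) *\<^sub>R (turn x w *\<^sub>R v - turn x v *\<^sub>R w)"
      by (simp add: A_def B_def divide_inverse_commute scaleR_diff_right)
    moreover have "inverse (turn v w) *\<^sub>R (turn v w *\<^sub>R x) = x" using \<tau> by simp
    ultimately show ?thesis by (simp only:)
  qed
  have A_diff: "A x - A y = A (x - y)" and B_diff: "B x - B y = B (x - y)" for x y
    by (simp_all add: A_def B_def turn_simps diff_divide_distrib)
  have AB_small: "\<bar>A x\<bar> < \<eta> \<and> \<bar>B x\<bar> < \<eta>" if "norm x \<le> \<rho>" for x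
  proof -
    have "K / \<tau> * norm x \<le> K / \<tau> * \<rho>" using that \<tau> K by (intro mult_left_mono) auto
    also have "\<dots> < \<eta>" using \<tau> K \<open>0 < \<eta>\<close> by (simp add: \<rho>_def field_simps)
    finally show ?thesis using coordinate_bound[of "A x" "B x"] by (simp add: AB)
  qed
  define T where "T x = x - (g (s + A x) - h (t + B x))" for x
  have contr: "norm (T x - T y) \<le> 1/2 * norm (x - y)" if xy: "norm x \<le> \<rho>" "norm y \<le> \<rho>" for x y
  proof -
    have "T x - T y = (h (t + B x) - h (t + B y) - (B x - B y) *\<^sub>R w)
        - (g (s + A x) - g (s + A y) - (A x - A y) *\<^sub>R v)"
      unfolding T_def A_diff B_diff using AB[of "x - y"] by (simp add: algebra_simps)
    moreover have "norm (h (t + B x) - h (t + B y) - (B x - B y) *\<^sub>R w) \<le> \<kappa> * \<bar>B x - B y\<bar>"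
      using nearly_linearD[OF h, of "t + B x" "t + B y"] AB_small xy by simp
    moreover have "norm (g (s + A x) - g (s + A y) - (A x - A y) *\<^sub>R v) \<le> \<kappa> * \<bar>A x - A y\<bar>"
      using nearly_linearD[OF g, of "s + A x" "s + A y"] AB_small xy by simp
    ultimately have "norm (T x - T y) \<le> \<kappa> * \<bar>B x - B y\<bar> + \<kappa> * \<bar>A x - A y\<bar>"
      by (simp only: order_trans[OF norm_triangle_ineq4 add_mono])
    also have "\<dots> \<le> norm (x - y) / 2"
      using error_bound[of "A (x - y)" "B (x - y)"] by (simp add: AB A_diff B_diff algebra_simps)
    finally show ?thesis by simp
  qed
  have "norm (T x) \<le> \<rho>" if "norm x \<le> \<rho>" for x
  proof -
    have "norm (T 0) \<le> \<rho> / 2"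
      using close by (simp add: T_def \<rho>_def A_def B_def turn_def norm_minus_commute)
    moreover have "norm (T x - T 0) \<le> \<rho> / 2" using contr[of x 0] that \<open>\<rho> > 0\<close> by simp
    ultimately show ?thesis using norm_triangle_ineq[of "T x - T 0" "T 0"] by simp
  qed
  then have "\<exists>!x\<in>cball 0 \<rho>. T x = x"
    using contr \<open>\<rho> > 0\<close>
    by (intro Banach_fix[where c = "1/2"])
      (auto simp: image_subset_iff dist_norm complete_eq_closed)
  then obtain x where x: "norm x \<le> \<rho>" "T x = x" by auto
  then have "g (s + A x) = h (t + B x)" by (simp add: T_def)
  moreover have "\<bar>(s + A x) - s\<bar> < \<eta>" "\<bar>(t + B x) - t\<bar> < \<eta>" using AB_small[OF x(1)] by auto
  ultimately show ?thesis by blast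
qed

text \<open>
  The curves \<open>h\<close> and \<open>h'\<close> differ by \<open>2 * \<epsilon> * \<phi>\<close> times the normal \<open>\<i> * w\<close>; so taking the determinant of
  the difference of the two crossing equations with \<open>w\<close> gives
  \<open>(r - r') * turn v w = 2 * \<epsilon> * \<phi> * (norm w)\<^sup>2\<close> up to small errors.
\<close>

lemma crossing_order:
  assumes g: "nearly_linear g v s \<eta> \<kappa>" and h: "nearly_linear h w t \<eta> \<kappa>"
    and r: "\<bar>r - s\<bar> < \<eta>" "\<bar>r' - s\<bar> < \<eta>" and q: "\<bar>q - t\<bar> < \<eta>" "\<bar>q' - t\<bar> < \<eta>"
    and eq: "g r = h q" "g r' = h' q'"
    and "0 < \<epsilon>"
    and off: "norm (h q' - h' q' + (2 * \<epsilon>) *\<^sub>R (of_real \<phi> * (\<i> * w))) \<le> 2 * \<epsilon> * \<kappa>"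
    and "norm (of_real \<phi> * (\<i> * w)) \<le> K" "\<kappa> \<le> K"
    and "0 < \<mu>" "\<mu> \<le> norm w" "0 < \<phi>0" "\<phi>0 \<le> \<phi>"
    and small: "K * \<kappa> * (16 * K\<^sup>2 / \<tau> + 2) < 2 * \<phi>0 * \<mu>\<^sup>2"
  shows "0 < (r - r') * turn v w"
proof -
  define a b where "a = r - r'" and "b = q - q'"
  define z where "z = a *\<^sub>R v - b *\<^sub>R w"
  define u where "u = (2 * \<epsilon>) *\<^sub>R (of_real \<phi> * (\<i> * w))"
  define e where "e = (h q - h q' - b *\<^sub>R w) - (g r - g r' - a *\<^sub>R v) + (h q' - h' q' + u)"
  have z: "z = e - u" using eq by (simp add: z_def e_def)
  have "norm e \<le> \<kappa> * \<bar>b\<bar> + \<kappa> * \<bar>a\<bar> + 2 * \<epsilon> * \<kappa>"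
    unfolding e_def
    by (rule order_trans[OF norm_triangle_ineq add_mono[OF order_trans[OF norm_triangle_ineq4 add_mono]
          off[folded u_def]]]
        nearly_linearD[OF g r, folded a_def] nearly_linearD[OF h q, folded b_def])+
  then have e: "norm e \<le> \<kappa> * (\<bar>a\<bar> + \<bar>b\<bar>) + 2 * \<epsilon> * \<kappa>" by (simp add: algebra_simps)
  have u: "norm u \<le> 2 * \<epsilon> * K" unfolding u_def norm_scaleR using assms by (simp add: mult_left_mono)
  have "norm z \<le> norm z / 2 + 2 * \<epsilon> * \<kappa> + 2 * \<epsilon> * K"
    using e u error_bound[of a b] norm_triangle_ineq4[of e u] unfolding z_def[symmetric] z[symmetric]
    by linarith
  moreover have "\<epsilon> * \<kappa> \<le> \<epsilon> * K" using assms by simp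
  ultimately have nz: "norm z \<le> 8 * \<epsilon> * K" by linarith
  \<comment> \<open>Both parameter differences are of order \<open>\<epsilon>\<close>, so the
    nonlinear errors are of order \<open>\<epsilon> * \<kappa>\<close>. The main term
    \<open>2 * \<epsilon> * \<phi> * (norm w)\<^sup>2\<close> is of order \<open>\<epsilon>\<close>
    too, and \<open>small\<close> makes it dominate.\<close>
  have ab: "\<bar>a\<bar> + \<bar>b\<bar> \<le> 16 * \<epsilon> * K\<^sup>2 / \<tau>"
  proof -
    have "\<bar>a\<bar> + \<bar>b\<bar> \<le> K / \<tau> * norm z + K / \<tau> * norm z"
      using coordinate_bound[of a b] unfolding z_def by (intro add_mono) auto
    also have "K / \<tau> * norm z \<le> K / \<tau> * (8 * \<epsilon> * K)" using nz K \<tau> by (intro mult_left_mono) auto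
    finally show ?thesis using \<tau> by (simp add: field_simps power2_eq_square)
  qed
  have "norm e \<le> \<kappa> * (16 * \<epsilon> * K\<^sup>2 / \<tau>) + 2 * \<epsilon> * \<kappa>"
    using e mult_left_mono[OF ab \<kappa>(1)] by linarith
  also have "\<dots> = \<epsilon> * \<kappa> * (16 * K\<^sup>2 / \<tau> + 2)" by (simp add: algebra_simps)
  finally have e': "norm e \<le> \<epsilon> * \<kappa> * (16 * K\<^sup>2 / \<tau> + 2)" .
  have "norm e * norm w \<le> \<epsilon> * \<kappa> * (16 * K\<^sup>2 / \<tau> + 2) * K"
    using e' K by (intro mult_mono) (auto intro: order_trans[OF norm_ge_zero])
  also have "\<dots> = \<epsilon> * (K * \<kappa> * (16 * K\<^sup>2 / \<tau> + 2))" by simp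
  also have "\<dots> < \<epsilon> * (2 * \<phi>0 * \<mu>\<^sup>2)" using small \<open>0 < \<epsilon>\<close> by (intro mult_strict_left_mono)
  also have "\<dots> \<le> \<epsilon> * (2 * \<phi> * (norm w)\<^sup>2)"
    using assms by (intro mult_left_mono mult_mono power_mono) auto
  finally have "norm e * norm w < 2 * \<epsilon> * \<phi> * (norm w)\<^sup>2" by (simp add: mult_ac)
  moreover have "turn u w = - (2 * \<epsilon> * \<phi> * (norm w)\<^sup>2)"
    unfolding cmod_power2 by (simp add: u_def turn_def power2_eq_square algebra_simps)
  moreover have "a * turn v w = turn e w - turn u w"
    using arg_cong[OF z, of "\<lambda>x. turn x w"] by (simp add: z_def turn_simps)
  ultimately have "0 < a * turn v w" using abs_turn_le[of e w] by linarith
  then show ?thesis by (simp add: a_def)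
qed

end


section \<open>Alexander numberings from paired crossings\<close>

definition crosses_classically :: "virtual_diagram \<Rightarrow> nat \<Rightarrow> real \<Rightarrow> nat \<Rightarrow> real \<Rightarrow> bool" where
  "crosses_classically D i s j t \<longleftrightarrow> classical_crossing D i s j t \<or> classical_crossing D j t i s"

text \<open>Up and down refer to the number along the \<open>i\<close>-th curve: a strand directed
  to the left of its partner comes in with \<open>k\<close> and goes out with
  \<open>k + 1\<close>.\<close>

definition up_cut :: "virtual_diagram \<Rightarrow> nat \<Rightarrow> real \<Rightarrow> bool" where
  "up_cut D i s \<longleftrightarrow> (\<exists>j t. crosses_classically D i s j t \<and> turn (velocity D j t) (velocity D i s) > 0)"

definition down_cut :: "virtual_diagram \<Rightarrow> nat \<Rightarrow> real \<Rightarrow> bool" where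
  "down_cut D i s \<longleftrightarrow> (\<exists>j t. crosses_classically D i s j t \<and> turn (velocity D i s) (velocity D j t) > 0)"

lemma cut_point_iff: "cut_point D i s \<longleftrightarrow> (\<exists>j t. crosses_classically D i s j t)"
  by (auto simp: cut_point_def crosses_classically_def)

lemma crosses_classically_sym: "crosses_classically D i s j t \<longleftrightarrow> crosses_classically D j t i s"
  by (auto simp: crosses_classically_def)

lemma up_cut_imp: "up_cut D i s \<Longrightarrow> cut_point D i s"
  and down_cut_imp: "down_cut D i s \<Longrightarrow> cut_point D i s"
  by (auto simp: up_cut_def down_cut_def cut_point_iff)

context link_diagram
begin

lemma crosses_classically_meets: "crosses_classically D i s j t \<Longrightarrow> meets D i s j t"
  unfolding crosses_classically_def classical_crossing_def using meets_sym by blast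

lemma crosses_classically_shift:
  "crosses_classically D i (s + of_int m) j (t + of_int l) \<longleftrightarrow> crosses_classically D i s j t"
  by (simp add: crosses_classically_def classical_shift)

lemma cut_point_shift: "cut_point D i (s + of_int m) \<longleftrightarrow> cut_point D i s"
  unfolding cut_point_iff using crosses_classically_shift[of i s m _ _ 0]
  by (metis add_0_right of_int_0)

lemma not_up_and_down: "\<not> (up_cut D i s \<and> down_cut D i s)"
proof safe
  assume "up_cut D i s" "down_cut D i s"
  then obtain j t k u where c: "crosses_classically D i s j t" "crosses_classically D i s k u"
    and *: "turn (velocity D j t) (velocity D i s) > 0" "turn (velocity D i s) (velocity D k u) > 0"
    unfolding up_cut_def down_cut_def by blast
  have "j = k \<and> t - u \<in> \<int>" using c crosses_classically_meets meets_unique by blast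
  then obtain m where "j = k" "t = u + of_int m" by (metis Ints_cases diff_eq_eq add.commute)
  moreover have "j < components D" using c(1) crosses_classically_meets meets_components by blast
  ultimately have "velocity D j t = velocity D k u" using velocity_periodic by simp
  then show False using * turn_swap[of "velocity D i s" "velocity D k u"] by simp
qed

end

text \<open>Separates the bookkeeping from the geometry. In the application \<open>D\<close> is the
  parallel diagram and \<open>W k\<close> holds the parameters of the crossings of the original
  diagram, as seen on component \<open>k\<close>.\<close>

locale paired_cut_points = link_diagram D for D +
  fixes \<delta> :: real and W :: "nat \<Rightarrow> real set"
  assumes width_pos: "0 < \<delta>"
    and finite_windows: "k < components D \<Longrightarrow> finite {w \<in> W k. \<bar>w\<bar> \<le> R}"
    and windows_separated: "w \<in> W k \<Longrightarrow> w' \<in> W k \<Longrightarrow> \<bar>w - w'\<bar> < 2 * \<delta> \<Longrightarrow> w = w'"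
    and windows_shift: "w \<in> W k \<Longrightarrow> w + of_int m \<in> W k"
    and cut_in_window: "cut_point D k r \<Longrightarrow> \<exists>w \<in> W k. \<bar>r - w\<bar> < \<delta>"
    and window_pair: "k < components D \<Longrightarrow> w \<in> W k \<Longrightarrow>
      (\<forall>r. \<bar>r - w\<bar> < \<delta> \<longrightarrow> \<not> cut_point D k r) \<or>
      (\<exists>a b. a < b \<and> \<bar>a - w\<bar> < \<delta> \<and> \<bar>b - w\<bar> < \<delta> \<and> up_cut D k a \<and> down_cut D k b \<and>
        (\<forall>r. \<bar>r - w\<bar> < \<delta> \<and> cut_point D k r \<longrightarrow> r = a \<or> r = b))"
begin

text \<open>Any two cut points of the window may serve as \<open>a\<close> and \<open>b\<close>, so
  no pair has to be chosen, and nothing is raised in a window without cut points.\<close>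

definition raised :: "nat \<Rightarrow> real \<Rightarrow> real \<Rightarrow> bool" where
  "raised k w r \<longleftrightarrow> (\<exists>a b. \<bar>a - w\<bar> < \<delta> \<and> \<bar>b - w\<bar> < \<delta> \<and> cut_point D k a \<and> cut_point D k b \<and> a < r \<and> r < b)"

definition number :: "nat \<Rightarrow> real \<Rightarrow> int" where
  "number k r = of_bool (\<exists>w \<in> W k. raised k w r)"

lemma raised_in_window: "raised k w r \<Longrightarrow> \<bar>r - w\<bar> < \<delta>"
  unfolding raised_def by auto

lemma raised_shift:
  assumes "raised k w r"
  shows "raised k (w + of_int m) (r + of_int m)"
proof -
  obtain a b where "\<bar>a - w\<bar> < \<delta>" "\<bar>b - w\<bar> < \<delta>" "cut_point D k a" "cut_point D k b" "a < r" "r < b"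
    using assms unfolding raised_def by blast
  then show ?thesis unfolding raised_def
    by (intro exI[of _ "a + of_int m"] exI[of _ "b + of_int m"]) (simp add: cut_point_shift)
qed

lemma number_periodic: "number k (r + 1) = number k r"
proof -
  have "(\<exists>w \<in> W k. raised k w (r + 1)) \<longleftrightarrow> (\<exists>w \<in> W k. raised k w r)"
    using raised_shift[of k _ r 1] raised_shift[of k _ "r + 1" "- 1"]
      windows_shift[of _ k 1] windows_shift[of _ k "- 1"] by fastforce
  then show ?thesis by (simp add: number_def)
qed

lemma number_in_window:
  assumes "w \<in> W k" "\<bar>r - w\<bar> < \<delta>"
  shows "number k r = of_bool (raised k w r)"
proof -
  have "w' = w" if "w' \<in> W k" "raised k w' r" for w'
    using raised_in_window[OF that(2)] assms(2) by (intro windows_separated[OF that(1) assms(1)]) linarith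
  then have "(\<exists>w' \<in> W k. raised k w' r) \<longleftrightarrow> raised k w r" using assms(1) by blast
  then show ?thesis unfolding number_def by (rule arg_cong)
qed

lemma eventually_in_window: "\<bar>r - w\<bar> < \<delta> \<Longrightarrow> \<forall>\<^sub>F r' in nhds r. \<bar>r' - w\<bar> < \<delta>"
  using eventually_nhds_in_open[of "ball w \<delta>" r] by (simp add: dist_real_def abs_minus_commute)

lemma raised_between:
  assumes ab: "a < b" "\<bar>a - w\<bar> < \<delta>" "\<bar>b - w\<bar> < \<delta>" "up_cut D k a" "down_cut D k b"
    "\<And>r. \<bar>r - w\<bar> < \<delta> \<Longrightarrow> cut_point D k r \<Longrightarrow> r = a \<or> r = b"
  shows "raised k w r \<longleftrightarrow> a < r \<and> r < b"
proof
  assume "raised k w r"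
  then obtain c d where cd: "\<bar>c - w\<bar> < \<delta>" "\<bar>d - w\<bar> < \<delta>" "cut_point D k c" "cut_point D k d" "c < r" "r < d"
    unfolding raised_def by blast
  then have "c = a \<or> c = b" "d = a \<or> d = b" using ab(6) by blast+
  then show "a < r \<and> r < b" using cd(5,6) ab(1) by linarith
next
  show "a < r \<and> r < b \<Longrightarrow> raised k w r" 
    unfolding raised_def using ab(2-5) up_cut_imp down_cut_imp
    by (intro exI[of _ a] exI[of _ b]) simp
qed

text \<open>Inside a window the raised set is empty or an explicit open interval, and
  \<open>r\<close> is not one of its ends. Outside all windows, for instance on the boundary of one,
  \<open>r\<close> has a neighbourhood that avoids the finitely many closed intervals
  nearby.\<close>

lemma number_locally_constant:
  assumes k: "k < components D" and r: "\<not> cut_point D k r"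
  shows "\<forall>\<^sub>F r' in nhds r. number k r' = number k r"
proof (cases "\<exists>w \<in> W k. \<bar>r - w\<bar> < \<delta>")
  case True
  then obtain w where w: "w \<in> W k" "\<bar>r - w\<bar> < \<delta>" by blast
  have "\<forall>\<^sub>F r' in nhds r. raised k w r' = raised k w r"
    using window_pair[OF k w(1)]
  proof (elim disjE exE conjE)
    assume "\<forall>r. \<bar>r - w\<bar> < \<delta> \<longrightarrow> \<not> cut_point D k r"
    then have "\<not> raised k w r'" for r' unfolding raised_def by blast
    then show ?thesis by simp
  next
    fix a b assume ab: "a < b" "\<bar>a - w\<bar> < \<delta>" "\<bar>b - w\<bar> < \<delta>" "up_cut D k a" "down_cut D k b"
      "\<forall>r. \<bar>r - w\<bar> < \<delta> \<and> cut_point D k r \<longrightarrow> r = a \<or> r = b"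
    then have eq: "raised k w r' \<longleftrightarrow> a < r' \<and> r' < b" for r' by (intro raised_between) auto
    have "r \<noteq> a" "r \<noteq> b" using r ab(4,5) up_cut_imp down_cut_imp by blast+
    then consider "r < a" | "a < r" "r < b" | "b < r" by linarith
    then show ?thesis
    proof cases
      case 1
      then have "\<forall>\<^sub>F r' in nhds r. r' \<in> {..<a}" by (intro eventually_nhds_in_open) auto
      then show ?thesis unfolding eq by eventually_elim (use 1 in auto)
    next
      case 2
      then have "\<forall>\<^sub>F r' in nhds r. r' \<in> {a<..<b}" by (intro eventually_nhds_in_open) auto
      then show ?thesis unfolding eq by eventually_elim (use 2 in auto)
    next
      case 3
      then have "\<forall>\<^sub>F r' in nhds r. r' \<in> {b<..}" by (intro eventually_nhds_in_open) auto
      then show ?thesis unfolding eq by eventually_elim (use 3 in auto)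
    qed
  qed
  with eventually_in_window[OF w(2)] show ?thesis
    by eventually_elim (simp add: number_in_window[OF w(1)] w(2))
next
  case False
  \<comment> \<open>Raised points lie within \<open>\<delta>\<close> of their window centre, so only
    these windows can influence the number at points within \<open>\<delta>\<close> of
    \<open>r\<close>.\<close>
  define V where "V = {w \<in> W k. \<bar>w - r\<bar> < 2 * \<delta>}"
  have "finite V" unfolding V_def
    by (rule finite_subset[OF _ finite_windows[OF k, of "\<bar>r\<bar> + 2 * \<delta>"]]) auto
  have "\<forall>\<^sub>F r' in nhds r. \<forall>w \<in> V. \<not> raised k w r'"
  proof (intro eventually_ball_finite \<open>finite V\<close> ballI)
    fix w assume "w \<in> V"
    then have w: "w \<in> W k" "\<not> \<bar>r - w\<bar> < \<delta>" using False by (auto simp: V_def)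
    from window_pair[OF k w(1)] show "\<forall>\<^sub>F r' in nhds r. \<not> raised k w r'"
    proof (elim disjE exE conjE)
      assume "\<forall>r. \<bar>r - w\<bar> < \<delta> \<longrightarrow> \<not> cut_point D k r"
      then show ?thesis unfolding raised_def by (intro always_eventually) blast
    next
      fix a b assume ab: "a < b" "\<bar>a - w\<bar> < \<delta>" "\<bar>b - w\<bar> < \<delta>" "up_cut D k a" "down_cut D k b"
        "\<forall>r. \<bar>r - w\<bar> < \<delta> \<and> cut_point D k r \<longrightarrow> r = a \<or> r = b"
      then have eq: "raised k w r' \<longleftrightarrow> a < r' \<and> r' < b" for r' by (intro raised_between) auto
      have "r \<in> - {a..b}" using ab(2,3) w(2) by auto
      then have "\<forall>\<^sub>F r' in nhds r. r' \<in> - {a..b}" by (intro eventually_nhds_in_open) auto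
      then show ?thesis unfolding eq by eventually_elim auto
    qed
  qed
  moreover have "\<forall>\<^sub>F r' in nhds r. \<bar>r' - r\<bar> < \<delta>"
    using eventually_nhds_in_open[of "ball r \<delta>" r] width_pos by (simp add: dist_real_def abs_minus_commute)
  ultimately have "\<forall>\<^sub>F r' in nhds r. number k r' = 0"
  proof eventually_elim
    case (elim r')
    have "\<not> raised k w r'" if w: "w \<in> W k" for w
    proof
      assume "raised k w r'"
      then have "w \<in> V" using raised_in_window[of k w r'] elim(2) w unfolding V_def by auto
      then show False using elim(1) \<open>raised k w r'\<close> by blast
    qed
    then show ?case by (simp add: number_def)
  qed
  then show ?thesis using eventually_nhds_x_imp_x by fastforce
qed

lemma number_constant:
  assumes k: "k < components D" and st: "s < t" "\<And>r. r \<in> {s..t} \<Longrightarrow> \<not> cut_point D k r"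
  shows "number k s = number k t"
proof (rule connected_local_const[of "{s..t}"], goal_cases)
  case 4
  show ?case
  proof
    fix r assume "r \<in> {s..t}"
    then have "\<forall>\<^sub>F r' in nhds r. number k r = number k r'"
      by (rule eventually_mono[OF number_locally_constant[OF k st(2)]]) simp
    then show "\<forall>\<^sub>F r' in at r within {s..t}. number k r = number k r'"
      by (auto simp: eventually_at_filter elim: eventually_mono)
  qed
qed (use st in auto)

lemma number_at_cut:
  assumes k: "k < components D"
  shows "up_cut D k r \<Longrightarrow> incoming number k r 0 \<and> outgoing number k r 1"
    and "down_cut D k r \<Longrightarrow> incoming number k r 1 \<and> outgoing number k r 0"
proof -
  have *: "(up_cut D k r \<longrightarrow> incoming number k r 0 \<and> outgoing number k r 1) \<and>
      (down_cut D k r \<longrightarrow> incoming number k r 1 \<and> outgoing number k r 0)" if r: "cut_point D k r"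
  proof -
    obtain w where w: "w \<in> W k" "\<bar>r - w\<bar> < \<delta>" using cut_in_window[OF r] by blast
    then obtain a b where ab: "a < b" "\<bar>a - w\<bar> < \<delta>" "\<bar>b - w\<bar> < \<delta>" "up_cut D k a" "down_cut D k b"
        "\<And>r. \<bar>r - w\<bar> < \<delta> \<Longrightarrow> cut_point D k r \<Longrightarrow> r = a \<or> r = b"
      using window_pair[OF k w(1)] r by blast
    have rab: "up_cut D k r \<longleftrightarrow> r = a" "down_cut D k r \<longleftrightarrow> r = b"
      using ab(4,5) ab(6)[OF w(2) r] not_up_and_down by blast+
    have eq: "\<forall>\<^sub>F r' in nhds r. number k r' = of_bool (a < r' \<and> r' < b)"
      using eventually_in_window[OF w(2)]
      by eventually_elim (simp add: number_in_window[OF w(1)] raised_between[OF ab])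
    have less: "\<forall>\<^sub>F r' in at_left r. r' < r" by (simp add: eventually_at_filter)
    have left: "\<forall>\<^sub>F r' in at_left r. number k r' = of_bool (a < r' \<and> r' < b)"
      and right: "\<forall>\<^sub>F r' in at_right r. number k r' = of_bool (a < r' \<and> r' < b)"
      using eq by (auto simp: eventually_at_filter elim: eventually_mono)
    have "incoming number k r 0 \<and> outgoing number k r 1" if "r = a"
    proof
      show "incoming number k r 0" unfolding incoming_def using left less
        by eventually_elim (use that in auto)
      show "outgoing number k r 1" unfolding outgoing_def
        using right eventually_at_right_real[OF ab(1), folded that]
        by eventually_elim (use that in auto)
    qed
    moreover have "incoming number k r 1 \<and> outgoing number k r 0" if "r = b"
    proof
      show "incoming number k r 1" unfolding incoming_def
        using left eventually_at_left_real[OF ab(1), folded that]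
        by eventually_elim (use that in auto)
      show "outgoing number k r 0" unfolding outgoing_def using right eventually_at_right_less[of r]
        by eventually_elim (use that in auto)
    qed
    ultimately show ?thesis using rab by blast
  qed
  show "up_cut D k r \<Longrightarrow> incoming number k r 0 \<and> outgoing number k r 1"
    and "down_cut D k r \<Longrightarrow> incoming number k r 1 \<and> outgoing number k r 0"
    using * up_cut_imp down_cut_imp by blast+
qed

theorem alexander_numbering: "alexander_numbering D number"
  unfolding alexander_numbering_def
proof (intro conjI allI impI)
  show "number i (t + 1) = number i t" for i t by (rule number_periodic)
  show "number i s = number i t" if "i < components D" "s < t \<and> (\<forall>r\<in>{s..t}. \<not> cut_point D i r)" for i s t
    using that by (intro number_constant) auto
  fix i s j t
  assume "(classical_crossing D i s j t \<or> classical_crossing D j t i s) \<and>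
      0 < turn (velocity D i s) (velocity D j t)"
  then have *: "crosses_classically D i s j t" "0 < turn (velocity D i s) (velocity D j t)"
    by (auto simp: crosses_classically_def)
  then have "down_cut D i s" "up_cut D j t"
    unfolding up_cut_def down_cut_def using crosses_classically_sym by blast+
  moreover have "i < components D" "j < components D"
    using meets_components[OF crosses_classically_meets[OF *(1)]] by auto
  \<comment> \<open>The same \<open>k = 0\<close> works at every crossing, because each number is 0
    outside a pair and 1 between its members.\<close>
  ultimately show "\<exists>k. incoming number j t k \<and> outgoing number i s k \<and>
      incoming number i s (k + 1) \<and> outgoing number j t (k + 1)"
    using number_at_cut by (intro exI[of _ 0]) simp
qed

end


section \<open>Pushoffs\<close>

lemma vector_derivative_periodic:
  fixes g g' :: "real \<Rightarrow> 'a::real_normed_vector"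
  assumes "\<And>t. (g has_vector_derivative g' t) (at t)" "\<And>t. g (t + 1) = g t"
  shows "g' (t + 1) = g' t"
proof -
  have "((\<lambda>t. g (t + 1)) has_vector_derivative 1 *\<^sub>R g' (t + 1)) (at t)"
    using vector_diff_chain_at[OF has_vector_derivative_add[OF has_vector_derivative_id
        has_vector_derivative_const] assms(1)] by (simp add: o_def)
  then show ?thesis using assms(1)[of t] vector_derivative_unique_at by (fastforce simp: assms(2))
qed

lemma periodic_bounded:
  fixes g :: "real \<Rightarrow> 'a::real_normed_vector"
  assumes "continuous_on UNIV g" "\<And>t. g (t + 1) = g t"
  shows "\<exists>B. \<forall>t. norm (g t) \<le> B"
proof -
  have "compact (g ` {0..1})"
    by (intro compact_continuous_image continuous_on_subset[OF assms(1)]) auto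
  then obtain B where B: "\<And>t. t \<in> {0..1} \<Longrightarrow> norm (g t) \<le> B"
    using compact_imp_bounded by (force simp: bounded_iff)
  have "norm (g t) \<le> B" for t
    using B[of "frac t"] periodic_of_int[of g "frac t" "\<lfloor>t\<rfloor>"] assms(2) frac_lt_1[of t]
    by (simp add: frac_def)
  then show ?thesis by blast
qed

lemma smooth_periodic_bounds:
  fixes g :: "real \<Rightarrow> 'a::real_normed_vector"
  assumes "smooth g" "\<And>t. g (t + 1) = g t"
  shows "\<exists>B. \<forall>t. norm (g t) \<le> B"
    and "\<exists>B. \<forall>t. norm (vector_derivative g (at t)) \<le> B"
    and "\<exists>B. \<forall>t r. norm (g t - g r) \<le> B * \<bar>t - r\<bar>"
proof -
  show "\<exists>B. \<forall>t. norm (g t) \<le> B"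
    using assms by (intro periodic_bounded smooth_continuous_on)
  show B: "\<exists>B. \<forall>t. norm (vector_derivative g (at t)) \<le> B"
  proof (rule periodic_bounded)
    show "continuous_on UNIV (\<lambda>t. vector_derivative g (at t))"
      by (rule smooth_continuous_on[OF smooth_derivative[OF assms(1)]])
    show "vector_derivative g (at (t + 1)) = vector_derivative g (at t)" for t
      by (rule vector_derivative_periodic[OF smooth_has_vector_derivative[OF assms(1)] assms(2)])
  qed
  then obtain B where "\<And>t. norm (vector_derivative g (at t)) \<le> B" by blast
  \<comment> \<open>Linear approximation with slope 0 is the Lipschitz bound; the radius is chosen
    just to contain both points.\<close>
  then have "norm (g t - g r - (t - r) *\<^sub>R 0) \<le> B * \<bar>t - r\<bar>" for t r
    using smooth_has_vector_derivative[OF assms(1)]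
    by (intro linear_approximation[where s = t and \<rho> = "\<bar>r - t\<bar> + 1"]) auto
  then show "\<exists>B. \<forall>t r. norm (g t - g r) \<le> B * \<bar>t - r\<bar>" by auto
qed

definition offset :: "virtual_diagram \<Rightarrow> (nat \<Rightarrow> real \<Rightarrow> real) \<Rightarrow> nat \<Rightarrow> real \<Rightarrow> complex" where
  "offset D f i t = f i t *\<^sub>R (\<i> * velocity D i t)"

text \<open>The signed height \<open>h\<close> treats both copies at once:
  \<open>- \<epsilon>\<close> gives the right copy and \<open>\<epsilon>\<close> the left one.
  Keeping \<open>h\<close> outside \<open>offset\<close> makes all bounds on \<open>offset\<close>
  independent of \<open>\<epsilon>\<close>.\<close>

definition pushoff :: "virtual_diagram \<Rightarrow> (nat \<Rightarrow> real \<Rightarrow> real) \<Rightarrow> real \<Rightarrow> nat \<Rightarrow> real \<Rightarrow> complex" where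
  "pushoff D f h i t = curve D i t + h *\<^sub>R offset D f i t"

definition pushoff_velocity ::
    "virtual_diagram \<Rightarrow> (nat \<Rightarrow> real \<Rightarrow> real) \<Rightarrow> real \<Rightarrow> nat \<Rightarrow> real \<Rightarrow> complex" where
  "pushoff_velocity D f h i t = velocity D i t + h *\<^sub>R vector_derivative (offset D f i) (at t)"

lemma right_copy_eq: "right_copy D f \<epsilon> i t = pushoff D f (- \<epsilon>) i t"
  and left_copy_eq: "left_copy D f \<epsilon> i t = pushoff D f \<epsilon> i t"
  by (simp_all add: right_copy_def left_copy_def pushoff_def offset_def scaleR_conv_of_real mult_ac)

section \<open>Bounds uniform along the curves and over all crossings\<close>

locale twisted_diagram = link_diagram D for D +
  fixes \<delta> :: real and f :: "nat \<Rightarrow> real \<Rightarrow> real"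
  assumes profile: "twist_profile D \<delta> f"
begin

lemma \<delta>_pos: "0 < \<delta>"
  and smooth_f: "i < components D \<Longrightarrow> smooth (f i)"
  and f_simple_zero: "i < components D \<Longrightarrow> f i r = 0 \<Longrightarrow> deriv (f i) r \<noteq> 0"
  and card_twist_zeros: "i < components D \<Longrightarrow> positive_under D i t \<or> negative_under D i t \<Longrightarrow>
    card (twist_zeros D \<delta> f i t) = 2"
  and f_nonpos: "i < components D \<Longrightarrow> f i r \<le> 0 \<Longrightarrow>
    \<exists>t. (positive_under D i t \<and> t < r \<and> r < t + \<delta>) \<or> (negative_under D i t \<and> t - \<delta> < r \<and> r < t)"
proof -
  show "0 < \<delta>" using profile unfolding twist_profile_def by (rule conjunct1)
  assume i: "i < components D"
  note * = profile[unfolded twist_profile_def, THEN conjunct2, THEN conjunct2, rule_format, OF i]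
  show "smooth (f i)" using * by (rule conjunct1)
  show "f i r = 0 \<Longrightarrow> deriv (f i) r \<noteq> 0"
    using *[THEN conjunct2, THEN conjunct2, THEN conjunct1] by blast
  show "positive_under D i t \<or> negative_under D i t \<Longrightarrow> card (twist_zeros D \<delta> f i t) = 2"
    using *[THEN conjunct2, THEN conjunct2, THEN conjunct2, THEN conjunct1] by blast
  show "f i r \<le> 0 \<Longrightarrow>
      \<exists>t. (positive_under D i t \<and> t < r \<and> r < t + \<delta>) \<or> (negative_under D i t \<and> t - \<delta> < r \<and> r < t)"
    using *[THEN conjunct2, THEN conjunct2, THEN conjunct2, THEN conjunct2] by blast
qed

lemma f_periodic: "i < components D \<Longrightarrow> f i (r + of_int m) = f i r"
  using profile unfolding twist_profile_def by (intro periodic_of_int) blast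

lemma separated:
  "crossing_param D i s \<Longrightarrow> crossing_param D i s' \<Longrightarrow> \<bar>s - s'\<bar> < 2 * \<delta> \<Longrightarrow> s = s'"
  using profile unfolding twist_profile_def crossing_param_def by (meson not_le)

text \<open>A nonpositive value occurs only strictly inside the twist interval of some under
  passage, thus within \<open>\<delta>\<close> of another crossing parameter, which the separation
  of crossings forbids.\<close>

lemma f_crossing_pos:
  assumes "crossing_param D i s"
  shows "f i s > 0"
proof (rule ccontr)
  assume "\<not> f i s > 0"
  then obtain t where "positive_under D i t \<or> negative_under D i t" "\<bar>s - t\<bar> < \<delta>" "s \<noteq> t"
    using f_nonpos[of i s] crossing_param_component[OF assms] by force
  then show False using separated[OF assms, of t] under_crossing_param[of i t] \<delta>_pos by auto
qed

lemma smooth_offset: "i < components D \<Longrightarrow> smooth (offset D f i)"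
  unfolding offset_def[abs_def]
  by (intro smooth_bilinear[OF bounded_bilinear_scaleR] smooth_bilinear[OF bounded_bilinear_mult]
      smooth_f smooth_const smooth_velocity)

lemma offset_periodic: "i < components D \<Longrightarrow> offset D f i (t + of_int m) = offset D f i t"
  by (simp add: offset_def f_periodic velocity_periodic)

lemma pushoff_periodic: "i < components D \<Longrightarrow> pushoff D f h i (t + of_int m) = pushoff D f h i t"
  by (simp add: pushoff_def offset_periodic curve_periodic)

lemma pushoff_has_derivative:
  assumes "i < components D"
  shows "(pushoff D f h i has_vector_derivative pushoff_velocity D f h i t) (at t)"
proof -
  have "((\<lambda>t. curve D i t + h *\<^sub>R offset D f i t) has_vector_derivative
      velocity D i t + (h *\<^sub>R vector_derivative (offset D f i) (at t) + 0 *\<^sub>R offset D f i t)) (at t)"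
    using assms smooth_offset smooth_has_vector_derivative curve_has_derivative
    by (intro has_vector_derivative_add has_vector_derivative_scaleR derivative_intros) blast+
  then show ?thesis by (simp add: pushoff_def[abs_def] pushoff_velocity_def)
qed

lemma smooth_pushoff: "i < components D \<Longrightarrow> smooth (pushoff D f h i)"
  unfolding pushoff_def[abs_def]
  by (intro smooth_add smooth_bilinear[OF bounded_bilinear_scaleR] smooth_const smooth_offset smooth_curve)

text \<open>A single constant for upper bounds, Lipschitz bounds and, as \<open>1 / K\<close>, the
  lower bound on the speed. The condition is monotone in \<open>K\<close>, so a maximum over the
  components serves all of them.\<close>

definition bounded_by :: "real \<Rightarrow> nat \<Rightarrow> bool" where
  "bounded_by K i \<longleftrightarrow> 1 \<le> K \<and>
     (\<forall>t. norm (velocity D i t) \<le> K \<and> 1 / K \<le> norm (velocity D i t) \<and> \<bar>f i t\<bar> \<le> K \<and>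
        norm (offset D f i t) \<le> K \<and> norm (vector_derivative (offset D f i) (at t)) \<le> K) \<and>
     (\<forall>t r. norm (velocity D i t - velocity D i r) \<le> K * \<bar>t - r\<bar> \<and>
        \<bar>f i t - f i r\<bar> \<le> K * \<bar>t - r\<bar> \<and> norm (offset D f i t - offset D f i r) \<le> K * \<bar>t - r\<bar>)"

lemma bounded_by_mono:
  assumes "bounded_by K i" "K \<le> K'"
  shows "bounded_by K' i"
proof -
  have 1: "K * \<bar>t - r\<bar> \<le> K' * \<bar>t - r\<bar>" for t r :: real using assms by (simp add: mult_right_mono)
  have 2: "1 / K' \<le> 1 / K" using assms by (simp add: bounded_by_def frac_le)
  show ?thesis
    unfolding bounded_by_def
  proof (intro conjI allI)
    show "1 \<le> K'" using assms unfolding bounded_by_def by linarith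
    fix t r
    show "norm (velocity D i t) \<le> K'" "\<bar>f i t\<bar> \<le> K'" "norm (offset D f i t) \<le> K'"
      "norm (vector_derivative (offset D f i) (at t)) \<le> K'"
      using assms(1) order_trans[OF _ assms(2)] unfolding bounded_by_def by blast+
    show "1 / K' \<le> norm (velocity D i t)"
      using assms(1) order_trans[OF 2] unfolding bounded_by_def by blast
    show "norm (velocity D i t - velocity D i r) \<le> K' * \<bar>t - r\<bar>" "\<bar>f i t - f i r\<bar> \<le> K' * \<bar>t - r\<bar>"
      "norm (offset D f i t - offset D f i r) \<le> K' * \<bar>t - r\<bar>"
      using assms(1) order_trans[OF _ 1] unfolding bounded_by_def by blast+
  qed
qed

text \<open>Bounding the reciprocal turns the lower bound into an upper bound for a continuous
  periodic function.\<close>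

lemma velocity_lower_bound:
  assumes "i < components D"
  shows "\<exists>B. \<forall>t. 1 / norm (velocity D i t) \<le> B"
proof -
  have "\<exists>B. \<forall>t. norm (1 / norm (velocity D i t)) \<le> B"
    using assms velocity_nonzero velocity_periodic[of i _ 1] smooth_continuous_on[OF smooth_velocity]
    by (intro periodic_bounded continuous_intros) auto
  then show ?thesis by simp
qed

lemma ex_bounded_by: "\<exists>K. \<forall>i < components D. bounded_by K i"
proof -
  have "\<exists>K. bounded_by K i" if i: "i < components D" for i
  proof -
    note v = smooth_periodic_bounds[OF smooth_velocity[OF i] velocity_periodic[OF i, of _ 1, simplified]]
    note w = smooth_periodic_bounds[OF smooth_offset[OF i] offset_periodic[OF i, of _ 1, simplified]]
    note f = smooth_periodic_bounds[OF smooth_f[OF i] f_periodic[OF i, of _ 1, simplified]]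
    obtain a where a: "\<And>t. norm (velocity D i t) \<le> a" using v(1) by blast
    obtain b where b: "\<And>t r. norm (velocity D i t - velocity D i r) \<le> b * \<bar>t - r\<bar>" using v(3) by blast
    obtain c where c: "\<And>t. 1 / norm (velocity D i t) \<le> c" using velocity_lower_bound[OF i] by blast
    obtain d where d: "\<And>t. \<bar>f i t\<bar> \<le> d" using f(1) by auto
    obtain e where e: "\<And>t r. \<bar>f i t - f i r\<bar> \<le> e * \<bar>t - r\<bar>" using f(3) by auto
    obtain g where g: "\<And>t. norm (offset D f i t) \<le> g" using w(1) by blast
    obtain h where h: "\<And>t. norm (vector_derivative (offset D f i) (at t)) \<le> h" using w(2) by blast
    obtain k where k: "\<And>t r. norm (offset D f i t - offset D f i r) \<le> k * \<bar>t - r\<bar>" using w(3) by blast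
    define K where "K = Max {1, a, b, c, d, e, g, h, k}"
    have K: "1 \<le> K" "a \<le> K" "b \<le> K" "c \<le> K" "d \<le> K" "e \<le> K" "g \<le> K" "h \<le> K" "k \<le> K"
      unfolding K_def by (rule Max_ge; simp)+
    have lip: "x * \<bar>t - r\<bar> \<le> K * \<bar>t - r\<bar>" if "x \<le> K" for x t r :: real
      using that by (simp add: mult_right_mono)
    have inv: "1 / K \<le> norm (velocity D i t)" for t
    proof -
      have "1 / norm (velocity D i t) \<le> K" using c[of t] K by linarith
      then show ?thesis using K(1) velocity_nonzero[OF i] by (simp add: field_simps)
    qed
    have "bounded_by K i"
      unfolding bounded_by_def
      by (intro conjI allI inv K(1) order_trans[OF a K(2)] order_trans[OF d K(5)] order_trans[OF g K(7)]
          order_trans[OF h K(8)] order_trans[OF b lip[OF K(3)]] order_trans[OF e lip[OF K(6)]]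
          order_trans[OF k lip[OF K(9)]])
    then show ?thesis ..
  qed
  then obtain K where K: "\<And>i. i < components D \<Longrightarrow> bounded_by (K i) i" by metis
  have "bounded_by (Max (K ` {..<components D})) i" if "i < components D" for i
    using that by (intro bounded_by_mono[OF K]) auto
  then show ?thesis by blast
qed

text \<open>Up to integer shifts there are only finitely many crossings, all of them transverse. The
  value 1 is inserted so that the minimum exists for a diagram without crossings.\<close>

lemma ex_turn_bound:
  "\<exists>\<tau>>0. \<forall>i s j t. meets D i s j t \<longrightarrow> \<tau> \<le> \<bar>turn (velocity D i s) (velocity D j t)\<bar>"
proof -
  define B where "B = insert 1 ((\<lambda>(i, s, j, t). \<bar>turn (velocity D i s) (velocity D j t)\<bar>) `
      {(i, s, j, t). meets D i s j t \<and> \<bar>s\<bar> \<le> 1 \<and> \<bar>t\<bar> \<le> 1})"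
  have fin: "finite B" "B \<noteq> {}" unfolding B_def using finite_meets by auto
  have "x > 0" if "x \<in> B" for x using that meets_transverse unfolding B_def by auto
  then have "Min B > 0" using fin by simp
  moreover have "Min B \<le> \<bar>turn (velocity D i s) (velocity D j t)\<bar>" if m: "meets D i s j t" for i s j t
  proof (rule Min_le[OF fin(1)])
    have i: "i < components D" "j < components D" using m by (auto simp: meets_def)
    have "meets D i (frac s) j (frac t)"
      using m meets_shift[of i "frac s" "\<lfloor>s\<rfloor>" j "frac t" "\<lfloor>t\<rfloor>"] by (simp add: frac_def)
    moreover have "velocity D i s = velocity D i (frac s)" "velocity D j t = velocity D j (frac t)"
      using velocity_periodic[OF i(1), of "frac s" "\<lfloor>s\<rfloor>"] velocity_periodic[OF i(2), of "frac t" "\<lfloor>t\<rfloor>"]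
      by (simp_all add: frac_def)
    ultimately show "\<bar>turn (velocity D i s) (velocity D j t)\<bar> \<in> B"
      unfolding B_def using frac_lt_1[of s] frac_lt_1[of t]
      by (intro insertI2 image_eqI[where x = "(i, frac s, j, frac t)"]) auto
  qed
  ultimately show ?thesis by blast
qed

lemma ex_f_bound: "\<exists>\<phi>>0. \<forall>i s. crossing_param D i s \<longrightarrow> \<phi> \<le> f i s"
proof -
  define B where "B = insert 1 (\<Union>i<components D. f i ` {s. crossing_param D i s \<and> \<bar>s\<bar> \<le> 1})"
  have fin: "finite B" "B \<noteq> {}" unfolding B_def using finite_crossing_params by auto
  have "x > 0" if "x \<in> B" for x using that f_crossing_pos unfolding B_def by auto
  then have "Min B > 0" using fin by simp
  moreover have "Min B \<le> f i s" if s: "crossing_param D i s" for i s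
  proof (rule Min_le[OF fin(1)])
    have "crossing_param D i (frac s)" "f i s = f i (frac s)"
      using s crossing_param_shift[of i "frac s" "\<lfloor>s\<rfloor>"]
        f_periodic[OF crossing_param_component[OF s], of "frac s" "\<lfloor>s\<rfloor>"] by (simp_all add: frac_def)
    then show "f i s \<in> B"
      unfolding B_def using frac_lt_1[of s] crossing_param_component[OF s]
      by (intro insertI2 UN_I[of i] image_eqI[of _ _ "frac s"]) auto
  qed
  ultimately show ?thesis by blast
qed

definition nearly_meets :: "real \<Rightarrow> nat \<Rightarrow> real \<Rightarrow> nat \<Rightarrow> real \<Rightarrow> bool" where
  "nearly_meets \<eta> i r j q \<longleftrightarrow> (\<exists>s t. meets D i s j t \<and> \<bar>r - s\<bar> < \<eta> \<and> \<bar>q - t\<bar> < \<eta>)"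

lemma nearly_meets_shift: "nearly_meets \<eta> i (r + of_int m) j (q + of_int l) \<longleftrightarrow> nearly_meets \<eta> i r j q"
proof -
  have *: "nearly_meets \<eta> i (r + of_int m) j (q + of_int l)" if "nearly_meets \<eta> i r j q" for r q m l
  proof -
    obtain s t where "meets D i s j t" "\<bar>r - s\<bar> < \<eta>" "\<bar>q - t\<bar> < \<eta>"
      using \<open>nearly_meets \<eta> i r j q\<close> unfolding nearly_meets_def by blast
    then show ?thesis unfolding nearly_meets_def
      by (intro exI[of _ "s + of_int m"] exI[of _ "t + of_int l"]) (simp add: meets_shift)
  qed
  show ?thesis using *[of r q m l] *[of "r + of_int m" "q + of_int l" "- m" "- l"] by auto
qed

text \<open>Compactness: the excluded parameter pairs form an open set containing all coincidences
  of the two curves, so the distance has a positive minimum on the rest of the unit square;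
  periodicity transfers this to all parameters.\<close>

lemma curves_far_apart:
  assumes ij: "i < components D" "j < components D" and "0 < \<eta>"
  shows "\<exists>\<kappa>>0. \<forall>r q. norm (curve D i r - curve D j q) < \<kappa> \<longrightarrow>
    i = j \<and> (\<exists>m::int. \<bar>r - q - of_int m\<bar> < \<eta>) \<or> nearly_meets \<eta> i r j q"
proof -
  define near where "near r q \<longleftrightarrow> i = j \<and> (\<exists>m::int. \<bar>r - q - of_int m\<bar> < \<eta>) \<or> nearly_meets \<eta> i r j q" for r q
  have near_shift: "near (r + of_int m) (q + of_int l) \<longleftrightarrow> near r q" for r q m l
  proof -
    have "(\<exists>k::int. \<bar>r + of_int m - (q + of_int l) - of_int k\<bar> < \<eta>) \<longleftrightarrow> (\<exists>k::int. \<bar>r - q - of_int k\<bar> < \<eta>)"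
      (is "?L \<longleftrightarrow> ?R")
    proof
      assume ?L
      then obtain k :: int where "\<bar>r + of_int m - (q + of_int l) - of_int k\<bar> < \<eta>" ..
      then show ?R by (intro exI[of _ "k - m + l"]) (simp add: algebra_simps)
    next
      assume ?R
      then obtain k :: int where "\<bar>r - q - of_int k\<bar> < \<eta>" ..
      then show ?L by (intro exI[of _ "k + m - l"]) (simp add: algebra_simps)
    qed
    then show ?thesis by (simp add: near_def nearly_meets_shift)
  qed
  define S where "S = ({0..1} \<times> {0..1}) - {p. near (fst p) (snd p)}"
  define F where "F p = norm (curve D i (fst p) - curve D j (snd p))" for p
  have "open {p. near (fst p) (snd p)}"
    unfolding near_def nearly_meets_def
    by (intro open_Collect_disj open_Collect_conj open_Collect_ex open_Collect_const open_Collect_less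
        continuous_intros)
  then have "compact S" unfolding S_def
    by (intro compact_diff compact_Times compact_Icc)
  have contF: "continuous_on S F"
    unfolding F_def
    by (intro continuous_intros continuous_on_compose2[OF smooth_continuous_on[OF smooth_curve[OF ij(1)], of UNIV]]
        continuous_on_compose2[OF smooth_continuous_on[OF smooth_curve[OF ij(2)], of UNIV]]) auto
  have posF: "F p > 0" if "p \<in> S" for p
  proof (rule ccontr)
    assume "\<not> F p > 0"
    then have eq: "curve D i (fst p) = curve D j (snd p)" by (simp add: F_def)
    have "near (fst p) (snd p)"
    proof (cases "i = j \<and> fst p - snd p \<in> \<int>")
      case True
      then obtain m where "i = j" "fst p - snd p = of_int m" by (auto elim: Ints_cases)
      then have "\<bar>fst p - snd p - of_int m\<bar> < \<eta>" using \<open>0 < \<eta>\<close> by simp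
      then show ?thesis using \<open>i = j\<close> unfolding near_def by blast
    next
      case False
      then have "meets D i (fst p) j (snd p)" using ij eq by (simp add: meets_def)
      then show ?thesis using \<open>0 < \<eta>\<close> unfolding near_def nearly_meets_def by force
    qed
    then show False using that by (simp add: S_def)
  qed
  obtain \<kappa> where \<kappa>: "\<kappa> > 0" "\<And>p. p \<in> S \<Longrightarrow> \<kappa> \<le> F p"
  proof (cases "S = {}")
    case True
    then show ?thesis using that[of 1] by simp
  next
    case False
    then obtain p where "p \<in> S" "\<And>y. y \<in> S \<Longrightarrow> F p \<le> F y"
      using continuous_attains_inf[OF \<open>compact S\<close> _ contF] by blast
    then show ?thesis using that posF by blast
  qed
  have "near r q" if "norm (curve D i r - curve D j q) < \<kappa>" for r q
  proof (rule ccontr)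
    assume "\<not> near r q"
    then have "\<not> near (frac r) (frac q)"
      using near_shift[of "frac r" "\<lfloor>r\<rfloor>" "frac q" "\<lfloor>q\<rfloor>"] by (simp add: frac_def)
    then have "(frac r, frac q) \<in> S"
      using frac_lt_1[of r] frac_lt_1[of q] by (simp add: S_def less_imp_le)
    then have "\<kappa> \<le> norm (curve D i (frac r) - curve D j (frac q))" using \<kappa>(2) by (force simp: F_def)
    then show False
      using that curve_periodic[OF ij(1), of "frac r" "\<lfloor>r\<rfloor>"] curve_periodic[OF ij(2), of "frac q" "\<lfloor>q\<rfloor>"]
      by (simp add: frac_def)
  qed
  then show ?thesis using \<kappa>(1) unfolding near_def by blast
qed

end

text \<open>All that the later arguments know about a small \<open>\<epsilon>\<close>; the estimates
  stay hidden behind these qualitative facts. \<open>coincidence\<close> says that there are no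
  crossings besides those at twists and near crossings of \<open>D\<close>, while the
  \<open>near_\<close> facts describe the latter.\<close>

locale fine_pushoffs = twisted_diagram D \<delta> f for D \<delta> f +
  fixes \<epsilon> \<eta> :: real
  assumes \<epsilon>_pos: "0 < \<epsilon>" and \<eta>_pos: "0 < \<eta>" and \<eta>_le: "2 * \<eta> \<le> \<delta>"
    and immersed: "i < components D \<Longrightarrow> \<bar>h\<bar> = \<epsilon> \<Longrightarrow> pushoff_velocity D f h i r \<noteq> 0"
    and coincidence: "i < components D \<Longrightarrow> j < components D \<Longrightarrow> \<bar>h\<bar> = \<epsilon> \<Longrightarrow> \<bar>k\<bar> = \<epsilon> \<Longrightarrow>
      pushoff D f h i r = pushoff D f k j q \<Longrightarrow>
      i = j \<and> r - q \<in> \<int> \<and> (h = k \<or> f i r = 0) \<or> nearly_meets \<eta> i r j q"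
    and f_near_pos: "crossing_param D i s \<Longrightarrow> \<bar>r - s\<bar> < \<eta> \<Longrightarrow> 0 < f i r"
    and near_exists: "meets D i s j t \<Longrightarrow> \<bar>h\<bar> = \<epsilon> \<Longrightarrow> \<bar>k\<bar> = \<epsilon> \<Longrightarrow>
      \<exists>r q. \<bar>r - s\<bar> < \<eta> \<and> \<bar>q - t\<bar> < \<eta> \<and> pushoff D f h i r = pushoff D f k j q"
    and near_unique: "meets D i s j t \<Longrightarrow> \<bar>h\<bar> = \<epsilon> \<Longrightarrow> \<bar>k\<bar> = \<epsilon> \<Longrightarrow>
      \<bar>r - s\<bar> < \<eta> \<Longrightarrow> \<bar>q - t\<bar> < \<eta> \<Longrightarrow> pushoff D f h i r = pushoff D f k j q \<Longrightarrow>
      \<bar>r' - s\<bar> < \<eta> \<Longrightarrow> \<bar>q' - t\<bar> < \<eta> \<Longrightarrow> pushoff D f h i r' = pushoff D f k j q' \<Longrightarrow>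
      r = r' \<and> q = q'"
    and near_turn: "meets D i s j t \<Longrightarrow> \<bar>h\<bar> = \<epsilon> \<Longrightarrow> \<bar>k\<bar> = \<epsilon> \<Longrightarrow>
      \<bar>r - s\<bar> < \<eta> \<Longrightarrow> \<bar>q - t\<bar> < \<eta> \<Longrightarrow>
      0 < turn (pushoff_velocity D f h i r) (pushoff_velocity D f k j q) *
        turn (velocity D i s) (velocity D j t)"
    and near_order: "meets D i s j t \<Longrightarrow> \<bar>h\<bar> = \<epsilon> \<Longrightarrow>
      \<bar>r - s\<bar> < \<eta> \<Longrightarrow> \<bar>q - t\<bar> < \<eta> \<Longrightarrow> pushoff D f h i r = pushoff D f (- \<epsilon>) j q \<Longrightarrow>
      \<bar>r' - s\<bar> < \<eta> \<Longrightarrow> \<bar>q' - t\<bar> < \<eta> \<Longrightarrow> pushoff D f h i r' = pushoff D f \<epsilon> j q' \<Longrightarrow>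
      0 < (r - r') * turn (velocity D i s) (velocity D j t)"

text \<open>The bounds on \<open>\<kappa>\<close> are those of \<open>transverse_pair\<close> and
  \<open>crossing_order\<close>. The bound \<open>K * \<eta> < \<phi>\<close> keeps \<open>f\<close>
  positive near crossings, the fourth and fifth powers of \<open>K\<close> serve
  \<open>local_injective\<close>, and \<open>\<eta> * \<tau> / (4 * K)\<close> is the distance
  allowed in \<open>crossing_exists\<close>.\<close>

locale pushoff_estimates = twisted_diagram D \<delta> f for D \<delta> f +
  fixes K \<tau> \<phi> \<kappa> \<eta> \<epsilon> :: real
  assumes K: "1 \<le> K" "i < components D \<Longrightarrow> bounded_by K i"
    and \<tau>: "0 < \<tau>" "meets D i s j t \<Longrightarrow> \<tau> \<le> \<bar>turn (velocity D i s) (velocity D j t)\<bar>"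
    and \<phi>: "0 < \<phi>" "crossing_param D i s \<Longrightarrow> \<phi> \<le> f i s"
    and \<kappa>: "0 < \<kappa>" "\<kappa> \<le> \<tau> / (4 * K)" "\<kappa> \<le> K" "K * \<kappa> * (16 * K\<^sup>2 / \<tau> + 2) < 2 * \<phi> * (1 / K)\<^sup>2"
    and \<eta>: "0 < \<eta>" "2 * K * \<eta> \<le> \<kappa>" "2 * \<eta> \<le> \<delta>" "K * \<eta> < \<phi>" "4 * K ^ 4 * \<eta> \<le> 1"
    and \<epsilon>: "0 < \<epsilon>" "2 * K * \<epsilon> \<le> \<kappa>" "2 * K * \<epsilon> \<le> \<eta> * \<tau> / (4 * K)" "4 * K ^ 5 * \<epsilon> \<le> 1"
    and far: "i < components D \<Longrightarrow> j < components D \<Longrightarrow>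
      norm (curve D i r - curve D j q) \<le> 2 * K * \<epsilon> \<Longrightarrow>
      i = j \<and> (\<exists>m::int. \<bar>r - q - of_int m\<bar> < \<eta>) \<or> nearly_meets \<eta> i r j q"
begin

section \<open>Geometry of the pushoffs for one fixed small offset\<close>

lemma estimates:
  assumes "i < components D"
  shows "norm (velocity D i r) \<le> K" "1 / K \<le> norm (velocity D i r)" "\<bar>f i r\<bar> \<le> K"
    "norm (offset D f i r) \<le> K" "norm (vector_derivative (offset D f i) (at r)) \<le> K"
    "norm (velocity D i r - velocity D i q) \<le> K * \<bar>r - q\<bar>"
    "\<bar>f i r - f i q\<bar> \<le> K * \<bar>r - q\<bar>"
    "norm (offset D f i r - offset D f i q) \<le> K * \<bar>r - q\<bar>"
  using K(2)[OF assms] unfolding bounded_by_def by simp_all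

lemma velocity_close:
  assumes "i < components D" "\<bar>h\<bar> = \<epsilon>" "\<bar>r - s\<bar> < \<eta>"
  shows "norm (pushoff_velocity D f h i r - velocity D i s) \<le> \<kappa>"
proof -
  have "pushoff_velocity D f h i r - velocity D i s =
      (velocity D i r - velocity D i s) + h *\<^sub>R vector_derivative (offset D f i) (at r)"
    by (simp add: pushoff_velocity_def)
  also have "norm \<dots> \<le> K * \<bar>r - s\<bar> + \<epsilon> * K"
    using estimates[OF assms(1)] assms(2) \<epsilon>(1)
    by (intro order_trans[OF norm_triangle_ineq add_mono]) (auto intro: mult_left_mono)
  also have "\<dots> \<le> K * \<eta> + \<epsilon> * K" using assms K(1) by simp
  also have "\<dots> \<le> \<kappa>" using \<epsilon>(2) \<eta>(2) by (simp add: algebra_simps)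
  finally show ?thesis .
qed

lemma nearly_linear_pushoff:
  assumes "i < components D" "\<bar>h\<bar> = \<epsilon>"
  shows "nearly_linear (pushoff D f h i) (velocity D i s) s \<eta> \<kappa>"
  unfolding nearly_linear_def
  using linear_approximation[of s \<eta> "pushoff D f h i" "pushoff_velocity D f h i"]
    velocity_close[OF assms] pushoff_has_derivative[OF assms(1)] by blast

lemma transverse_pair:
  assumes "meets D i s j t"
  shows "transverse_pair (velocity D i s) (velocity D j t) \<tau> K \<kappa>"
  using assms \<tau> K(1) \<kappa> estimates(1) meets_components[OF assms] by unfold_locales auto

text \<open>The offset changes the velocity by at most \<open>\<epsilon> * K\<close>, which is less
  than the minimal speed \<open>1 / K\<close>.\<close>

lemma fine_immersed:
  assumes "i < components D" "\<bar>h\<bar> = \<epsilon>"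
  shows "pushoff_velocity D f h i r \<noteq> 0"
proof
  assume "pushoff_velocity D f h i r = 0"
  then have "velocity D i r = - (h *\<^sub>R vector_derivative (offset D f i) (at r))"
    by (simp add: pushoff_velocity_def eq_neg_iff_add_eq_0)
  then have "norm (velocity D i r) = \<epsilon> * norm (vector_derivative (offset D f i) (at r))"
    using assms by simp
  then have "1 / K \<le> \<epsilon> * K"
    using estimates(2,5)[OF assms(1), of r] \<epsilon>(1) by (metis mult_left_mono less_imp_le order_trans)
  then have "1 \<le> K * \<epsilon> * K" using K(1) by (simp add: field_simps)
  also have "K * \<epsilon> * K = K ^ 2 * \<epsilon>" by (simp add: power2_eq_square)
  also have "\<dots> \<le> K ^ 5 * \<epsilon>" using K(1) \<epsilon>(1) by (intro mult_right_mono power_increasing) auto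
  finally show False using \<epsilon>(4) by simp
qed

lemma f_positive_near:
  assumes "crossing_param D i s" "\<bar>r - s\<bar> < \<eta>"
  shows "0 < f i r"
proof -
  have "\<bar>f i r - f i s\<bar> \<le> K * \<bar>r - s\<bar>" by (intro estimates crossing_param_component[OF assms(1)])
  also have "\<dots> \<le> K * \<eta>" using assms(2) K(1) by simp
  finally show ?thesis using \<phi>(2)[OF assms(1)] \<eta>(4) by linarith
qed

text \<open>For \<open>h = - k\<close> the offsets differ by an amount of order
  \<open>\<epsilon>\<close> that is not controlled by \<open>r - q\<close>, so Lipschitz estimates
  alone do not give \<open>r = q\<close>. Up to terms small relative to \<open>r - q\<close> that
  difference is normal to the curve, hence the tangential component of the equation decides.\<close>

lemma local_injective:
  assumes i: "i < components D" and hk: "\<bar>h\<bar> = \<epsilon>" "\<bar>k\<bar> = \<epsilon>" and rq: "\<bar>r - q\<bar> < \<eta>"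
    and eq: "pushoff D f h i r = pushoff D f k i q"
  shows "r = q \<and> (h = k \<or> f i r = 0)"
proof -
  define v where "v = velocity D i r"
  define e where "e = curve D i r - curve D i q - (r - q) *\<^sub>R v"
  define e' where "e' = f i q *\<^sub>R (\<i> * (v - velocity D i q))"
  have "norm e \<le> (K * \<bar>r - q\<bar>) * \<bar>r - q\<bar>"
    unfolding e_def v_def
  proof (rule differentiable_bound_linearization[of q r "closed_segment q r" "curve D i"
        "\<lambda>x h. h *\<^sub>R velocity D i x" r "K * \<bar>r - q\<bar>", THEN order_trans, simplified real_norm_def])
    show "q + t *\<^sub>R (r - q) \<in> closed_segment q r" if "t \<in> {0..1}" for t
      using that by (auto simp: in_segment algebra_simps intro!: exI[of _ t])
    show "(curve D i has_derivative (\<lambda>h. h *\<^sub>R velocity D i x)) (at x within closed_segment q r)" for x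
      using curve_has_derivative[OF i, of x]
      by (simp add: has_vector_derivative_def has_derivative_at_withinI)
    show "onorm ((\<lambda>h. h *\<^sub>R velocity D i x) - (\<lambda>h. h *\<^sub>R velocity D i r)) \<le> K * \<bar>r - q\<bar>"
      if "x \<in> closed_segment q r" for x
    proof (rule onorm_bound)
      have "\<bar>x - r\<bar> \<le> \<bar>r - q\<bar>" using that by (auto simp: closed_segment_eq_real_ivl split: if_splits)
      then have "norm (velocity D i x - velocity D i r) \<le> K * \<bar>r - q\<bar>"
        using estimates(6)[OF i, of x r] K(1) by (meson mult_left_mono order_trans zero_le_one)
      then show "norm (((\<lambda>h. h *\<^sub>R velocity D i x) - (\<lambda>h. h *\<^sub>R velocity D i r)) h) \<le> K * \<bar>r - q\<bar> * norm h"
        for h using mult_left_mono[of _ _ "norm h"]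
        by (simp add: mult.commute[of "K * _"] flip: scaleR_diff_right)
    qed (use K(1) in simp)
  qed (auto simp: mult.commute)
  then have e: "norm e \<le> K * \<eta> * \<bar>r - q\<bar>"
    using rq K(1) by (meson mult_left_mono mult_right_mono abs_ge_zero less_imp_le order_trans zero_le_one)
  have "norm e' = \<bar>f i q\<bar> * norm (velocity D i r - velocity D i q)" by (simp add: e'_def v_def norm_mult)
  also have "\<dots> \<le> K * (K * \<bar>r - q\<bar>)"
    using K(1) by (intro mult_mono estimates[OF i]) auto
  finally have e': "norm e' \<le> K * (K * \<bar>r - q\<bar>)" .
  (* pairing with the normal i v eliminates the offset of v itself *)
  have "(r - q) *\<^sub>R v + e + (h * f i r - k * f i q) *\<^sub>R (\<i> * v) + k *\<^sub>R e' = 0"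
    using eq by (simp add: e_def e'_def v_def pushoff_def offset_def algebra_simps)
  then have "turn (\<i> * v) ((r - q) *\<^sub>R v + e + (h * f i r - k * f i q) *\<^sub>R (\<i> * v) + k *\<^sub>R e') = 0"
    by (simp add: turn_def)
  moreover have "turn (\<i> * v) v = - (norm v)\<^sup>2"
    unfolding cmod_power2 by (simp add: turn_def power2_eq_square)
  ultimately have main: "(r - q) * (norm v)\<^sup>2 = turn (\<i> * v) e + k * turn (\<i> * v) e'"
    by (simp add: turn_simps)
  have nv: "norm (\<i> * v) \<le> K" "1 / K \<le> norm v" using estimates(1,2)[OF i] by (simp_all add: v_def norm_mult)
  have "\<bar>r - q\<bar> * (1 / K)\<^sup>2 \<le> \<bar>r - q\<bar> * (norm v)\<^sup>2"
    using nv K(1) by (intro mult_left_mono power_mono) auto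
  also have "\<dots> = \<bar>turn (\<i> * v) e + k * turn (\<i> * v) e'\<bar>" using main by (metis abs_mult abs_power2)
  also have "\<dots> \<le> \<bar>turn (\<i> * v) e\<bar> + \<epsilon> * \<bar>turn (\<i> * v) e'\<bar>"
    using abs_triangle_ineq[of "turn (\<i> * v) e" "k * turn (\<i> * v) e'"] hk by (simp add: abs_mult)
  also have "\<dots> \<le> K * (K * \<eta> * \<bar>r - q\<bar>) + \<epsilon> * (K * (K * (K * \<bar>r - q\<bar>)))"
    using nv e e' K(1) \<epsilon>(1)
    by (intro add_mono mult_left_mono order_trans[OF abs_turn_le mult_mono]) auto
  finally have "K\<^sup>2 * (\<bar>r - q\<bar> * (1 / K)\<^sup>2) \<le>
      K\<^sup>2 * (K * (K * \<eta> * \<bar>r - q\<bar>) + \<epsilon> * (K * (K * (K * \<bar>r - q\<bar>))))"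
    by (intro mult_left_mono) auto
  then have "\<bar>r - q\<bar> \<le> (K ^ 4 * \<eta> + K ^ 5 * \<epsilon>) * \<bar>r - q\<bar>"
    using K(1) by (simp add: power_divide field_simps power_numeral_reduce)
  \<comment> \<open>Each of the two summands is at most 1/4, by the bounds on
    \<open>4 * K ^ 4 * \<eta>\<close> and \<open>4 * K ^ 5 * \<epsilon>\<close>.\<close>
  also have "\<dots> \<le> (1/2) * \<bar>r - q\<bar>"
    using \<epsilon>(4) \<eta>(5) by (intro mult_right_mono) auto
  finally have "r = q" by simp
  then have "(h - k) *\<^sub>R offset D f i r = 0" using eq by (simp add: pushoff_def algebra_simps)
  then show ?thesis using \<open>r = q\<close> velocity_nonzero[OF i] by (simp add: offset_def)
qed

lemma pushoff_distance:
  assumes "i < components D" "j < components D" "\<bar>h\<bar> = \<epsilon>" "\<bar>k\<bar> = \<epsilon>"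
  shows "norm ((pushoff D f h i r - pushoff D f k j q) - (curve D i r - curve D j q)) \<le> 2 * K * \<epsilon>"
proof -
  have "(pushoff D f h i r - pushoff D f k j q) - (curve D i r - curve D j q) =
      h *\<^sub>R offset D f i r - k *\<^sub>R offset D f j q" by (simp add: pushoff_def)
  also have "norm \<dots> \<le> \<epsilon> * K + \<epsilon> * K"
    using assms \<epsilon>(1) estimates(4)
    by (intro order_trans[OF norm_triangle_ineq4 add_mono]) (auto intro!: mult_left_mono)
  finally show ?thesis by simp
qed

lemma fine_coincidence:
  assumes ij: "i < components D" "j < components D" and hk: "\<bar>h\<bar> = \<epsilon>" "\<bar>k\<bar> = \<epsilon>"
    and eq: "pushoff D f h i r = pushoff D f k j q"
  shows "i = j \<and> r - q \<in> \<int> \<and> (h = k \<or> f i r = 0) \<or> nearly_meets \<eta> i r j q"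
proof -
  have "norm (curve D i r - curve D j q) \<le> 2 * K * \<epsilon>"
    using pushoff_distance[OF ij hk, of r q] eq by (simp add: norm_minus_commute)
  then consider m :: int where "i = j" "\<bar>r - q - of_int m\<bar> < \<eta>" | "nearly_meets \<eta> i r j q"
    using far[OF ij] by blast
  then show ?thesis
  proof cases
    case 1
    then have "\<bar>r - (q + of_int m)\<bar> < \<eta>" "pushoff D f h i r = pushoff D f k i (q + of_int m)"
      using eq ij by (auto simp: pushoff_periodic algebra_simps)
    from local_injective[OF ij(1) hk this] have "r = q + of_int m" "h = k \<or> f i r = 0" by auto
    then show ?thesis using \<open>i = j\<close> by simp
  qed simp
qed

lemma fine_near_exists:
  assumes m: "meets D i s j t" and hk: "\<bar>h\<bar> = \<epsilon>" "\<bar>k\<bar> = \<epsilon>"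
  shows "\<exists>r q. \<bar>r - s\<bar> < \<eta> \<and> \<bar>q - t\<bar> < \<eta> \<and> pushoff D f h i r = pushoff D f k j q"
proof -
  have ij: "i < components D" "j < components D" "curve D i s = curve D j t"
    using m by (auto simp: meets_def)
  interpret transverse_pair "velocity D i s" "velocity D j t" \<tau> K \<kappa> by (rule transverse_pair[OF m])
  show ?thesis
    using pushoff_distance[OF ij(1,2) hk, of s t] \<epsilon>(3) ij(3) \<eta>(1)
    by (intro crossing_exists nearly_linear_pushoff ij hk) auto
qed

lemma fine_near_unique:
  assumes m: "meets D i s j t" and hk: "\<bar>h\<bar> = \<epsilon>" "\<bar>k\<bar> = \<epsilon>"
    and "\<bar>r - s\<bar> < \<eta>" "\<bar>q - t\<bar> < \<eta>" "pushoff D f h i r = pushoff D f k j q"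
    and "\<bar>r' - s\<bar> < \<eta>" "\<bar>q' - t\<bar> < \<eta>" "pushoff D f h i r' = pushoff D f k j q'"
  shows "r = r' \<and> q = q'"
proof -
  interpret transverse_pair "velocity D i s" "velocity D j t" \<tau> K \<kappa> by (rule transverse_pair[OF m])
  have ij: "i < components D" "j < components D" using m by (auto simp: meets_def)
  show ?thesis
    using crossing_unique[OF nearly_linear_pushoff[OF ij(1) hk(1)] nearly_linear_pushoff[OF ij(2) hk(2)]
        assms(4,7,5,8,6,9)] by blast
qed

text \<open>A positive determinant means that the \<open>i\<close>-th curve passes from the left to
  the right of the \<open>j\<close>-th one, so it meets the left copy, at \<open>r'\<close>, before
  the right copy, at \<open>r\<close>. The proof is \<open>crossing_order\<close> with these copies
  as the two parallel curves.\<close>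

lemma fine_near_order:
  assumes m: "meets D i s j t" and h: "\<bar>h\<bar> = \<epsilon>"
    and rq: "\<bar>r - s\<bar> < \<eta>" "\<bar>q - t\<bar> < \<eta>" "pushoff D f h i r = pushoff D f (- \<epsilon>) j q"
    and rq': "\<bar>r' - s\<bar> < \<eta>" "\<bar>q' - t\<bar> < \<eta>" "pushoff D f h i r' = pushoff D f \<epsilon> j q'"
  shows "0 < (r - r') * turn (velocity D i s) (velocity D j t)"
proof -
  note small = \<kappa>(3) \<kappa>(4)
  interpret transverse_pair "velocity D i s" "velocity D j t" \<tau> K \<kappa> by (rule transverse_pair[OF m])
  have ij: "i < components D" "j < components D" using m by (auto simp: meets_def)
  have t: "crossing_param D j t" using m meets_sym unfolding crossing_param_def by blast
  have off: "of_real (f j t) * (\<i> * velocity D j t) = offset D f j t"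
    by (simp add: offset_def scaleR_conv_of_real)
  have "pushoff D f (- \<epsilon>) j q' - pushoff D f \<epsilon> j q' + (2 * \<epsilon>) *\<^sub>R offset D f j t =
      (2 * \<epsilon>) *\<^sub>R (offset D f j t - offset D f j q')"
    by (simp add: pushoff_def algebra_simps flip: scaleR_add_left)
  also have "norm \<dots> \<le> 2 * \<epsilon> * (K * \<bar>t - q'\<bar>)"
    using estimates(8)[OF ij(2)] \<epsilon>(1) by (simp add: mult_left_mono)
  also have "\<dots> \<le> 2 * \<epsilon> * (K * \<eta>)" using rq'(2) K(1) \<epsilon>(1) by (intro mult_left_mono) auto
  also have "K * \<eta> \<le> \<kappa>" using \<eta>(1,2) K(1) mult_pos_pos[of K \<eta>] by linarith
  then have "2 * \<epsilon> * (K * \<eta>) \<le> 2 * \<epsilon> * \<kappa>" using \<epsilon>(1) by (intro mult_left_mono) auto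
  finally have "norm (pushoff D f (- \<epsilon>) j q' - pushoff D f \<epsilon> j q' + (2 * \<epsilon>) *\<^sub>R
      (of_real (f j t) * (\<i> * velocity D j t))) \<le> 2 * \<epsilon> * \<kappa>" unfolding off .
  note offset_change = this
  have offset_bound: "norm (of_real (f j t) * (\<i> * velocity D j t)) \<le> K"
    unfolding off by (rule estimates[OF ij(2)])
  have abs_\<epsilon>: "\<bar>- \<epsilon>\<bar> = \<epsilon>" and K_pos: "0 < 1 / K" using \<epsilon>(1) K(1) by auto
  show ?thesis
    by (rule crossing_order[where g = "pushoff D f h i" and h = "pushoff D f (- \<epsilon>) j"
        and h' = "pushoff D f \<epsilon> j" and q' = q' and r' = r' and \<phi> = "f j t", OF nearly_linear_pushoff[OF ij(1) h] nearly_linear_pushoff[OF ij(2) abs_\<epsilon>]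
        rq(1) rq'(1) rq(2) rq'(2) rq(3) rq'(3) \<epsilon>(1) offset_change offset_bound small(1) K_pos
        estimates(2)[OF ij(2)] \<phi>(1) \<phi>(2)[OF t] small(2)])
qed

text \<open>Expanding the determinant around the velocities at the crossing leaves three error
  terms, each at most \<open>\<kappa> * K\<close> and hence \<open>\<tau> / 4\<close>; together they
  stay below \<open>\<tau>\<close> and cannot change the sign.\<close>

lemma fine_near_turn:
  assumes m: "meets D i s j t" and hk: "\<bar>h\<bar> = \<epsilon>" "\<bar>k\<bar> = \<epsilon>"
    and rq: "\<bar>r - s\<bar> < \<eta>" "\<bar>q - t\<bar> < \<eta>"
  shows "0 < turn (pushoff_velocity D f h i r) (pushoff_velocity D f k j q) *
    turn (velocity D i s) (velocity D j t)"
proof -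
  have ij: "i < components D" "j < components D" using m by (auto simp: meets_def)
  define v w where "v = velocity D i s" and "w = velocity D j t"
  define a b where "a = pushoff_velocity D f h i r - v" and "b = pushoff_velocity D f k j q - w"
  have a: "norm a \<le> \<kappa>" and b: "norm b \<le> \<kappa>"
    unfolding a_def b_def v_def w_def using velocity_close ij hk rq by auto
  have v: "norm v \<le> K" and w: "norm w \<le> K" unfolding v_def w_def using estimates(1) ij by auto
  have eq: "turn (pushoff_velocity D f h i r) (pushoff_velocity D f k j q) =
      turn v w + (turn a w + turn v b + turn a b)"
    by (simp add: a_def b_def turn_simps)
  have turn_le: "\<bar>turn x y\<bar> \<le> \<kappa> * K" if "norm x * norm y \<le> \<kappa> * K" for x y
    using abs_turn_le[of x y] that by linarith
  have "\<bar>turn a w\<bar> \<le> \<kappa> * K" using a w \<kappa>(1) by (intro turn_le mult_mono) auto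
  moreover have "\<bar>turn v b\<bar> \<le> \<kappa> * K"
    using b v K(1) by (intro turn_le, subst mult.commute) (intro mult_mono, auto)
  moreover have "\<bar>turn a b\<bar> \<le> \<kappa> * K"
    using a order_trans[OF b \<kappa>(3)] \<kappa>(1) by (intro turn_le mult_mono) auto
  moreover have "\<kappa> * K \<le> \<tau> / 4" using \<kappa>(2) K(1) by (simp add: field_simps)
  moreover have "\<tau> \<le> \<bar>turn v w\<bar>" using \<tau>(2)[OF m] by (simp add: v_def w_def)
  ultimately have "\<bar>turn a w + turn v b + turn a b\<bar> < \<bar>turn v w\<bar>" using \<tau>(1) by linarith
  then show ?thesis unfolding eq v_def[symmetric] w_def[symmetric]
    by (cases "turn v w > 0") (auto simp: zero_less_mult_iff)
qed

lemma fine: "fine_pushoffs D \<delta> f \<epsilon> \<eta>"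
  using \<epsilon>(1) \<eta>(1,3) fine_immersed fine_coincidence f_positive_near fine_near_exists fine_near_unique
    fine_near_turn fine_near_order by unfold_locales blast+

end

lemma (in twisted_diagram) eventually_fine: "\<forall>\<^sub>F \<epsilon> in at_right 0. \<exists>\<eta>. fine_pushoffs D \<delta> f \<epsilon> \<eta>"
proof -
  obtain K0 where K0: "\<And>i. i < components D \<Longrightarrow> bounded_by K0 i" using ex_bounded_by by blast
  define K where "K = max 1 K0"
  have K: "1 \<le> K" "\<And>i. i < components D \<Longrightarrow> bounded_by K i"
    using bounded_by_mono[OF K0] by (auto simp: K_def)
  obtain \<tau> where \<tau>: "0 < \<tau>" "\<And>i s j t. meets D i s j t \<Longrightarrow> \<tau> \<le> \<bar>turn (velocity D i s) (velocity D j t)\<bar>"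
    using ex_turn_bound by blast
  obtain \<phi> where \<phi>: "0 < \<phi>" "\<And>i s. crossing_param D i s \<Longrightarrow> \<phi> \<le> f i s" using ex_f_bound by blast
  define X where "X = 16 * K\<^sup>2 / \<tau> + 2"
  have X: "0 < X" using \<tau> by (simp add: X_def add_nonneg_pos)
  \<comment> \<open>The last bound gives \<open>K * \<kappa> * X \<le> \<phi> / K\<^sup>2\<close>,
    half of the required upper bound, which yields the strict inequality.\<close>
  define \<kappa> where "\<kappa> = min (min (\<tau> / (4 * K)) K) (\<phi> / (K ^ 3 * X))"
  have \<kappa>: "0 < \<kappa>" "\<kappa> \<le> \<tau> / (4 * K)" "\<kappa> \<le> K" using K \<tau> \<phi> X by (auto simp: \<kappa>_def)
  have "\<kappa> \<le> \<phi> / (K ^ 3 * X)" by (simp add: \<kappa>_def)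
  then have "K * \<kappa> * X \<le> K * (\<phi> / (K ^ 3 * X)) * X" using K X by (intro mult_right_mono mult_left_mono) auto
  also have "\<dots> = \<phi> * (1 / K)\<^sup>2" using K(1) X by (simp add: field_simps power2_eq_square power3_eq_cube)
  also have "\<dots> < 2 * \<phi> * (1 / K)\<^sup>2" using K(1) \<phi>(1) by simp
  finally have \<kappa>4: "K * \<kappa> * (16 * K\<^sup>2 / \<tau> + 2) < 2 * \<phi> * (1 / K)\<^sup>2" by (simp only: X_def)
  define \<eta> where "\<eta> = min (min (\<kappa> / (2 * K)) (\<delta> / 2)) (min (\<phi> / (2 * K)) (1 / (4 * K ^ 4)))"
  have \<eta>0: "0 < \<eta>" using K \<kappa> \<phi> \<delta>_pos by (auto simp: \<eta>_def)
  have "\<eta> \<le> \<kappa> / (2 * K)" "\<eta> \<le> \<delta> / 2" "\<eta> \<le> \<phi> / (2 * K)" "\<eta> \<le> 1 / (4 * K ^ 4)"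
    by (auto simp: \<eta>_def)
  then have \<eta>: "2 * K * \<eta> \<le> \<kappa>" "2 * \<eta> \<le> \<delta>" "2 * K * \<eta> \<le> \<phi>" "4 * K ^ 4 * \<eta> \<le> 1"
    using K(1) by (simp_all add: field_simps)
  have tend: "((\<lambda>\<epsilon>. c * \<epsilon>) \<longlongrightarrow> 0) (at_right 0)" for c :: real
    by (rule tendsto_eq_rhs[OF tendsto_mult[OF tendsto_const tendsto_ident_at]]) simp
  have small: "\<forall>\<^sub>F \<epsilon> in at_right 0. c * \<epsilon> < b" if "0 < b" for b c :: real
    using order_tendstoD(2)[OF tend that] .
  \<comment> \<open>The admissible distance from \<open>curves_far_apart\<close> depends on
    \<open>\<eta>\<close>, so \<open>\<eta>\<close> had to be fixed before \<open>\<epsilon>\<close>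
    is made small.\<close>
  have far: "\<forall>\<^sub>F \<epsilon> in at_right 0. \<forall>p \<in> {..<components D} \<times> {..<components D}. \<forall>r q.
      norm (curve D (fst p) r - curve D (snd p) q) \<le> 2 * K * \<epsilon> \<longrightarrow>
      fst p = snd p \<and> (\<exists>m::int. \<bar>r - q - of_int m\<bar> < \<eta>) \<or> nearly_meets \<eta> (fst p) r (snd p) q"
  proof (intro eventually_ball_finite finite_cartesian_product ballI finite_lessThan)
    fix p assume p: "p \<in> {..<components D} \<times> {..<components D}"
    obtain \<kappa> where "0 < \<kappa>" and *: "\<And>r q. norm (curve D (fst p) r - curve D (snd p) q) < \<kappa> \<Longrightarrow>
        fst p = snd p \<and> (\<exists>m::int. \<bar>r - q - of_int m\<bar> < \<eta>) \<or> nearly_meets \<eta> (fst p) r (snd p) q"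
      using curves_far_apart[of "fst p" "snd p" \<eta>] p \<eta>0 by (auto simp: mem_Times_iff)
    show "\<forall>\<^sub>F \<epsilon> in at_right 0. \<forall>r q.
      norm (curve D (fst p) r - curve D (snd p) q) \<le> 2 * K * \<epsilon> \<longrightarrow>
      fst p = snd p \<and> (\<exists>m::int. \<bar>r - q - of_int m\<bar> < \<eta>) \<or> nearly_meets \<eta> (fst p) r (snd p) q"
      using small[OF \<open>0 < \<kappa>\<close>, of "2 * K"]
    proof eventually_elim
      case (elim \<epsilon>)
      then show ?case using * by (meson le_less_trans)
    qed
  qed
  have "0 < \<eta> * \<tau> / (4 * K)" using \<eta>0 \<tau> K by simp
  from far small[OF \<kappa>(1), of "2 * K"] small[OF this, of "2 * K"] small[OF zero_less_one, of "4 * K ^ 5"]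
    eventually_at_right_less[of 0]
  show ?thesis
  proof eventually_elim
    case (elim \<epsilon>)
    have "pushoff_estimates D \<delta> f K \<tau> \<phi> \<kappa> \<eta> \<epsilon>"
    proof unfold_locales
      show "K * \<eta> < \<phi>" using \<eta>(3) \<phi>(1) by linarith
    qed (use elim K \<tau> \<phi> \<kappa> \<kappa>4 \<eta>0 \<eta> in auto)
    then show ?case using pushoff_estimates.fine by blast
  qed
qed


section \<open>Twists\<close>

text \<open>A positive derivative would force negative values just before the zero.\<close>

lemma deriv_at_first_zero:
  fixes g :: "real \<Rightarrow> real"
  assumes "(g has_real_derivative l) (at z)" "l \<noteq> 0" "a < z" "g z = 0" "\<And>x. a < x \<Longrightarrow> x < z \<Longrightarrow> 0 < g x"
  shows "l < 0"
proof (rule ccontr)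
  assume "\<not> l < 0"
  then obtain d where d: "d > 0" "\<And>h. 0 < h \<Longrightarrow> h < d \<Longrightarrow> g (z - h) < g z"
    using DERIV_pos_inc_left[OF assms(1)] assms(2) by auto
  obtain h where "0 < h" "h < min d (z - a)" using dense[of 0 "min d (z - a)"] d(1) assms(3) by auto
  then show False using d(2)[of h] assms(4) assms(5)[of "z - h"] by simp
qed

lemma deriv_at_last_zero:
  fixes g :: "real \<Rightarrow> real"
  assumes "(g has_real_derivative l) (at z)" "l \<noteq> 0" "z < b" "g z = 0" "\<And>x. z < x \<Longrightarrow> x < b \<Longrightarrow> 0 < g x"
  shows "0 < l"
proof (rule ccontr)
  assume "\<not> 0 < l"
  then obtain d where d: "d > 0" "\<And>h. 0 < h \<Longrightarrow> h < d \<Longrightarrow> g z > g (z + h)"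
    using DERIV_neg_dec_right[OF assms(1)] assms(2) by auto
  obtain h where "0 < h" "h < min d (b - z)" using dense[of 0 "min d (b - z)"] d(1) assms(3) by auto
  then show False using d(2)[of h] assms(4) assms(5)[of "z + h"] by simp
qed

context twisted_diagram
begin

lemma f_has_derivative: "i < components D \<Longrightarrow> (f i has_real_derivative deriv (f i) r) (at r)"
  using smooth_has_vector_derivative[OF smooth_f, of i r]
  unfolding has_real_derivative_iff_has_vector_derivative[symmetric]
  by (metis DERIV_imp_deriv)

lemma continuous_f: "i < components D \<Longrightarrow> continuous_on S (f i)"
  by (rule smooth_continuous_on[OF smooth_f])

lemma twist_zeros_iff:
  assumes "positive_under D i t \<or> negative_under D i t"
  shows "r \<in> twist_zeros D \<delta> f i t \<longleftrightarrow>
    f i r = 0 \<and> (positive_under D i t \<and> t < r \<and> r < t + \<delta> \<or> negative_under D i t \<and> t - \<delta> < r \<and> r < t)"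
  using assms under_exclusive[of i t] unfolding twist_zeros_def by auto

lemma finite_twist_zeros:
  assumes "positive_under D i t \<or> negative_under D i t"
  shows "finite (twist_zeros D \<delta> f i t)" "twist_zeros D \<delta> f i t \<noteq> {}"
  using card_twist_zeros[OF crossing_param_component[OF under_crossing_param[OF assms]] assms]
  by (auto intro: card_ge_0_finite)

lemma twist_zeros_shift:
  assumes "positive_under D i t \<or> negative_under D i t"
  shows "twist_zeros D \<delta> f i (t + of_int m) = (\<lambda>r. r + of_int m) ` twist_zeros D \<delta> f i t"
proof -
  have i: "i < components D" using crossing_param_component[OF under_crossing_param[OF assms]] .
  have f: "f i (r + of_int m) = f i r" "f i (r - of_int m) = f i r" for r
    using f_periodic[OF i, of r m] f_periodic[OF i, of "r - of_int m" m] by simp_all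
  have "r \<in> twist_zeros D \<delta> f i (t + of_int m) \<longleftrightarrow> r - of_int m \<in> twist_zeros D \<delta> f i t" for r
    unfolding twist_zeros_def mem_Collect_eq f positive_under_shift
    by (rule conj_cong refl)+ auto
  then show ?thesis by (force simp: image_iff)
qed

text \<open>The parameters of the classical crossings of the twists, in the parametrisation of the right copy.\<close>

definition twist_cut :: "nat \<Rightarrow> real \<Rightarrow> bool" where
  "twist_cut i r \<longleftrightarrow> (\<exists>t. positive_under D i t \<and> r = Min (twist_zeros D \<delta> f i t)) \<or>
     (\<exists>t. negative_under D i t \<and> r = Max (twist_zeros D \<delta> f i t))"

lemma twist_cut_component: "twist_cut i r \<Longrightarrow> i < components D"
  unfolding twist_cut_def using under_crossing_param crossing_param_component by blast

text \<open>\<open>f\<close> is positive at the crossing parameter \<open>t\<close>, and by the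
  intermediate value theorem it stays positive up to its first zero after \<open>t\<close>. That
  zero is simple, so it is passed downwards.\<close>

lemma positive_twist_cut:
  assumes "positive_under D i t" "z = Min (twist_zeros D \<delta> f i t)"
  shows "f i z = 0" "t < z" "z < t + \<delta>" "deriv (f i) z < 0"
proof -
  note fin = finite_twist_zeros[OF disjI1[OF assms(1)]]
  have i: "i < components D" using crossing_param_component[OF under_crossing_param] assms(1) by blast
  have z: "z \<in> twist_zeros D \<delta> f i t" using fin assms(2) by simp
  then show *: "f i z = 0" "t < z" "z < t + \<delta>"
    using assms(1) under_exclusive[of i t] by (auto simp: twist_zeros_iff)
  have "0 < f i x" if x: "t < x" "x < z" for x
  proof (rule ccontr)
    assume "\<not> 0 < f i x"
    then obtain y where "t \<le> y" "y \<le> x" "f i y = 0"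
      using IVT2'[of "f i" x 0 t] f_crossing_pos[OF under_crossing_param[OF disjI1[OF assms(1)]]]
        continuous_f[OF i] x(1) by auto
    moreover have "y \<noteq> t"
      using \<open>f i y = 0\<close> f_crossing_pos[OF under_crossing_param[OF disjI1[OF assms(1)]]] by auto
    ultimately have "y \<in> twist_zeros D \<delta> f i t"
      using assms(1) x(2) *(3) by (auto simp: twist_zeros_iff)
    then have "z \<le> y" using fin assms(2) by simp
    then show False using \<open>y \<le> x\<close> x(2) by simp
  qed
  then show "deriv (f i) z < 0"
    using *(1,2) by (intro deriv_at_first_zero[OF f_has_derivative[OF i] f_simple_zero[OF i]]) auto
qed

lemma negative_twist_cut:
  assumes "negative_under D i t" "z = Max (twist_zeros D \<delta> f i t)"
  shows "f i z = 0" "t - \<delta> < z" "z < t" "0 < deriv (f i) z"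
proof -
  note fin = finite_twist_zeros[OF disjI2[OF assms(1)]]
  have i: "i < components D" using crossing_param_component[OF under_crossing_param] assms(1) by blast
  have z: "z \<in> twist_zeros D \<delta> f i t" using fin assms(2) by simp
  then show *: "f i z = 0" "t - \<delta> < z" "z < t"
    using assms(1) under_exclusive[of i t] by (auto simp: twist_zeros_iff)
  have "0 < f i x" if x: "z < x" "x < t" for x
  proof (rule ccontr)
    assume "\<not> 0 < f i x"
    then obtain y where "x \<le> y" "y \<le> t" "f i y = 0"
      using IVT'[of "f i" x 0 t] f_crossing_pos[OF under_crossing_param[OF disjI2[OF assms(1)]]]
        continuous_f[OF i] x(2) by auto
    moreover have "y \<noteq> t"
      using \<open>f i y = 0\<close> f_crossing_pos[OF under_crossing_param[OF disjI2[OF assms(1)]]] by auto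
    ultimately have "y \<in> twist_zeros D \<delta> f i t"
      using assms(1) x(1) *(2) by (auto simp: twist_zeros_iff)
    then have "y \<le> z" using fin assms(2) by simp
    then show False using \<open>x \<le> y\<close> x(1) by simp
  qed
  then show "0 < deriv (f i) z"
    using *(1,3) by (intro deriv_at_last_zero[OF f_has_derivative[OF i] f_simple_zero[OF i]]) auto
qed

lemma twist_cut_zero: "twist_cut i r \<Longrightarrow> f i r = 0"
  unfolding twist_cut_def using positive_twist_cut(1) negative_twist_cut(1) by blast

lemma twist_cut_window:
  assumes "twist_cut i r"
  obtains t where "positive_under D i t \<or> negative_under D i t" "\<bar>r - t\<bar> < \<delta>"
    "r = (if positive_under D i t then Min else Max) (twist_zeros D \<delta> f i t)"
  using assms unfolding twist_cut_def
proof (elim disjE exE conjE)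
  fix t assume "positive_under D i t" "r = Min (twist_zeros D \<delta> f i t)"
  with positive_twist_cut[OF this] show ?thesis by (intro that[of t]) auto
next
  fix t assume "negative_under D i t" "r = Max (twist_zeros D \<delta> f i t)"
  with negative_twist_cut[OF this] under_exclusive[of i t] show ?thesis by (intro that[of t]) auto
qed

lemma twist_cut_shift: "twist_cut i (r + of_int m) \<longleftrightarrow> twist_cut i r"
proof -
  have *: "twist_cut i (r + of_int m)" if "twist_cut i r" for r m
  proof -
    have mono: "mono (\<lambda>r::real. r + of_int m)" by (simp add: mono_def)
    obtain t where t: "positive_under D i t \<or> negative_under D i t"
      "r = (if positive_under D i t then Min else Max) (twist_zeros D \<delta> f i t)"
      using \<open>twist_cut i r\<close> by (rule twist_cut_window)
    have "r + of_int m = (if positive_under D i t then Min else Max) (twist_zeros D \<delta> f i (t + of_int m))"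
      unfolding twist_zeros_shift[OF t(1)] t(2)
      using mono_Min_commute[OF mono finite_twist_zeros[OF t(1)]]
        mono_Max_commute[OF mono finite_twist_zeros[OF t(1)]] by simp
    then show ?thesis
      using t(1) unfolding twist_cut_def
      by (metis positive_under_shift negative_under_shift)
  qed
  show ?thesis using *[of r m] *[of "r + of_int m" "- m"] by auto
qed

text \<open>Where \<open>f\<close> vanishes, the derivative of the offset is just
  \<open>deriv (f i) r\<close> times the normal, so the two velocities are the velocity of
  \<open>D\<close> minus and plus the same normal vector.\<close>

lemma twist_turn:
  assumes i: "i < components D" and "f i r = 0"
  shows "turn (pushoff_velocity D f (- h) i r) (pushoff_velocity D f h i r) =
    2 * h * deriv (f i) r * (norm (velocity D i r))\<^sup>2"
proof -
  have "((\<lambda>t. \<i> * velocity D i t) has_vector_derivative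
      \<i> * vector_derivative (velocity D i) (at r)) (at r)"
    using smooth_has_vector_derivative[OF smooth_velocity[OF i]]
    by (intro has_vector_derivative_mult_right)
  then have "(offset D f i has_vector_derivative f i r *\<^sub>R (\<i> * vector_derivative (velocity D i) (at r)) +
      deriv (f i) r *\<^sub>R (\<i> * velocity D i r)) (at r)"
    unfolding offset_def[abs_def] by (intro has_vector_derivative_scaleR f_has_derivative[OF i])
  then have "vector_derivative (offset D f i) (at r) = deriv (f i) r *\<^sub>R (\<i> * velocity D i r)"
    using assms(2) by (simp add: vector_derivative_at)
  then show ?thesis
    unfolding cmod_power2 by (simp add: pushoff_velocity_def turn_def power2_eq_square algebra_simps)
qed

lemma pushoff_velocity_periodic:
  assumes "i < components D"
  shows "pushoff_velocity D f h i (r + of_int m) = pushoff_velocity D f h i r"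
proof (rule periodic_of_int)
  have "pushoff D f h i (t + 1) = pushoff D f h i t" for t
    using pushoff_periodic[OF assms, of h t 1] by simp
  then show "pushoff_velocity D f h i (t + 1) = pushoff_velocity D f h i t" for t
    using vector_derivative_periodic[OF pushoff_has_derivative[OF assms]] by blast
qed

end

section \<open>Over passages of the right copy\<close>

context fine_pushoffs
begin

lemma param_left: "meets D i s j t \<Longrightarrow> crossing_param D i s"
  and param_right: "meets D i s j t \<Longrightarrow> crossing_param D j t"
  using meets_sym unfolding crossing_param_def by blast+

lemma near_param_unique:
  "crossing_param D i s \<Longrightarrow> crossing_param D i s' \<Longrightarrow> \<bar>r - s\<bar> < \<delta> \<Longrightarrow> \<bar>r - s'\<bar> < \<delta> \<Longrightarrow> s = s'"
  using separated[of i s s'] by linarith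

lemma near_window: "\<bar>r - s\<bar> < \<eta> \<Longrightarrow> \<bar>r - s\<bar> < \<delta>"
  using \<eta>_le \<eta>_pos by linarith

lemma zero_not_near: "f i r = 0 \<Longrightarrow> \<not> nearly_meets \<eta> i r j q"
  unfolding nearly_meets_def using f_near_pos param_left by (metis less_irrefl)

text \<open>The two passages of a self-crossing have disjoint \<open>\<delta>\<close>-windows modulo
  the integers. This excludes the trivial alternative of \<open>coincidence\<close> near a
  crossing.\<close>

lemma meets_not_close:
  assumes "meets D i s i t" "\<bar>r - s\<bar> < \<delta>" "\<bar>q - t\<bar> < \<delta>"
  shows "r - q \<notin> \<int>"
proof
  assume "r - q \<in> \<int>"
  then obtain m where m: "r = q + of_int m" by (metis Ints_cases diff_eq_eq add.commute)
  have "s = t + of_int m"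
    using param_left[OF assms(1)] param_right[OF assms(1)] crossing_param_shift assms(2,3) m
    by (intro near_param_unique[where r = r and i = i]) auto
  then show False using assms(1) by (simp add: meets_def)
qed

definition right_over :: "nat \<Rightarrow> real \<Rightarrow> bool" where
  "right_over i r \<longleftrightarrow> right_copy_over D \<delta> f \<epsilon> i r"

text \<open>\<open>right_copy_over\<close> looks for crossings in windows of radius
  \<open>\<delta>\<close>; \<open>coincidence\<close> shows that they actually lie within
  \<open>\<eta>\<close>, where they are unique for each pair of copies.\<close>

lemma right_over_cases:
  assumes "right_over i r"
  obtains s j t q h where "classical_crossing D i s j t" "\<bar>r - s\<bar> < \<eta>" "\<bar>q - t\<bar> < \<eta>"
      "\<bar>h\<bar> = \<epsilon>" "pushoff D f (- \<epsilon>) i r = pushoff D f h j q"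
  | "twist_cut i r"
proof -
  consider s j t q where "classical_crossing D i s j t" "\<bar>r - s\<bar> < \<delta>" "\<bar>q - t\<bar> < \<delta>"
      "pushoff D f (- \<epsilon>) i r \<in> {pushoff D f (- \<epsilon>) j q, pushoff D f \<epsilon> j q}" | "twist_cut i r"
    using assms unfolding right_over_def right_copy_over_def twist_cut_def right_copy_eq left_copy_eq
    by blast
  then show ?thesis
  proof cases
    case 1
    then obtain h where h: "\<bar>h\<bar> = \<epsilon>" "pushoff D f (- \<epsilon>) i r = pushoff D f h j q"
      using \<epsilon>_pos by (metis abs_minus_cancel abs_of_pos insert_iff singletonD)
    have m: "meets D i s j t" "over D i s" using 1(1) by (auto simp: classical_crossing_def)
    have ij: "i < components D" "j < components D" using m(1) by (auto simp: meets_def)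
    have "\<bar>- \<epsilon>\<bar> = \<epsilon>" using \<epsilon>_pos by simp
    from coincidence[OF ij this h] have "nearly_meets \<eta> i r j q"
      using meets_not_close[of i s t r q] m(1) 1(2,3) by blast
    then obtain s' t' where st: "meets D i s' j t'" "\<bar>r - s'\<bar> < \<eta>" "\<bar>q - t'\<bar> < \<eta>"
      unfolding nearly_meets_def by blast
    have "s' = s" by (rule near_param_unique[OF param_left[OF st(1)] param_left[OF m(1)] near_window[OF st(2)] 1(2)])
    then have "classical_crossing D i s j t'" using over_classical st(1) m(2) by blast
    then show ?thesis using that(1) st(2,3) h \<open>s' = s\<close> by blast
  qed (rule that(2))
qed

lemma right_over_near:
  assumes m: "meets D i s j t" and r: "\<bar>r - s\<bar> < \<eta>" "\<bar>q - t\<bar> < \<eta>"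
    and h: "\<bar>h\<bar> = \<epsilon>" "pushoff D f (- \<epsilon>) i r = pushoff D f h j q"
  shows "right_over i r \<longleftrightarrow> over D i s"
proof
  assume "right_over i r"
  then show "over D i s"
  proof (cases rule: right_over_cases)
    case (1 s' j' t')
    then have m': "meets D i s' j' t'" "over D i s'" by (auto simp: classical_crossing_def)
    have "s' = s"
      by (rule near_param_unique[OF param_left[OF m'(1)] param_left[OF m] near_window near_window])
        (use 1 r in auto)
    then show ?thesis using m'(2) by simp
  next
    case 2
    then show ?thesis using twist_cut_zero f_near_pos[OF param_left[OF m] r(1)] by auto
  qed
next
  assume "over D i s"
  then have "classical_crossing D i s j t" using over_classical m by blast
  moreover have "pushoff D f h j q \<in> {pushoff D f (- \<epsilon>) j q, pushoff D f \<epsilon> j q}"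
    using h(1) by (auto simp: abs_if split: if_splits)
  ultimately show "right_over i r"
    unfolding right_over_def right_copy_over_def right_copy_eq left_copy_eq
    using near_window[OF r(1)] near_window[OF r(2)] h(2) by metis
qed

lemma right_over_zero:
  assumes "f i r = 0"
  shows "right_over i r \<longleftrightarrow> twist_cut i r"
proof
  assume "right_over i r"
  then show "twist_cut i r"
  proof (cases rule: right_over_cases)
    case (1 s j t)
    then have "crossing_param D i s" using param_left by (auto simp: classical_crossing_def)
    then show ?thesis using f_near_pos 1(2) assms by fastforce
  qed
next
  show "twist_cut i r \<Longrightarrow> right_over i r"
    unfolding right_over_def right_copy_over_def twist_cut_def by blast
qed

lemma right_over_shift: "right_over i (r + of_int m) \<longleftrightarrow> right_over i r"
proof -
  have *: "right_over i (r + of_int m)" if "right_over i r" for r m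
    using that
  proof (cases rule: right_over_cases)
    case (1 s j t q h)
    have i: "i < components D" "meets D i s j t" "over D i s"
      using 1(1) by (auto simp: classical_crossing_def meets_def)
    have "meets D i (s + of_int m) j t" using meets_shift[of i s m j t 0] i(2) by simp
    then have "right_over i (r + of_int m) \<longleftrightarrow> over D i (s + of_int m)"
      using 1(2-5) i(1) by (intro right_over_near[of _ _ j t _ q h]) (auto simp: pushoff_periodic)
    then show ?thesis using i over_periodic by simp
  next
    case 2
    then show ?thesis using right_over_zero twist_cut_zero twist_cut_shift by metis
  qed
  show ?thesis using *[of r m] *[of "r + of_int m" "- m"] by auto
qed

end


section \<open>The parallel diagram is a virtual link diagram\<close>

context fine_pushoffs
begin

abbreviation parallel :: virtual_diagram where
  "parallel \<equiv> phi_minus D \<delta> f \<epsilon>"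

definition side :: "nat \<Rightarrow> real" where
  "side k = (if even k then - \<epsilon> else \<epsilon>)"

text \<open>Converts parameters of component \<open>k\<close> into parameters of \<open>D\<close>
  and, being its own inverse, back again; left copies run backwards.\<close>

definition dir :: "nat \<Rightarrow> real" where
  "dir k = (if even k then 1 else - 1)"

lemma abs_side [simp]: "\<bar>side k\<bar> = \<epsilon>"
  using \<epsilon>_pos by (simp add: side_def)

lemma dir_dir [simp]: "dir k * (dir k * r) = r"
  by (simp add: dir_def)

lemma dir_Ints: "dir k * r - dir k * q \<in> \<int> \<longleftrightarrow> r - q \<in> \<int>"
  using Ints_minus[of "r - q"] Ints_minus[of "q - r"] by (auto simp: dir_def)

lemma dir_add_int: "\<exists>l. dir k * (r + of_int m) = dir k * r + of_int l"
  by (cases "even k") (auto simp: dir_def algebra_simps intro: exI[of _ m] exI[of _ "- m"])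

lemma components_parallel: "components parallel = 2 * components D"
  by (simp add: phi_minus_def)

lemma component_half: "k < components parallel \<Longrightarrow> k div 2 < components D"
  by (auto simp: components_parallel)

lemma curve_parallel: "curve parallel k r = pushoff D f (side k) (k div 2) (dir k * r)"
  by (simp add: phi_minus_def side_def dir_def right_copy_eq left_copy_eq)

lemma over_parallel: "over parallel k r \<longleftrightarrow> even k \<and> right_over (k div 2) r"
  by (simp add: phi_minus_def right_over_def)

lemma curve_parallel_has_derivative:
  assumes "k < components parallel"
  shows "(curve parallel k has_vector_derivative
    dir k *\<^sub>R pushoff_velocity D f (side k) (k div 2) (dir k * r)) (at r)"
proof -
  have "((\<lambda>r. dir k * r) has_vector_derivative dir k) (at r)"
    unfolding has_real_derivative_iff_has_vector_derivative[symmetric]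
    by (rule derivative_eq_intros refl)+ simp
  from vector_diff_chain_at[OF this pushoff_has_derivative[OF component_half[OF assms]]]
  show ?thesis by (simp add: o_def curve_parallel[abs_def])
qed

lemma velocity_parallel:
  "k < components parallel \<Longrightarrow>
    velocity parallel k r = dir k *\<^sub>R pushoff_velocity D f (side k) (k div 2) (dir k * r)"
  unfolding velocity_def by (rule vector_derivative_at[OF curve_parallel_has_derivative])

lemma smooth_parallel:
  assumes "k < components parallel"
  shows "smooth (curve parallel k)"
proof -
  note sm = smooth_pushoff[OF component_half[OF assms], of "side k"]
  show ?thesis
    using sm smooth_reverse[OF sm]
    by (cases "even k") (simp_all add: curve_parallel[abs_def] dir_def)
qed

lemma meets_parallel_iff:
  "meets parallel k r l q \<longleftrightarrow> k < components parallel \<and> l < components parallel \<and>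
     \<not> (k = l \<and> r - q \<in> \<int>) \<and>
     pushoff D f (side k) (k div 2) (dir k * r) = pushoff D f (side l) (l div 2) (dir l * q)"
  by (simp add: meets_def curve_parallel)

lemma meets_parallel_cases:
  assumes "meets parallel k r l q"
  obtains (twist) "k div 2 = l div 2" "k \<noteq> l" "dir k * r - dir l * q \<in> \<int>" "f (k div 2) (dir k * r) = 0"
  | (near) s t where "meets D (k div 2) s (l div 2) t" "\<bar>dir k * r - s\<bar> < \<eta>" "\<bar>dir l * q - t\<bar> < \<eta>"
proof -
  have kl: "k < components parallel" "l < components parallel" "\<not> (k = l \<and> r - q \<in> \<int>)"
    "pushoff D f (side k) (k div 2) (dir k * r) = pushoff D f (side l) (l div 2) (dir l * q)"
    using assms by (auto simp: meets_parallel_iff)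
  from coincidence[OF component_half[OF kl(1)] component_half[OF kl(2)] abs_side abs_side kl(4)]
  show ?thesis
  proof
    assume *: "k div 2 = l div 2 \<and> dir k * r - dir l * q \<in> \<int> \<and> (side k = side l \<or> f (k div 2) (dir k * r) = 0)"
    have "k \<noteq> l" using * kl(3) dir_Ints by blast
    have "side k \<noteq> side l"
    proof
      assume "side k = side l"
      then have "even k \<longleftrightarrow> even l" using \<epsilon>_pos by (auto simp: side_def split: if_splits)
      with * have "k = l" by (metis even_two_times_div_two odd_two_times_div_two_succ)
      then show False using \<open>k \<noteq> l\<close> by simp
    qed
    then show ?thesis using * \<open>k \<noteq> l\<close> twist by blast
  next
    assume "nearly_meets \<eta> (k div 2) (dir k * r) (l div 2) (dir l * q)"
    then show ?thesis unfolding nearly_meets_def using near by blast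
  qed
qed

lemma over_parallel_near:
  assumes "meets D (k div 2) s (l div 2) t" "\<bar>dir k * r - s\<bar> < \<eta>" "\<bar>dir l * q - t\<bar> < \<eta>"
    "meets parallel k r l q"
  shows "over parallel k r \<longleftrightarrow> even k \<and> over D (k div 2) s"
  unfolding over_parallel
proof (rule conj_cong[OF refl])
  assume "even k"
  then show "right_over (k div 2) r \<longleftrightarrow> over D (k div 2) s"
    using assms by (intro right_over_near[of _ _ _ _ _ "dir l * q" "side l"])
      (use \<epsilon>_pos in \<open>auto simp: meets_parallel_iff side_def dir_def\<close>)
qed

lemma over_parallel_twist:
  "f (k div 2) (dir k * r) = 0 \<Longrightarrow> over parallel k r \<longleftrightarrow> even k \<and> twist_cut (k div 2) r"
  unfolding over_parallel by (rule conj_cong[OF refl]) (simp add: right_over_zero dir_def)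

lemma f_periodic_Ints:
  assumes "i < components D" "r - q \<in> \<int>"
  shows "f i r = f i q"
proof -
  obtain m where "r = q + of_int m" using assms(2) by (metis Ints_cases diff_eq_eq add.commute)
  then show ?thesis using f_periodic[OF assms(1)] by simp
qed

lemma transverse_parallel:
  assumes m: "meets parallel k r l q"
  shows "turn (velocity parallel k r) (velocity parallel l q) \<noteq> 0"
proof -
  have kl: "k < components parallel" "l < components parallel" using m by (auto simp: meets_def)
  have "turn (pushoff_velocity D f (side k) (k div 2) (dir k * r))
      (pushoff_velocity D f (side l) (l div 2) (dir l * q)) \<noteq> 0"
    using m
  proof (cases rule: meets_parallel_cases)
    case twist
    have i: "k div 2 < components D" using component_half kl by simp
    obtain m where m: "dir l * q = dir k * r + of_int m"
      using twist(3) by (metis Ints_cases Ints_minus minus_diff_eq diff_eq_eq add.commute)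
    have "side l = - side k"
    proof (cases "even k \<longleftrightarrow> even l")
      case True
      then have "k = l" using twist(1) by (metis even_two_times_div_two odd_two_times_div_two_succ)
      then show ?thesis using twist(2) by simp
    qed (auto simp: side_def)
    then have "turn (pushoff_velocity D f (side k) (k div 2) (dir k * r))
        (pushoff_velocity D f (side l) (l div 2) (dir l * q)) =
        2 * (- side k) * deriv (f (k div 2)) (dir k * r) * (norm (velocity D (k div 2) (dir k * r)))\<^sup>2"
      using twist_turn[OF i twist(4), of "- side k"] unfolding m twist(1)[symmetric]
      by (simp add: pushoff_velocity_periodic[OF i])
    moreover have "side k \<noteq> 0" using \<epsilon>_pos by (simp add: side_def)
    ultimately show ?thesis using f_simple_zero[OF i twist(4)] velocity_nonzero[OF i] by simp
  next
    case (near s t)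
    then show ?thesis using near_turn[OF near(1) abs_side abs_side near(2,3), of k l] by auto
  qed
  then show ?thesis unfolding velocity_parallel[OF kl(1)] velocity_parallel[OF kl(2)]
    by (simp add: turn_simps dir_def)
qed

text \<open>Partners at a twist are determined by the other copy, and a zero of \<open>f\<close> is
  never near a crossing. If both partners are near crossings, they lie near the same crossing and
  coincide with each other, so \<open>coincidence\<close> applies to them: either they are the same
  point, or the partner curve of \<open>D\<close> would meet itself at one and the same point of the
  circle.\<close>

lemma meets_parallel_unique:
  assumes 1: "meets parallel k r l q" and 2: "meets parallel k r l' q'"
  shows "l = l' \<and> q - q' \<in> \<int>"
proof -
  have kl: "k div 2 < components D" "l div 2 < components D" "l' div 2 < components D"
    using 1 2 component_half by (auto simp: meets_def)
  have same_parity: "l = l'" if "l div 2 = l' div 2" "even l \<longleftrightarrow> even l'"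
    using that by (metis even_two_times_div_two odd_two_times_div_two_succ)
  show ?thesis
    using 1
  proof (cases rule: meets_parallel_cases)
    case twist
    show ?thesis
      using 2
    proof (cases rule: meets_parallel_cases)
      case twist': twist
      have "l = l'" using twist(1,2) twist'(1,2) same_parity
        by (metis even_two_times_div_two odd_two_times_div_two_succ)
      moreover have "dir l * q - dir l' * q' \<in> \<int>"
        using Ints_diff[OF twist'(3) twist(3)] by simp
      ultimately show ?thesis using dir_Ints by simp
    next
      case (near s t)
      then show ?thesis using zero_not_near[OF twist(4)] unfolding nearly_meets_def by blast
    qed
  next
    case (near s t)
    show ?thesis
      using 2
    proof (cases rule: meets_parallel_cases)
      case twist
      then show ?thesis using zero_not_near[OF twist(4)] near unfolding nearly_meets_def by blast
    next
      case near': (near s' t')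
      have "s = s'"
        by (rule near_param_unique[OF param_left[OF near(1)] param_left[OF near'(1)]
              near_window[OF near(2)] near_window[OF near'(2)]])
      then have j: "l div 2 = l' div 2" "t - t' \<in> \<int>" using meets_unique near(1) near'(1) by auto
      obtain m where m: "t = t' + of_int m" using j(2) by (metis Ints_cases diff_eq_eq add.commute)
      have q: "\<bar>(dir l * q - of_int m) - t'\<bar> < \<eta>" using near(3) m by simp
      have eq: "pushoff D f (side l) (l div 2) (dir l * q) = pushoff D f (side l') (l div 2) (dir l' * q')"
        using 1 2 j(1) by (simp add: meets_parallel_iff)
      have t': "crossing_param D (l div 2) t'" using param_right[OF near'(1)] j(1) by simp
      from coincidence[OF kl(2) kl(2) abs_side abs_side eq]
      consider "dir l * q - dir l' * q' \<in> \<int>" "side l = side l' \<or> f (l div 2) (dir l * q) = 0"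
        | "nearly_meets \<eta> (l div 2) (dir l * q) (l div 2) (dir l' * q')" by blast
      then show ?thesis
      proof cases
        case 1
        have "f (l div 2) (dir l * q) > 0" using f_near_pos[OF param_right[OF near(1)] near(3)] .
        then have "side l = side l'" using 1(2) by simp
        then have "even l \<longleftrightarrow> even l'" using \<epsilon>_pos by (auto simp: side_def split: if_splits)
        then have "l = l'" using same_parity j(1) by blast
        then show ?thesis using 1(1) dir_Ints by simp
      next
        case 2
        then obtain a b where ab: "meets D (l div 2) a (l div 2) b"
          "\<bar>dir l * q - a\<bar> < \<eta>" "\<bar>dir l' * q' - b\<bar> < \<eta>" unfolding nearly_meets_def by blast
        have "a = t" by (rule near_param_unique[OF param_left[OF ab(1)] param_right[OF near(1)]
              near_window[OF ab(2)] near_window[OF near(3)]])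
        moreover have "b = t'" by (rule near_param_unique[OF param_right[OF ab(1)] t'
              near_window[OF ab(3)] near_window[OF near'(3)]])
        ultimately show ?thesis using ab(1) j(2) by (simp add: meets_def)
      qed
    qed
  qed
qed

text \<open>Every zero belongs to a twist, each twist has two of them, and only finitely many twists
  reach a bounded range.\<close>

lemma finite_zeros: "i < components D \<Longrightarrow> finite {r. f i r = 0 \<and> \<bar>r\<bar> \<le> R}"
proof (rule finite_subset)
  assume i: "i < components D"
  let ?U = "{t. crossing_param D i t \<and> \<bar>t\<bar> \<le> R + \<delta>}"
  show "{r. f i r = 0 \<and> \<bar>r\<bar> \<le> R} \<subseteq>
      (\<Union>t\<in>{t \<in> ?U. positive_under D i t \<or> negative_under D i t}. twist_zeros D \<delta> f i t)"
  proof safe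
    fix r assume r: "f i r = 0" "\<bar>r\<bar> \<le> R"
    then obtain t where t: "positive_under D i t \<and> t < r \<and> r < t + \<delta> \<or> negative_under D i t \<and> t - \<delta> < r \<and> r < t"
      using f_nonpos[OF i, of r] by auto
    then have u: "positive_under D i t \<or> negative_under D i t" by blast
    show "r \<in> (\<Union>t\<in>{t \<in> ?U. positive_under D i t \<or> negative_under D i t}. twist_zeros D \<delta> f i t)"
    proof (rule UN_I[of t])
      have "\<bar>t\<bar> \<le> R + \<delta>" using t r(2) by linarith
      then show "t \<in> {t \<in> ?U. positive_under D i t \<or> negative_under D i t}"
        using u under_crossing_param[OF u] by blast
      show "r \<in> twist_zeros D \<delta> f i t" using t r(1) unfolding twist_zeros_iff[OF u] by blast
    qed
  qed
  show "finite (\<Union>t\<in>{t \<in> ?U. positive_under D i t \<or> negative_under D i t}. twist_zeros D \<delta> f i t)"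
  proof (rule finite_UN_I)
    show "finite {t \<in> ?U. positive_under D i t \<or> negative_under D i t}"
      by (rule finite_subset[OF _ finite_crossing_params[of i "R + \<delta>"]]) auto
  qed (use finite_twist_zeros(1) in blast)
qed

lemma finite_near:
  assumes "meets D i s j t"
  shows "finite {(r, q). \<bar>dir k * r - s\<bar> < \<eta> \<and> \<bar>dir l * q - t\<bar> < \<eta> \<and>
    pushoff D f (side k) i (dir k * r) = pushoff D f (side l) j (dir l * q)}" (is "finite ?A")
proof -
  have "p = p'" if "p \<in> ?A" "p' \<in> ?A" for p p'
  proof -
    have "dir k * fst p = dir k * fst p' \<and> dir l * snd p = dir l * snd p'"
      using that by (intro near_unique[OF assms abs_side abs_side]) auto
    then show ?thesis by (metis dir_dir prod_eqI)
  qed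
  then have "?A = {} \<or> (\<exists>p. ?A = {p})" by blast
  then show ?thesis by (elim disjE exE) (simp_all only: finite.intros)
qed

lemma finite_meets_parallel:
  "finite {(k, r, l, q). meets parallel k r l q \<and> r \<in> {0..<1} \<and> q \<in> {0..<1}}"
proof (rule finite_subset)
  let ?N = "components parallel"
  let ?M = "{(i, s, j, t). meets D i s j t \<and> \<bar>s\<bar> \<le> 1 + \<delta> \<and> \<bar>t\<bar> \<le> 1 + \<delta>}"
  let ?near = "\<lambda>k l s t. {(r, q). \<bar>dir k * r - s\<bar> < \<eta> \<and> \<bar>dir l * q - t\<bar> < \<eta> \<and>
      pushoff D f (side k) (k div 2) (dir k * r) = pushoff D f (side l) (l div 2) (dir l * q)}"
  let ?Z = "\<lambda>k. (\<lambda>r. dir k * r) ` {r. f (k div 2) r = 0 \<and> \<bar>r\<bar> \<le> 1}"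
  \<comment> \<open>A finite set of candidates: pairs of zeros of \<open>f\<close> for the twists,
    and for each crossing of \<open>D\<close> in a bounded range the at most one nearby crossing of
    the two copies.\<close>
  define A where "A = (\<Union>k<?N. \<Union>l<?N. (\<lambda>(r, q). (k, r, l, q)) ` ((?Z k \<times> ?Z l) \<union>
      (\<Union>(i, s, j, t)\<in>{(i, s, j, t) \<in> ?M. i = k div 2 \<and> j = l div 2}. ?near k l s t)))"
  show "{(k, r, l, q). meets parallel k r l q \<and> r \<in> {0..<1} \<and> q \<in> {0..<1}} \<subseteq> A"
  proof safe
    fix k r l q assume m: "meets parallel k r l q" and "r \<in> {0..<1}" "q \<in> {0..<1}"
    then have r: "\<bar>dir k * r\<bar> \<le> 1" "\<bar>dir l * q\<bar> \<le> 1" by (auto simp: dir_def)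
    have kl: "k < ?N" "l < ?N"
      "pushoff D f (side k) (k div 2) (dir k * r) = pushoff D f (side l) (l div 2) (dir l * q)"
      using m by (auto simp: meets_parallel_iff)
    have "(r, q) \<in> (?Z k \<times> ?Z l) \<union>
      (\<Union>(i, s, j, t)\<in>{(i, s, j, t) \<in> ?M. i = k div 2 \<and> j = l div 2}. ?near k l s t)"
      using m
    proof (cases rule: meets_parallel_cases)
      case twist
      have "f (l div 2) (dir l * q) = 0"
        using f_periodic_Ints[OF component_half[OF kl(1)] twist(3)] twist(1,4) by simp
      then have "q \<in> ?Z l" by (intro image_eqI[of _ _ "dir l * q"]) (use r in simp_all)
      moreover have "r \<in> ?Z k" by (rule image_eqI[of _ _ "dir k * r"]) (use twist(4) r in simp_all)
      ultimately show ?thesis by blast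
    next
      case (near s t)
      then have "\<bar>s\<bar> \<le> 1 + \<delta>" "\<bar>t\<bar> \<le> 1 + \<delta>"
        using r near_window[OF near(2)] near_window[OF near(3)] by linarith+
      then show ?thesis using near kl(3)
        by (intro UnI2 UN_I[of "(k div 2, s, l div 2, t)"]) auto
    qed
    then show "(k, r, l, q) \<in> A" unfolding A_def using kl(1,2)
      by (intro UN_I[of k] UN_I[of l] image_eqI[of _ _ "(r, q)"]) (simp_all only: lessThan_iff prod.case)
  qed
  show "finite A"
    unfolding A_def
  proof (intro finite_UN_I finite_lessThan finite_imageI finite_UnI finite_cartesian_product)
    fix k l assume k: "k \<in> {..<?N}" and l: "l \<in> {..<?N}"
    show "finite {r. f (k div 2) r = 0 \<and> \<bar>r\<bar> \<le> 1}" "finite {r. f (l div 2) r = 0 \<and> \<bar>r\<bar> \<le> 1}"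
      using k l by (auto intro: finite_zeros component_half)
    show "finite {(i, s, j, t) \<in> ?M. i = k div 2 \<and> j = l div 2}"
      by (rule finite_subset[OF _ finite_meets[of "1 + \<delta>"]]) auto
    fix x assume "x \<in> {(i, s, j, t) \<in> ?M. i = k div 2 \<and> j = l div 2}"
    then show "finite (case x of (i, s, j, t) \<Rightarrow> ?near k l s t)"
      using finite_near by auto
  qed
qed

lemma meets_twist:
  assumes "i < components D" "f i z = 0"
  shows "meets parallel (2 * i) z (2 * i + 1) (- z)"
  using assms by (simp add: meets_parallel_iff components_parallel dir_def pushoff_def offset_def)

lemma meets_parallel_near:
  assumes m: "meets D (k div 2) s (l div 2) t" and rq: "\<bar>r - s\<bar> < \<eta>" "\<bar>q - t\<bar> < \<eta>"
    and eq: "pushoff D f (side k) (k div 2) r = pushoff D f (side l) (l div 2) q"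
  shows "meets parallel k (dir k * r) l (dir l * q)"
proof -
  have "\<not> (k = l \<and> dir k * r - dir l * q \<in> \<int>)"
    using m meets_not_close[OF _ near_window[OF rq(1)] near_window[OF rq(2)]] dir_Ints by metis
  then show ?thesis
    using m eq by (auto simp: meets_def curve_parallel components_parallel)
qed

lemma classical_parallel_near:
  assumes c: "classical_crossing D i s (l div 2) t" and rq: "\<bar>r - s\<bar> < \<eta>" "\<bar>q - t\<bar> < \<eta>"
    and eq: "pushoff D f (- \<epsilon>) i r = pushoff D f (side l) (l div 2) q"
  shows "classical_crossing parallel (2 * i) r l (dir l * q)"
proof -
  have m: "meets D (2 * i div 2) s (l div 2) t" "over D i s" "\<not> over D (l div 2) t"
    using c by (auto simp: classical_crossing_def)
  have M: "meets parallel (2 * i) r l (dir l * q)"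
    using meets_parallel_near[OF m(1), of r q] rq eq by (simp add: side_def dir_def)
  have M': "meets parallel l (dir l * q) (2 * i) r" using M meets_sym by blast
  have m': "meets D (l div 2) t (2 * i div 2) s" using m(1) meets_sym by blast
  have "over parallel (2 * i) r"
    using over_parallel_near[OF m(1) _ _ M] rq m(2) by (simp add: dir_def)
  moreover have "\<not> over parallel l (dir l * q)"
    using over_parallel_near[OF m' _ _ M'] rq m(3) by (simp add: dir_def)
  ultimately show ?thesis using M by (simp add: classical_crossing_def)
qed

lemma classical_parallel_twist:
  assumes "twist_cut i z"
  shows "classical_crossing parallel (2 * i) z (2 * i + 1) (- z)"
  using assms meets_twist[OF twist_cut_component twist_cut_zero] right_over_zero twist_cut_zero
  by (simp add: classical_crossing_def over_parallel)

lemma classical_parallel_cases: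
  assumes "classical_crossing parallel k r l q"
  obtains (near) s t where "even k" "classical_crossing D (k div 2) s (l div 2) t"
      "\<bar>r - s\<bar> < \<eta>" "\<bar>dir l * q - t\<bar> < \<eta>"
      "pushoff D f (- \<epsilon>) (k div 2) r = pushoff D f (side l) (l div 2) (dir l * q)"
  | (twist) "even k" "l div 2 = k div 2" "r - dir l * q \<in> \<int>" "twist_cut (k div 2) r"
proof -
  have m: "meets parallel k r l q" "over parallel k r"
    using assms by (auto simp: classical_crossing_def)
  then have "even k" by (simp add: over_parallel)
  then have [simp]: "dir k = 1" "side k = - \<epsilon>" by (auto simp: dir_def side_def)
  show ?thesis
    using m(1)
  proof (cases rule: meets_parallel_cases)
    case twist': twist
    then show ?thesis using twist over_parallel_twist[of k r] m(2) \<open>even k\<close> by simp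
  next
    case near': (near s t)
    then have "over D (k div 2) s" using over_parallel_near[OF near' m(1)] m(2) by simp
    then have "classical_crossing D (k div 2) s (l div 2) t" using over_classical near'(1) by blast
    then show ?thesis using near near' m(1) \<open>even k\<close> by (simp add: meets_parallel_iff)
  qed
qed

lemma over_parallel_meets:
  assumes "k < components parallel" "over parallel k r"
  shows "\<exists>l q. meets parallel k r l q \<and> \<not> over parallel l q"
proof -
  have k: "even k" "right_over (k div 2) r" using assms by (auto simp: over_parallel)
  then have k2: "2 * (k div 2) = k" by simp
  from k(2) show ?thesis
  proof (cases rule: right_over_cases)
    case (1 s j t q h)
    define l where "l = (if h = \<epsilon> then 2 * j + 1 else 2 * j)"
    have "l div 2 = j" "side l = h" using 1(4) by (auto simp: l_def side_def)
    then have "classical_crossing parallel (2 * (k div 2)) r l (dir l * q)"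
      using 1 by (intro classical_parallel_near[of _ s l t]) auto
    then show ?thesis unfolding k2 classical_crossing_def by blast
  next
    case 2
    then show ?thesis using classical_parallel_twist[OF 2] unfolding k2 classical_crossing_def by blast
  qed
qed

theorem virtual_link_diagram_parallel: "virtual_link_diagram parallel"
  unfolding virtual_link_diagram_def
proof (intro conjI allI impI)
  fix k t assume k: "k < components parallel"
  show "smooth (curve parallel k)" by (rule smooth_parallel[OF k])
  obtain l where l: "dir k * (t + of_int 1) = dir k * t + of_int l" using dir_add_int by blast
  then show "curve parallel k (t + 1) = curve parallel k t"
    using pushoff_periodic[OF component_half[OF k]] by (simp add: curve_parallel)
  show "velocity parallel k t \<noteq> 0"
    unfolding velocity_parallel[OF k] using immersed[OF component_half[OF k] abs_side] by (simp add: dir_def)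
  show "over parallel k (t + 1) = over parallel k t"
    using right_over_shift[of _ t 1] by (simp add: over_parallel)
next
  show "finite {(i, s, j, t). meets parallel i s j t \<and> s \<in> {0..<1} \<and> t \<in> {0..<1}}"
    by (rule finite_meets_parallel)
next
  fix i s j t assume "meets parallel i s j t"
  then show "turn (velocity parallel i s) (velocity parallel j t) \<noteq> 0" by (rule transverse_parallel)
next
  fix i s j t k u assume "meets parallel i s j t \<and> meets parallel i s k u"
  then have "j = k \<and> t - u \<in> \<int>" using meets_parallel_unique by blast
  then show "j = k" "t - u \<in> \<int>" by auto
next
  fix i s assume "i < components parallel" "over parallel i s"
  then show "\<exists>j t. meets parallel i s j t \<and> \<not> over parallel j t" by (rule over_parallel_meets)
qed

end


section \<open>The Alexander numbering\<close>

context fine_pushoffs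
begin

text \<open>All crossings of \<open>D\<close> count, also virtual ones and over passages as seen on
  a left copy; the windows of those contain no cut point.\<close>

definition windows :: "nat \<Rightarrow> real set" where
  "windows k = {w. crossing_param D (k div 2) (dir k * w)}"

lemma abs_dir_diff: "\<bar>dir k * r - dir k * w\<bar> = \<bar>r - w\<bar>"
  by (simp add: dir_def abs_minus_commute)

lemma dir_even: "dir (2 * j) = 1" and dir_odd: "dir (Suc (2 * j)) = - 1"
  by (simp_all add: dir_def)

section \<open>Classical crossings on a component of the parallel diagram\<close>

lemma cut_point_parallel_cases:
  assumes "cut_point parallel k r"
  obtains (over) s j t q h where "even k" "classical_crossing D (k div 2) s j t"
      "\<bar>dir k * r - s\<bar> < \<eta>" "\<bar>q - t\<bar> < \<eta>" "\<bar>h\<bar> = \<epsilon>"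
      "pushoff D f (- \<epsilon>) (k div 2) (dir k * r) = pushoff D f h j q"
  | (under) s j t q where "classical_crossing D j t (k div 2) s"
      "\<bar>dir k * r - s\<bar> < \<eta>" "\<bar>q - t\<bar> < \<eta>"
      "pushoff D f (- \<epsilon>) j q = pushoff D f (side k) (k div 2) (dir k * r)"
  | (twist) "twist_cut (k div 2) (dir k * r)"
proof -
  consider l q where "classical_crossing parallel k r l q" | l q where "classical_crossing parallel l q k r"
    using assms unfolding cut_point_def by blast
  then show ?thesis
  proof cases
    case 1
    then show ?thesis
    proof (cases rule: classical_parallel_cases)
      case (near s t)
      then show ?thesis using over[of s "l div 2" t "dir l * q" "side l"] by (simp add: dir_def)
    next
      case twist': twist
      then show ?thesis using twist by (simp add: dir_def)
    qed
  next
    case 2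
    then show ?thesis
    proof (cases rule: classical_parallel_cases)
      case (near t s)
      then show ?thesis using under[of "l div 2" t s q] by simp
    next
      case twist': twist
      then obtain m where "q = dir k * r + of_int m" by (metis Ints_cases diff_eq_eq add.commute)
      then show ?thesis using twist twist' twist_cut_shift by simp
    qed
  qed
qed

lemma over_not_under:
  assumes "classical_crossing D i s j t" "classical_crossing D j' t' i s"
  shows False
  using assms by (simp add: classical_crossing_def)

lemma cut_point_over:
  assumes s: "crossing_param D (k div 2) s" and not_under: "\<not> (\<exists>j t. classical_crossing D j t (k div 2) s)"
    and r: "\<bar>dir k * r - s\<bar> < \<delta>" "cut_point parallel k r"
  obtains j t q h where "even k" "classical_crossing D (k div 2) s j t"
      "\<bar>dir k * r - s\<bar> < \<eta>" "\<bar>q - t\<bar> < \<eta>" "\<bar>h\<bar> = \<epsilon>"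
      "pushoff D f (- \<epsilon>) (k div 2) (dir k * r) = pushoff D f h j q"
  using r(2)
proof (cases rule: cut_point_parallel_cases)
  case (over s' j t q h)
  then have "crossing_param D (k div 2) s'" using param_left by (auto simp: classical_crossing_def)
  then have "s' = s" using near_param_unique[OF _ s near_window[OF over(3)] r(1)] by blast
  then show ?thesis using over that by blast
next
  case (under s' j t)
  then have "crossing_param D (k div 2) s'" using param_right by (auto simp: classical_crossing_def)
  then have "s' = s" using near_param_unique[OF _ s near_window[OF under(2)] r(1)] by blast
  then show ?thesis using under(1) not_under by blast
next
  case twist
  then obtain t where t: "positive_under D (k div 2) t \<or> negative_under D (k div 2) t" "\<bar>dir k * r - t\<bar> < \<delta>"
    by (rule twist_cut_window)
  then have "t = s" using near_param_unique[OF under_crossing_param s t(2) r(1)] by blast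
  then show ?thesis using t(1) not_under under_iff by blast
qed

lemma cut_point_under:
  assumes s: "classical_crossing D j t (k div 2) s"
    and r: "\<bar>dir k * r - s\<bar> < \<delta>" "cut_point parallel k r"
  obtains q where "\<bar>dir k * r - s\<bar> < \<eta>" "\<bar>q - t\<bar> < \<eta>"
      "pushoff D f (- \<epsilon>) j q = pushoff D f (side k) (k div 2) (dir k * r)"
  | "dir k * r = (if positive_under D (k div 2) s then Min else Max) (twist_zeros D \<delta> f (k div 2) s)"
proof -
  have param: "crossing_param D (k div 2) s" using s param_right by (auto simp: classical_crossing_def)
  show thesis
    using r(2)
  proof (cases rule: cut_point_parallel_cases)
    case (over s' j' t' q h)
    then have "crossing_param D (k div 2) s'" using param_left by (auto simp: classical_crossing_def)
    then have "s' = s" using near_param_unique[OF _ param near_window[OF over(3)] r(1)] by blast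
    then show ?thesis using over(2) s over_not_under by blast
  next
    case (under s' j' t' q)
    then have "crossing_param D (k div 2) s'" using param_right by (auto simp: classical_crossing_def)
    then have "s' = s" using near_param_unique[OF _ param near_window[OF under(2)] r(1)] by blast
    then have "j' = j \<and> t' - t \<in> \<int>" using under(1) s classical_unique by blast
    then obtain m where m: "j' = j" "t' = t + of_int m" by (metis Ints_cases diff_eq_eq add.commute)
    have j: "j < components D" using s by (auto simp: classical_crossing_def meets_def)
    have "pushoff D f (- \<epsilon>) j (q - of_int m) = pushoff D f (- \<epsilon>) j q"
      using pushoff_periodic[OF j, of _ "q - of_int m" m] by simp
    then show ?thesis
      using that(1)[of "q - of_int m"] under m \<open>s' = s\<close> by (simp add: algebra_simps)
  next
    case twist
    then obtain u where u: "positive_under D (k div 2) u \<or> negative_under D (k div 2) u" "\<bar>dir k * r - u\<bar> < \<delta>"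
      "dir k * r = (if positive_under D (k div 2) u then Min else Max) (twist_zeros D \<delta> f (k div 2) u)"
      by (rule twist_cut_window)
    then have "u = s" using near_param_unique[OF under_crossing_param param u(2) r(1)] by blast
    then show ?thesis using u(3) that(2) by blast
  qed
qed

lemma turn_parallel_near:
  assumes m: "meets D (k div 2) s (l div 2) t" and rq: "\<bar>r - s\<bar> < \<eta>" "\<bar>q - t\<bar> < \<eta>"
  shows "0 < turn (velocity parallel k (dir k * r)) (velocity parallel l (dir l * q)) *
    (dir k * dir l * turn (velocity D (k div 2) s) (velocity D (l div 2) t))"
proof -
  have kl: "k < components parallel" "l < components parallel"
    using m by (auto simp: components_parallel meets_def)
  show ?thesis
    using near_turn[OF m abs_side abs_side rq, of k l]
    unfolding velocity_parallel[OF kl(1)] velocity_parallel[OF kl(2)]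
    by (simp add: turn_simps dir_def)
qed

text \<open>Reversing the left copy changes the sign in \<open>twist_turn\<close>, so the
  determinant is opposite in sign to the derivative of \<open>f\<close>. Strictness is supplied at
  the point of use by transversality.\<close>

lemma turn_parallel_twist:
  assumes "i < components D" "f i z = 0"
  shows "turn (velocity parallel (2 * i) z) (velocity parallel (2 * i + 1) (- z)) * deriv (f i) z \<le> 0"
proof -
  have kl: "2 * i < components parallel" "2 * i + 1 < components parallel"
    using assms by (auto simp: components_parallel)
  have "turn (velocity parallel (2 * i) z) (velocity parallel (2 * i + 1) (- z)) =
      - (2 * \<epsilon> * deriv (f i) z * (norm (velocity D i z))\<^sup>2)"
    using twist_turn[OF assms, of \<epsilon>]
    unfolding velocity_parallel[OF kl(1)] velocity_parallel[OF kl(2)]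
    by (simp add: turn_simps dir_def side_def)
  then have "turn (velocity parallel (2 * i) z) (velocity parallel (2 * i + 1) (- z)) * deriv (f i) z =
      - (2 * \<epsilon> * (deriv (f i) z)\<^sup>2 * (norm (velocity D i z))\<^sup>2)"
    by (simp add: power2_eq_square)
  then show ?thesis using \<epsilon>_pos by simp
qed

lemma cut_signs:
  assumes "crosses_classically parallel k r l q"
  shows "0 < turn (velocity parallel k r) (velocity parallel l q) \<Longrightarrow> down_cut parallel k r \<and> up_cut parallel l q"
    and "turn (velocity parallel k r) (velocity parallel l q) < 0 \<Longrightarrow> up_cut parallel k r \<and> down_cut parallel l q"
  using assms crosses_classically_sym[of parallel k r l q]
    turn_swap[of "velocity parallel k r" "velocity parallel l q"]
  unfolding up_cut_def down_cut_def by (smt (verit))+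

text \<open>The determinants at the two copies of the under strand have opposite signs, because the
  left copy is reversed. \<open>near_order\<close> tells which copy is met first, and its answer
  depends on \<open>T\<close> in the same way as the signs do, so the rising crossing always
  precedes.\<close>

lemma window_over:
  assumes c: "classical_crossing D (k div 2) s j t" and "even k"
  shows "\<exists>a b. a < b \<and> \<bar>dir k * a - s\<bar> < \<delta> \<and> \<bar>dir k * b - s\<bar> < \<delta> \<and> up_cut parallel k a \<and> down_cut parallel k b \<and>
    (\<forall>r. \<bar>dir k * r - s\<bar> < \<delta> \<and> cut_point parallel k r \<longrightarrow> r = a \<or> r = b)"
proof -
  define i where "i = k div 2"
  have k: "k = 2 * i" "dir k = 1" "side k = - \<epsilon>" using \<open>even k\<close> by (auto simp: i_def dir_def side_def)
  have m: "meets D i s j t" using c by (simp add: classical_crossing_def i_def)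
  have j: "j < components D" using m by (simp add: meets_def)
  have abs: "\<bar>- \<epsilon>\<bar> = \<epsilon>" "\<bar>\<epsilon>\<bar> = \<epsilon>" using \<epsilon>_pos by auto
  define T where "T = turn (velocity D i s) (velocity D j t)"
  obtain r q where rq: "\<bar>r - s\<bar> < \<eta>" "\<bar>q - t\<bar> < \<eta>" "pushoff D f (- \<epsilon>) i r = pushoff D f (- \<epsilon>) j q"
    using near_exists[OF m abs(1,1)] by blast
  obtain r' q' where rq': "\<bar>r' - s\<bar> < \<eta>" "\<bar>q' - t\<bar> < \<eta>" "pushoff D f (- \<epsilon>) i r' = pushoff D f \<epsilon> j q'"
    using near_exists[OF m abs(1,2)] by blast
  have order: "0 < (r - r') * T" unfolding T_def by (rule near_order[OF m abs(1) rq rq'])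
  have cr: "crosses_classically parallel k r (2 * j) q"
    using classical_parallel_near[of i s "2 * j" t r q] c rq
    by (simp add: crosses_classically_def i_def[symmetric] dir_def side_def k(1))
  have cr': "crosses_classically parallel k r' (2 * j + 1) (- q')"
    using classical_parallel_near[of i s "2 * j + 1" t r' q'] c rq'
    by (simp add: crosses_classically_def i_def[symmetric] dir_def side_def k(1))
  have sgn: "0 < turn (velocity parallel k r) (velocity parallel (2 * j) q) * T"
    using turn_parallel_near[of k s "2 * j" t r q] m rq
    by (simp add: T_def i_def[symmetric] k(2) dir_even)
  have sgn': "turn (velocity parallel k r') (velocity parallel (2 * j + 1) (- q')) * T < 0"
    using turn_parallel_near[of k s "2 * j + 1" t r' q'] m rq'
    by (simp add: T_def i_def[symmetric] k(2) dir_odd)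
  have only: "x = r \<or> x = r'" if x: "\<bar>dir k * x - s\<bar> < \<delta>" "cut_point parallel k x" for x
  proof -
    have "\<not> (\<exists>j t. classical_crossing D j t (k div 2) s)" using c over_not_under by blast
    from cut_point_over[OF param_left[OF m, unfolded i_def] this x]
    obtain j' t' p h where x': "classical_crossing D i s j' t'" "\<bar>x - s\<bar> < \<eta>" "\<bar>p - t'\<bar> < \<eta>" "\<bar>h\<bar> = \<epsilon>"
      "pushoff D f (- \<epsilon>) i x = pushoff D f h j' p" by (metis i_def k(2) mult_1)
    \<comment> \<open>The crossing is known only modulo an integer shift of the partner; moving
      \<open>p\<close> by that integer makes \<open>near_unique\<close> applicable.\<close>
    have "j' = j \<and> t' - t \<in> \<int>" using x'(1) m meets_unique by (auto simp: classical_crossing_def)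
    then obtain l where l: "j' = j" "t' = t + of_int l" by (metis Ints_cases diff_eq_eq add.commute)
    have p: "\<bar>(p - of_int l) - t\<bar> < \<eta>" "pushoff D f (- \<epsilon>) i x = pushoff D f h j (p - of_int l)"
      using x'(3,5) l pushoff_periodic[OF j, of h "p - of_int l" l] by (auto simp: algebra_simps)
    consider "h = - \<epsilon>" | "h = \<epsilon>" using x'(4) by linarith
    then show ?thesis
    proof cases
      case 1
      then show ?thesis using near_unique[OF m abs(1,1) x'(2) p(1) _ rq] p(2) by blast
    next
      case 2
      then show ?thesis using near_unique[OF m abs(1,2) x'(2) p(1) _ rq'] p(2) by blast
    qed
  qed
  have win: "\<bar>dir k * r - s\<bar> < \<delta>" "\<bar>dir k * r' - s\<bar> < \<delta>"
    using near_window[OF rq(1)] near_window[OF rq'(1)] k by auto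
  show ?thesis
  proof (cases "T > 0")
    case True
    then have "r' < r" "up_cut parallel k r'" "down_cut parallel k r"
      using order cut_signs[OF cr] cut_signs[OF cr'] sgn sgn'
      by (auto simp: zero_less_mult_iff mult_less_0_iff)
    then show ?thesis using win only by (intro exI[of _ r'] exI[of _ r]) auto
  next
    case False
    then have "r < r'" "up_cut parallel k r" "down_cut parallel k r'"
      using order cut_signs[OF cr] cut_signs[OF cr'] sgn sgn'
      by (auto simp: zero_less_mult_iff mult_less_0_iff)
    then show ?thesis using win only by (intro exI[of _ r] exI[of _ r']) auto
  qed
qed

text \<open>Copy \<open>k\<close> passes below the right copy of the over strand at \<open>x\<close>
  and has the classical crossing of its twist at \<open>z\<close>, in parameters of
  \<open>D\<close>. The sign \<open>T\<close> of the crossing decides both the side of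
  \<open>x\<close> on which \<open>z\<close> lies and the sign at the twist. For odd
  \<open>k\<close> the order is reversed and the role at each crossing is the other one, so the
  result holds for every sign and side.\<close>

lemma window_under:
  assumes c: "classical_crossing D j t (k div 2) s"
  shows "\<exists>a b. a < b \<and> \<bar>dir k * a - s\<bar> < \<delta> \<and> \<bar>dir k * b - s\<bar> < \<delta> \<and> up_cut parallel k a \<and> down_cut parallel k b \<and>
    (\<forall>r. \<bar>dir k * r - s\<bar> < \<delta> \<and> cut_point parallel k r \<longrightarrow> r = a \<or> r = b)"
proof -
  define i where "i = k div 2"
  have m: "meets D j t i s" using c by (simp add: classical_crossing_def i_def)
  have i: "i < components D" using m by (simp add: meets_def)
  have abs: "\<bar>- \<epsilon>\<bar> = \<epsilon>" using \<epsilon>_pos by auto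
  define T where "T = turn (velocity D j t) (velocity D i s)"
  have T: "T \<noteq> 0" unfolding T_def by (rule meets_transverse[OF m])
  obtain q x where qx: "\<bar>q - t\<bar> < \<eta>" "\<bar>x - s\<bar> < \<eta>" "pushoff D f (- \<epsilon>) j q = pushoff D f (side k) i x"
    using near_exists[OF m abs abs_side] by blast
  have pos: "positive_under D i s \<longleftrightarrow> T > 0"
  proof
    assume "positive_under D i s"
    then obtain j' t' where p: "positive_crossing D j' t' i s" unfolding positive_under_def by blast
    then have "j' = j \<and> t' - t \<in> \<int>" using c classical_unique by (auto simp: positive_crossing_def i_def)
    then obtain l where "j' = j" "t' = t + of_int l" by (metis Ints_cases diff_eq_eq add.commute)
    then have "positive_crossing D j t i s" using p positive_shift[of j t l i s 0] by simp
    then show "T > 0" by (simp add: positive_crossing_def T_def)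
  next
    assume "T > 0"
    then show "positive_under D i s" using c unfolding positive_under_def positive_crossing_def T_def i_def by blast
  qed
  define z where "z = (if positive_under D i s then Min else Max) (twist_zeros D \<delta> f i s)"
  have neg: "negative_under D i s" if "\<not> T > 0"
    using c that pos under_iff[of i s] unfolding i_def by blast
  have z: "twist_cut i z" "\<bar>z - s\<bar> < \<delta>" "deriv (f i) z * T < 0" "0 < (z - x) * T"
  proof -
    have "twist_cut i z \<and> \<bar>z - s\<bar> < \<delta> \<and> deriv (f i) z * T < 0 \<and> 0 < (z - s) * T"
    proof (cases "T > 0")
      case True
      then have p: "positive_under D i s" "z = Min (twist_zeros D \<delta> f i s)" using pos by (auto simp: z_def)
      from positive_twist_cut[OF p] p True show ?thesis
        by (auto simp: twist_cut_def mult_less_0_iff)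
    next
      case False
      then have p: "negative_under D i s" "z = Max (twist_zeros D \<delta> f i s)" using pos neg by (auto simp: z_def)
      from negative_twist_cut[OF p] p False T show ?thesis
        by (auto simp: twist_cut_def mult_less_0_iff zero_less_mult_iff)
    qed
    note * = this
    then show "twist_cut i z" "\<bar>z - s\<bar> < \<delta>" "deriv (f i) z * T < 0" by auto
    \<comment> \<open>\<open>f\<close> vanishes at \<open>z\<close> but is positive within
      \<open>\<eta>\<close> of \<open>s\<close>. So \<open>z\<close> is farther from
      \<open>s\<close> than \<open>x\<close> is, and \<open>z - x\<close> has the sign of
      \<open>z - s\<close>.\<close>
    have "\<not> \<bar>z - s\<bar> < \<eta>"
      using f_near_pos[OF param_right[OF m]] twist_cut_zero * by force
    then show "0 < (z - x) * T" using * qx(2) by (auto simp: zero_less_mult_iff)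
  qed
  have cx: "crosses_classically parallel (2 * j) q k (dir k * x)"
    using classical_parallel_near[of j t k s q x] c qx
    by (simp add: crosses_classically_def i_def[symmetric] abs_minus_commute)
  have sx: "0 < turn (velocity parallel (2 * j) q) (velocity parallel k (dir k * x)) * (dir k * T)"
    using turn_parallel_near[of "2 * j" t k s q x] m qx by (simp add: T_def i_def[symmetric] dir_def)
  have cz: "crosses_classically parallel (2 * i) z (2 * i + 1) (- z)"
    using classical_parallel_twist[OF z(1)] by (simp add: crosses_classically_def)
  have mz: "meets parallel (2 * i) z (2 * i + 1) (- z)"
    by (rule meets_twist[OF i twist_cut_zero[OF z(1)]])
  have sz: "0 < turn (velocity parallel (2 * i) z) (velocity parallel (2 * i + 1) (- z)) * T"
    using turn_parallel_twist[OF i twist_cut_zero[OF z(1)]] z(3) transverse_parallel[OF mz]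
    by (auto simp: zero_less_mult_iff mult_less_0_iff mult_le_0_iff)
  have only: "r = dir k * x \<or> r = dir k * z" if r: "\<bar>dir k * r - s\<bar> < \<delta>" "cut_point parallel k r" for r
  proof -
    have "dir k * r = x \<or> dir k * r = z"
      using c r
    proof (cases rule: cut_point_under)
      case (1 p)
      then show ?thesis using near_unique[OF m abs abs_side 1(2) 1(1) _ qx] by (simp add: i_def)
    next
      case 2
      then show ?thesis by (simp add: z_def i_def)
    qed
    then show ?thesis using dir_dir by metis
  qed
  have win: "\<bar>dir k * (dir k * x) - s\<bar> < \<delta>" "\<bar>dir k * (dir k * z) - s\<bar> < \<delta>"
    using near_window[OF qx(2)] z(2) by auto
  \<comment> \<open>This condition says that copy \<open>k\<close>, in its own direction, reaches
    the crossing below the over strand before the twist.\<close>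
  have "(T > 0 \<longleftrightarrow> even k) \<Longrightarrow> dir k * x < dir k * z \<and> up_cut parallel k (dir k * x) \<and> down_cut parallel k (dir k * z)"
  proof (cases "even k")
    case True
    assume "T > 0 \<longleftrightarrow> even k"
    then have "T > 0" using True by simp
    have k: "k = 2 * i" "dir k = 1" using True by (auto simp: i_def dir_def)
    show ?thesis using z(4) sx sz cut_signs(1)[OF cx] cut_signs(1)[OF cz] \<open>T > 0\<close> k
      by (auto simp: zero_less_mult_iff)
  next
    case False
    assume "T > 0 \<longleftrightarrow> even k"
    then have "T < 0" using False T by simp
    have k: "k = 2 * i + 1" "dir k = - 1" using False by (auto simp: i_def dir_def)
    show ?thesis using z(4) sx sz cut_signs(1)[OF cx] cut_signs(2)[OF cz] \<open>T < 0\<close> k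
      by (auto simp: zero_less_mult_iff)
  qed
  moreover have "\<not> (T > 0 \<longleftrightarrow> even k) \<Longrightarrow>
      dir k * z < dir k * x \<and> up_cut parallel k (dir k * z) \<and> down_cut parallel k (dir k * x)"
  proof (cases "even k")
    case True
    assume "\<not> (T > 0 \<longleftrightarrow> even k)"
    then have "T < 0" using True T by simp
    have k: "k = 2 * i" "dir k = 1" using True by (auto simp: i_def dir_def)
    show ?thesis using z(4) sx sz cut_signs(2)[OF cx] cut_signs(2)[OF cz] \<open>T < 0\<close> k
      by (auto simp: zero_less_mult_iff)
  next
    case False
    assume "\<not> (T > 0 \<longleftrightarrow> even k)"
    then have "T > 0" using False by simp
    have k: "k = 2 * i + 1" "dir k = - 1" using False by (auto simp: i_def dir_def)
    show ?thesis using z(4) sx sz cut_signs(2)[OF cx] cut_signs(1)[OF cz] \<open>T > 0\<close> k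
      by (auto simp: zero_less_mult_iff)
  qed
  ultimately show ?thesis using win only by blast
qed

sublocale parallel_diagram: link_diagram parallel
  by unfold_locales (rule virtual_link_diagram_parallel)

sublocale numbering: paired_cut_points parallel \<delta> windows
proof
  show "0 < \<delta>" by (rule \<delta>_pos)
  show "finite {w \<in> windows k. \<bar>w\<bar> \<le> R}" for k R
  proof (rule finite_subset)
    show "{w \<in> windows k. \<bar>w\<bar> \<le> R} \<subseteq> (\<lambda>s. dir k * s) ` {s. crossing_param D (k div 2) s \<and> \<bar>s\<bar> \<le> R}"
    proof
      fix w assume "w \<in> {w \<in> windows k. \<bar>w\<bar> \<le> R}"
      then show "w \<in> (\<lambda>s. dir k * s) ` {s. crossing_param D (k div 2) s \<and> \<bar>s\<bar> \<le> R}"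
        by (intro image_eqI[of _ _ "dir k * w"]) (auto simp: windows_def dir_def)
    qed
  qed (intro finite_imageI finite_crossing_params)
  show "w = w'" if "w \<in> windows k" "w' \<in> windows k" "\<bar>w - w'\<bar> < 2 * \<delta>" for k w w'
    using separated[of "k div 2" "dir k * w" "dir k * w'"] that dir_dir
    unfolding windows_def abs_dir_diff mem_Collect_eq by metis
  show "w + of_int m \<in> windows k" if "w \<in> windows k" for w m k
    using that dir_add_int[of k w m] crossing_param_shift unfolding windows_def by auto
  show "\<exists>w\<in>windows k. \<bar>r - w\<bar> < \<delta>" if "cut_point parallel k r" for k r
  proof -
    have "\<exists>s. crossing_param D (k div 2) s \<and> \<bar>dir k * r - s\<bar> < \<delta>"
      using that
    proof (cases rule: cut_point_parallel_cases)
      case (over s)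
      then show ?thesis
        by (intro exI[of _ s] conjI near_window) (auto simp: classical_crossing_def intro: param_left)
    next
      case (under s)
      then show ?thesis
        by (intro exI[of _ s] conjI near_window) (auto simp: classical_crossing_def intro: param_right)
    next
      case twist
      then show ?thesis using twist_cut_window under_crossing_param by metis
    qed
    then obtain s where "crossing_param D (k div 2) s" "\<bar>dir k * r - s\<bar> < \<delta>" by blast
    then show ?thesis using abs_dir_diff[of k r "dir k * s"]
      by (intro bexI[of _ "dir k * s"]) (auto simp: windows_def)
  qed
  show "(\<forall>r. \<bar>r - w\<bar> < \<delta> \<longrightarrow> \<not> cut_point parallel k r) \<or>
      (\<exists>a b. a < b \<and> \<bar>a - w\<bar> < \<delta> \<and> \<bar>b - w\<bar> < \<delta> \<and> up_cut parallel k a \<and> down_cut parallel k b \<and>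
        (\<forall>r. \<bar>r - w\<bar> < \<delta> \<and> cut_point parallel k r \<longrightarrow> r = a \<or> r = b))"
    if w: "w \<in> windows k" for k w
  proof -
    define s where "s = dir k * w"
    have s: "crossing_param D (k div 2) s" using w by (simp add: windows_def s_def)
    have eq: "\<bar>r - w\<bar> = \<bar>dir k * r - s\<bar>" for r by (simp add: s_def abs_dir_diff)
    show ?thesis unfolding eq
    proof (cases "\<exists>j t. classical_crossing D j t (k div 2) s")
      case True
      then show "(\<forall>r. \<bar>dir k * r - s\<bar> < \<delta> \<longrightarrow> \<not> cut_point parallel k r) \<or>
        (\<exists>a b. a < b \<and> \<bar>dir k * a - s\<bar> < \<delta> \<and> \<bar>dir k * b - s\<bar> < \<delta> \<and> up_cut parallel k a \<and> down_cut parallel k b \<and>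
        (\<forall>r. \<bar>dir k * r - s\<bar> < \<delta> \<and> cut_point parallel k r \<longrightarrow> r = a \<or> r = b))"
        by (elim exE) (rule disjI2, rule window_under)
    next
      case not_under: False
      show "(\<forall>r. \<bar>dir k * r - s\<bar> < \<delta> \<longrightarrow> \<not> cut_point parallel k r) \<or>
        (\<exists>a b. a < b \<and> \<bar>dir k * a - s\<bar> < \<delta> \<and> \<bar>dir k * b - s\<bar> < \<delta> \<and> up_cut parallel k a \<and> down_cut parallel k b \<and>
        (\<forall>r. \<bar>dir k * r - s\<bar> < \<delta> \<and> cut_point parallel k r \<longrightarrow> r = a \<or> r = b))"
      \<comment> \<open>At an over passage only the right copy has classical crossings; the left
        copy meets both copies of the under strand virtually.\<close>
      proof (cases "even k \<and> (\<exists>j t. classical_crossing D (k div 2) s j t)")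
        case True
        then obtain j t where "classical_crossing D (k div 2) s j t" "even k" by blast
        then show ?thesis by (intro disjI2 window_over)
      next
        case False
        then have "\<not> cut_point parallel k r" if "\<bar>dir k * r - s\<bar> < \<delta>" for r
          using cut_point_over[OF s not_under that] by blast
        then show ?thesis by blast
      qed
    qed
  qed
qed

theorem parallel_almost_classical:
  "virtual_link_diagram parallel \<and> admits_alexander_numbering parallel \<and>
   almost_classical (welded_link parallel)"
  using virtual_link_diagram_parallel numbering.alexander_numbering
  unfolding admits_alexander_numbering_def almost_classical_def welded_link_def
  by (blast intro: equivclp_refl)

end

theorem theorem4p1:
  fixes D :: virtual_diagram
  assumes "virtual_link_diagram D"
  shows "(\<exists>\<delta> f. twist_profile D \<delta> f) \<and>
    (\<forall>\<delta> f. twist_profile D \<delta> f \<longrightarrow>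
      (\<forall>\<^sub>F \<epsilon> in at_right 0.
         virtual_link_diagram (phi_minus D \<delta> f \<epsilon>) \<and>
         admits_alexander_numbering (phi_minus D \<delta> f \<epsilon>) \<and>
         almost_classical (welded_link (phi_minus D \<delta> f \<epsilon>))))"
proof (intro conjI allI impI)
  interpret link_diagram D by unfold_locales (rule assms)
  show "\<exists>\<delta> f. twist_profile D \<delta> f" by (rule twist_profile_exists)
  fix \<delta> f assume "twist_profile D \<delta> f"
  then interpret twisted_diagram D \<delta> f by unfold_locales
  show "\<forall>\<^sub>F \<epsilon> in at_right 0.
      virtual_link_diagram (phi_minus D \<delta> f \<epsilon>) \<and>
      admits_alexander_numbering (phi_minus D \<delta> f \<epsilon>) \<and>
      almost_classical (welded_link (phi_minus D \<delta> f \<epsilon>))"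
    using eventually_fine
  proof eventually_elim
    case (elim \<epsilon>)
    then obtain \<eta> where "fine_pushoffs D \<delta> f \<epsilon> \<eta>" ..
    then show ?case by (rule fine_pushoffs.parallel_almost_classical)
  qed
qed

end
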